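(* Let $(\phi_h^1,\mu_h^{1/2})\in S_h\times S_h$ be the unique solution of the first-step problem and, for $1\le m\le M-1$, let $(\phi_h^{m+1},\mu_h^{m+1/2})\in S_h\times S_h$ be the unique solution of the multistep problem (both problems are written out in the context). Assume that there is a constant $C_0>0$, independent of $h$ and $\tau$, with $$E(\phi_h^0)+\tau^2\|\Delta_h\mu_h^0\|_{L^2}^2+\|\Delta_h\phi_h^0\|_{L^2}^2\le C_0 ,$$ and that $\|\mu_h^0\|_{L^2}^2\le C_0$, independent of $h$. Then there is a constant $C>0$, independent of $h$, $\tau$ and $T$, such that for any $h,\tau>0$: $$\tau\sum_{m=0}^{M-1}\Big\|\frac{\phi_h^{m+1}-\phi_h^m}{\tau}\Big\|_{L^2}^2\le C(T+1),$$ $$\max_{0\le m\le M-1}\|\mu_h^{m+1/2}\|_{L^2}^2\le C(T+1).$$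
   Context: $\Omega\subset\mathbb{R}^d$, $d\in\{2,3\}$, is an open polygonal or polyhedral domain; $\varepsilon>0$ is fixed (constants may depend on $\varepsilon$, $\Omega$, $q$, the mesh-regularity constants and $C_0$); $(\cdot,\cdot)$ is the $L^2(\Omega)$ inner product and $a(u,v):=(\nabla u,\nabla v)$. $T>0$, $M$ is a positive integer, $\tau=T/M$. $\{\mathcal{T}_h\}$ is a conforming, shape-regular, quasi-uniform family of triangulations of $\Omega$, $q\ge1$ is an integer, $S_h:=\{v\in C^0(\Omega): v|_K\in\mathcal{P}_q(K)\ \forall K\in\mathcal{T}_h\}\subset H^1(\Omega)$, $\mathring S_h:=S_h\cap L^2_0(\Omega)$ (zero-mean functions). The discrete Laplacian $\Delta_h:S_h\to\mathring S_h$ is defined by $(\Delta_hv_h,\xi)=-a(v_h,\xi)$ for all $\xi\in S_h$. The energy is $E(\phi)=\int_\Omega\{\frac1{4\varepsilon}(\phi^2-1)^2+\frac{\varepsilon}{2}|\nabla\phi|^2\}dx$. The nonlinearity is $\chi(u,v):=\tfrac12(u^2+v^2)\cdot\tfrac12(u+v)$. Initial data: $\phi_h^0=R_h\phi_0$, $\mu_h^0=R_h\mu_0$, with $\phi_0\in H^2(\Omega)$, $\partial_n\phi_0=0$ on $\partial\Omega$, $\mu_0:=\varepsilon^{-1}(\phi_0^3-\phi_0)-\varepsilon\Delta\phi_0\in H^1(\Omega)$, where the Ritz projection $R_h:H^1(\Omega)\to S_h$ is defined by $a(R_h\phi-\phi,\xi)=0$ for all $\xi\in S_h$ and $(R_h\phi-\phi,1)=0$.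 First-step problem: find $\phi_h^1,\mu_h^{1/2}\in S_h$ such that for all $\nu,\psi\in S_h$: $\big(\tfrac{\phi_h^1-\phi_h^0}{\tau},\nu\big)+\varepsilon a(\mu_h^{1/2},\nu)=0$ and $\varepsilon^{-1}(\chi(\phi_h^1,\phi_h^0),\psi)-\varepsilon^{-1}(\phi_h^0,\psi)+\tfrac{\tau}{2}a(\mu_h^0,\psi)+\varepsilon a(\tfrac12\phi_h^1+\tfrac12\phi_h^0,\psi)-(\mu_h^{1/2},\psi)=0$. Multistep problem ($1\le m\le M-1$): given $\phi_h^m,\phi_h^{m-1}$, find $\phi_h^{m+1},\mu_h^{m+1/2}\in S_h$ such that for all $\nu,\psi\in S_h$: $\big(\tfrac{\phi_h^{m+1}-\phi_h^m}{\tau},\nu\big)+\varepsilon a(\mu_h^{m+1/2},\nu)=0$ and $\varepsilon^{-1}(\chi(\phi_h^{m+1},\phi_h^m),\psi)-\varepsilon^{-1}(\tfrac32\phi_h^m-\tfrac12\phi_h^{m-1},\psi)+\varepsilon a(\tfrac34\phi_h^{m+1}+\tfrac14\phi_h^{m-1},\psi)-(\mu_h^{m+1/2},\psi)=0$. Both problems are uniquely solvable. *)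

theory Defs
  imports "HOL-Analysis.Analysis"
begin

section \<open>Smooth functions and Sobolev spaces\<close>

definition partial_deriv :: "'n \<Rightarrow> (real^'n \<Rightarrow> real) \<Rightarrow> real^'n \<Rightarrow> real" where
  "partial_deriv i f x = frechet_derivative f (at x) (axis i 1)"

text \<open>Differentiability of every iterated partial derivative makes every iterated partial
  derivative continuous, so this is \<open>C\<^sup>\<infinity>\<close> on the whole space.\<close>

definition smooth :: "(real^'n \<Rightarrow> real) \<Rightarrow> bool" where
  "smooth f \<longleftrightarrow> (\<forall>js. foldr partial_deriv js f differentiable_on UNIV)"

definition test_function :: "(real^'n) set \<Rightarrow> (real^'n \<Rightarrow> real) \<Rightarrow> bool" where
  "test_function \<Omega> \<psi> \<longleftrightarrow>
     smooth \<psi> \<and> (\<exists>K. compact K \<and> K \<subseteq> \<Omega> \<and> (\<forall>x. x \<notin> K \<longrightarrow> \<psi> x = 0))"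

definition L2 :: "(real^'n) set \<Rightarrow> (real^'n \<Rightarrow> real) set" where
  "L2 \<Omega> = {u. u \<in> borel_measurable (lebesgue_on \<Omega>) \<and>
              integrable (lebesgue_on \<Omega>) (\<lambda>x. (u x)\<^sup>2)}"

definition L2_inner :: "(real^'n) set \<Rightarrow> (real^'n \<Rightarrow> real) \<Rightarrow> (real^'n \<Rightarrow> real) \<Rightarrow> real" where
  "L2_inner \<Omega> u v = (LINT x|lebesgue_on \<Omega>. u x * v x)"

definition L2_norm :: "(real^'n) set \<Rightarrow> (real^'n \<Rightarrow> real) \<Rightarrow> real" where
  "L2_norm \<Omega> u = sqrt (L2_inner \<Omega> u u)"

definition has_weak_gradient ::
  "(real^'n) set \<Rightarrow> (real^'n \<Rightarrow> real) \<Rightarrow> (real^'n \<Rightarrow> real^'n) \<Rightarrow> bool" where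
  "has_weak_gradient \<Omega> u g \<longleftrightarrow>
     u \<in> L2 \<Omega> \<and> (\<forall>i. (\<lambda>x. g x $ i) \<in> L2 \<Omega>) \<and>
     (\<forall>\<psi> i. test_function \<Omega> \<psi> \<longrightarrow>
        L2_inner \<Omega> u (partial_deriv i \<psi>) = - L2_inner \<Omega> (\<lambda>x. g x $ i) \<psi>)"

definition H1 :: "(real^'n) set \<Rightarrow> (real^'n \<Rightarrow> real) set" where
  "H1 \<Omega> = {u. \<exists>g. has_weak_gradient \<Omega> u g}"

text \<open>Weak gradients are unique only almost everywhere on \<open>\<Omega>\<close>; we choose a representative.  It
  occurs below only in integrals over (subsets of) \<open>\<Omega>\<close> or in notions that do not depend on the
  choice.\<close>

definition weak_gradient :: "(real^'n) set \<Rightarrow> (real^'n \<Rightarrow> real) \<Rightarrow> real^'n \<Rightarrow> real^'n" where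
  "weak_gradient \<Omega> u = (SOME g. has_weak_gradient \<Omega> u g)"

definition H2 :: "(real^'n) set \<Rightarrow> (real^'n \<Rightarrow> real) set" where
  "H2 \<Omega> = {u \<in> H1 \<Omega>. \<forall>i. (\<lambda>x. weak_gradient \<Omega> u x $ i) \<in> H1 \<Omega>}"

definition laplacian :: "(real^'n) set \<Rightarrow> (real^'n \<Rightarrow> real) \<Rightarrow> real^'n \<Rightarrow> real" where
  "laplacian \<Omega> u x = (\<Sum>i\<in>UNIV. weak_gradient \<Omega> (\<lambda>y. weak_gradient \<Omega> u y $ i) x $ i)"

definition grad_form :: "(real^'n) set \<Rightarrow> (real^'n \<Rightarrow> real) \<Rightarrow> (real^'n \<Rightarrow> real) \<Rightarrow> real" where
  "grad_form \<Omega> u v = (LINT x|lebesgue_on \<Omega>. weak_gradient \<Omega> u x \<bullet> weak_gradient \<Omega> v x)"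

section \<open>Polyhedral domains and the Neumann condition\<close>

text \<open>A (not necessarily convex) bounded polygonal/polyhedral domain.  The condition
  \<open>interior (closure \<Omega>) = \<Omega>\<close> excludes slits and punctures.\<close>

definition polyhedral_domain :: "(real^'n) set \<Rightarrow> bool" where
  "polyhedral_domain \<Omega> \<longleftrightarrow>
     open \<Omega> \<and> connected \<Omega> \<and> \<Omega> \<noteq> {} \<and> interior (closure \<Omega>) = \<Omega> \<and>
     (\<exists>\<P>. finite \<P> \<and> (\<forall>P\<in>\<P>. polytope P) \<and> closure \<Omega> = \<Union>\<P>)"

text \<open>Near \<open>x\<close> the boundary is a flat disc of radius \<open>r\<close> with outward unit normal \<open>\<nu>\<close>.  Such discs
  cover the boundary of a polyhedral domain up to its vertices and edges, which are negligible
  for the surface measure.\<close>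

definition flat_boundary_disc :: "(real^'n) set \<Rightarrow> real^'n \<Rightarrow> real \<Rightarrow> real^'n \<Rightarrow> bool" where
  "flat_boundary_disc \<Omega> x r \<nu> \<longleftrightarrow>
     r > 0 \<and> norm \<nu> = 1 \<and> \<Omega> \<inter> ball x r = {y \<in> ball x r. (y - x) \<bullet> \<nu> < 0}"

text \<open>The surface integral of \<open>f\<close> over the disc \<open>{y \<in> ball x r. (y - x) \<bullet> \<nu> = 0}\<close>, written as the
  Lebesgue integral over the cylinder of height 1 above the disc of the function that is
  constant in direction \<open>\<nu>\<close> and equals \<open>f\<close> on the disc.\<close>

definition disc_integral :: "real^'n \<Rightarrow> real \<Rightarrow> real^'n \<Rightarrow> (real^'n \<Rightarrow> real) \<Rightarrow> real" where
  "disc_integral x r \<nu> f =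
     (let pr = (\<lambda>y. y - ((y - x) \<bullet> \<nu>) *\<^sub>R \<nu>)
      in LINT y|lebesgue_on {y. pr y \<in> ball x r \<and> 0 \<le> (y - x) \<bullet> \<nu> \<and> (y - x) \<bullet> \<nu> \<le> 1}. f (pr y))"

text \<open>The trace operator is the continuous extension to \<open>H\<^sup>1\<close> of the restriction of functions
  that are smooth up to the boundary, with values in \<open>L\<^sup>2\<close> of the boundary.  Hence the trace of
  \<open>w\<close> vanishes on the disc iff \<open>w\<close> is the \<open>H\<^sup>1\<close>-limit of smooth functions whose restrictions to the
  disc tend to 0 in \<open>L\<^sup>2\<close>.\<close>

definition zero_trace_on_disc ::
  "(real^'n) set \<Rightarrow> real^'n \<Rightarrow> real \<Rightarrow> real^'n \<Rightarrow> (real^'n \<Rightarrow> real) \<Rightarrow> bool" where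
  "zero_trace_on_disc \<Omega> x r \<nu> w \<longleftrightarrow>
     (\<exists>s. (\<forall>k::nat. smooth (s k)) \<and>
        (\<lambda>k. L2_norm (\<Omega> \<inter> ball x r) (\<lambda>y. s k y - w y)) \<longlonglongrightarrow> 0 \<and>
        (\<forall>i. (\<lambda>k. L2_norm (\<Omega> \<inter> ball x r)
                   (\<lambda>y. partial_deriv i (s k) y - weak_gradient \<Omega> w y $ i)) \<longlonglongrightarrow> 0) \<and>
        (\<lambda>k. disc_integral x r \<nu> (\<lambda>y. (s k y)\<^sup>2)) \<longlonglongrightarrow> 0)"

definition zero_normal_derivative :: "(real^'n) set \<Rightarrow> (real^'n \<Rightarrow> real) \<Rightarrow> bool" where
  "zero_normal_derivative \<Omega> \<phi> \<longleftrightarrow>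
     (\<forall>x r \<nu>. flat_boundary_disc \<Omega> x r \<nu> \<longrightarrow>
        zero_trace_on_disc \<Omega> x r \<nu> (\<lambda>y. weak_gradient \<Omega> \<phi> y \<bullet> \<nu>))"

section \<open>Meshes and finite element spaces\<close>

definition conforming_mesh :: "(real^'n) set \<Rightarrow> (real^'n) set set \<Rightarrow> bool" where
  "conforming_mesh \<Omega> \<K> \<longleftrightarrow>
     triangulation \<K> \<and> (\<forall>K\<in>\<K>. int CARD('n) simplex K) \<and> \<Union>\<K> = closure \<Omega>"

definition mesh_size :: "(real^'n) set set \<Rightarrow> real" where
  "mesh_size \<K> = Max (diameter ` \<K>)"

definition inradius :: "(real^'n) set \<Rightarrow> real" where
  "inradius K = Sup {r. 0 \<le> r \<and> (\<exists>x. cball x r \<subseteq> K)}"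

definition regular_mesh_family ::
  "(real^'n) set \<Rightarrow> real \<Rightarrow> real \<Rightarrow> real set \<Rightarrow> (real \<Rightarrow> (real^'n) set set) \<Rightarrow> bool" where
  "regular_mesh_family \<Omega> \<sigma> \<kappa> H \<T> \<longleftrightarrow>
     (\<forall>h\<in>H. h > 0 \<and> conforming_mesh \<Omega> (\<T> h) \<and> mesh_size (\<T> h) = h \<and>
        (\<forall>K\<in>\<T> h. diameter K \<le> \<sigma> * inradius K) \<and>
        (\<forall>K\<in>\<T> h. h \<le> \<kappa> * diameter K))"

definition polynomial_of_degree_le :: "nat \<Rightarrow> (real^'n \<Rightarrow> real) \<Rightarrow> bool" where
  "polynomial_of_degree_le q p \<longleftrightarrow>
     (\<exists>c. \<forall>x. p x = (\<Sum>\<alpha> | (\<Sum>i\<in>UNIV. \<alpha> i) \<le> q. c \<alpha> * (\<Prod>i\<in>UNIV. (x $ i) ^ \<alpha> i)))"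

text \<open>Elements are functions on \<open>\<Omega>\<close>; their values outside \<open>\<Omega>\<close> are irrelevant.  Discrete functions
  characterised by variational identities are thus unique as functions on \<open>\<Omega>\<close>, and the Ritz
  projection and the discrete Laplacian are given by their graphs.\<close>

definition fe_space ::
  "(real^'n) set \<Rightarrow> (real^'n) set set \<Rightarrow> nat \<Rightarrow> (real^'n \<Rightarrow> real) set" where
  "fe_space \<Omega> \<K> q =
     {v. continuous_on \<Omega> v \<and>
         (\<forall>K\<in>\<K>. \<exists>p. polynomial_of_degree_le q p \<and> (\<forall>x\<in>K \<inter> \<Omega>. v x = p x))}"

definition zero_mean :: "(real^'n) set \<Rightarrow> (real^'n \<Rightarrow> real) \<Rightarrow> bool" where
  "zero_mean \<Omega> v \<longleftrightarrow> L2_inner \<Omega> v (\<lambda>_. 1) = 0"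

definition is_ritz_projection ::
  "(real^'n) set \<Rightarrow> (real^'n \<Rightarrow> real) set \<Rightarrow> (real^'n \<Rightarrow> real) \<Rightarrow> (real^'n \<Rightarrow> real) \<Rightarrow> bool" where
  "is_ritz_projection \<Omega> S \<phi> R \<longleftrightarrow>
     R \<in> S \<and> (\<forall>\<xi>\<in>S. grad_form \<Omega> (\<lambda>x. R x - \<phi> x) \<xi> = 0) \<and> zero_mean \<Omega> (\<lambda>x. R x - \<phi> x)"

definition is_discrete_laplacian ::
  "(real^'n) set \<Rightarrow> (real^'n \<Rightarrow> real) set \<Rightarrow> (real^'n \<Rightarrow> real) \<Rightarrow> (real^'n \<Rightarrow> real) \<Rightarrow> bool" where
  "is_discrete_laplacian \<Omega> S v w \<longleftrightarrow>
     w \<in> S \<and> zero_mean \<Omega> w \<and> (\<forall>\<xi>\<in>S. L2_inner \<Omega> w \<xi> = - grad_form \<Omega> v \<xi>)"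

section \<open>The Cahn--Hilliard scheme\<close>

definition energy :: "(real^'n) set \<Rightarrow> real \<Rightarrow> (real^'n \<Rightarrow> real) \<Rightarrow> real" where
  "energy \<Omega> \<epsilon> \<phi> =
     (LINT x|lebesgue_on \<Omega>.
        1 / (4 * \<epsilon>) * ((\<phi> x)\<^sup>2 - 1)\<^sup>2 + \<epsilon> / 2 * (norm (weak_gradient \<Omega> \<phi> x))\<^sup>2)"

definition chemical_potential ::
  "(real^'n) set \<Rightarrow> real \<Rightarrow> (real^'n \<Rightarrow> real) \<Rightarrow> real^'n \<Rightarrow> real" where
  "chemical_potential \<Omega> \<epsilon> \<phi> x = (1 / \<epsilon>) * ((\<phi> x) ^ 3 - \<phi> x) - \<epsilon> * laplacian \<Omega> \<phi> x"

definition chi :: "real \<Rightarrow> real \<Rightarrow> real" where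
  "chi u v = 1/2 * (u\<^sup>2 + v\<^sup>2) * (1/2 * (u + v))"

text \<open>In the next two definitions the last two arguments are the new phase field and the new
  chemical potential.\<close>

definition first_step_solution ::
  "(real^'n) set \<Rightarrow> (real^'n \<Rightarrow> real) set \<Rightarrow> real \<Rightarrow> real \<Rightarrow> (real^'n \<Rightarrow> real) \<Rightarrow> (real^'n \<Rightarrow> real) \<Rightarrow>
   (real^'n \<Rightarrow> real) \<Rightarrow> (real^'n \<Rightarrow> real) \<Rightarrow> bool" where
  "first_step_solution \<Omega> S \<epsilon> \<tau> \<phi>\<^sub>0 \<mu>\<^sub>0 \<phi>\<^sub>1 \<mu> \<longleftrightarrow>
     \<phi>\<^sub>1 \<in> S \<and> \<mu> \<in> S \<and>
     (\<forall>\<nu>\<in>S. L2_inner \<Omega> (\<lambda>x. (\<phi>\<^sub>1 x - \<phi>\<^sub>0 x) / \<tau>) \<nu> + \<epsilon> * grad_form \<Omega> \<mu> \<nu> = 0) \<and>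
     (\<forall>\<psi>\<in>S. (1 / \<epsilon>) * L2_inner \<Omega> (\<lambda>x. chi (\<phi>\<^sub>1 x) (\<phi>\<^sub>0 x)) \<psi>
            - (1 / \<epsilon>) * L2_inner \<Omega> \<phi>\<^sub>0 \<psi>
            + \<tau> / 2 * grad_form \<Omega> \<mu>\<^sub>0 \<psi>
            + \<epsilon> * grad_form \<Omega> (\<lambda>x. 1/2 * \<phi>\<^sub>1 x + 1/2 * \<phi>\<^sub>0 x) \<psi>
            - L2_inner \<Omega> \<mu> \<psi> = 0)"

definition multistep_solution ::
  "(real^'n) set \<Rightarrow> (real^'n \<Rightarrow> real) set \<Rightarrow> real \<Rightarrow> real \<Rightarrow> (real^'n \<Rightarrow> real) \<Rightarrow> (real^'n \<Rightarrow> real) \<Rightarrow>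
   (real^'n \<Rightarrow> real) \<Rightarrow> (real^'n \<Rightarrow> real) \<Rightarrow> bool" where
  "multistep_solution \<Omega> S \<epsilon> \<tau> \<phi>prev \<phi>cur \<phi>new \<mu> \<longleftrightarrow>
     \<phi>new \<in> S \<and> \<mu> \<in> S \<and>
     (\<forall>\<nu>\<in>S. L2_inner \<Omega> (\<lambda>x. (\<phi>new x - \<phi>cur x) / \<tau>) \<nu> + \<epsilon> * grad_form \<Omega> \<mu> \<nu> = 0) \<and>
     (\<forall>\<psi>\<in>S. (1 / \<epsilon>) * L2_inner \<Omega> (\<lambda>x. chi (\<phi>new x) (\<phi>cur x)) \<psi>
            - (1 / \<epsilon>) * L2_inner \<Omega> (\<lambda>x. 3/2 * \<phi>cur x - 1/2 * \<phi>prev x) \<psi>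
            + \<epsilon> * grad_form \<Omega> (\<lambda>x. 3/4 * \<phi>new x + 1/4 * \<phi>prev x) \<psi>
            - L2_inner \<Omega> \<mu> \<psi> = 0)"

end

(*
  Testing the scheme with the increments of the phase field gives a discrete energy law, hence
  uniform H^1 bounds for the phase fields and a bound for the sum of tau |grad mu^(m+1/2)|^2.
  Subtracting the equations for two consecutive chemical potentials and testing with
  3/4 mu^(m+1/2) + 1/4 mu^(m-3/2) produces a telescoping sum together with the squared norms of the
  difference quotients.  The increments of the cubic nonlinearity are absorbed with the Sobolev
  embedding H^1 -> L^6, whose constant must not depend on the mesh.  It is proved by Gagliardo's
  method: the domain satisfies a cone condition with finitely many cones, so u^4 is bounded by line
  integrals of u^4 + |u|^3 |grad u| in the directions of a basis, and the Loomis-Whitney inequality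
  applies.  The bound for the first chemical potential uses the discrete Laplacians of the initial
  data.
*)

theory Submission
  imports Defs "HOL-Computational_Algebra.Polynomial"
begin

section \<open>Smooth bump functions\<close>

text \<open>Two obstacles shape the proof. First, \<open>weak_gradient\<close> is an arbitrarily
  chosen representative, so before any estimate \<open>grad_form\<close> and \<open>energy\<close>
  must be tied to the classical piecewise gradient. This takes existence (integration by parts
  across the cells) and uniqueness almost everywhere (a sufficient supply of smooth test functions);
  bumps on boxes supply the latter. Second, the bounds may grow only linearly in \<open>T\<close>,
  so a Gronwall argument with its exponential factor is avoided: the remainder in the recursion for
  the chemical potentials is controlled by gradients whose weighted time sum is already bounded by
  the energy law, independently of \<open>T\<close>. What makes this possible is a bound of the full
  L2 norm of a potential by 1 plus its squared gradient norm at the same time level. The weights 3/4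
  and 1/4 are those of the gradient term of the scheme, so the same combination of evolution
  equations fits the test function. The first step has other weights and an extra term; it enters
  the recursion as a start in which one time level is repeated.\<close>

definition bump_factor :: "real poly \<Rightarrow> nat \<Rightarrow> real \<Rightarrow> real \<Rightarrow> real \<Rightarrow> real \<Rightarrow> real" where
  "bump_factor p n c a b t =
     (if (t - a) * (b - t) > 0 then poly p t / ((t - a) * (b - t)) ^ n * exp (- c / ((t - a) * (b - t)))
      else 0)"

text \<open>The numerator of the derivative, so that the family of bump factors is closed under
  differentiation.\<close>

definition bump_deriv_poly :: "real poly \<Rightarrow> nat \<Rightarrow> real \<Rightarrow> real \<Rightarrow> real \<Rightarrow> real poly" where
  "bump_deriv_poly p n c a b =
     pderiv p * ([:-a, 1:] * [:b, -1:])^2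
     - smult (real n) (p * [:a + b, -2:] * ([:-a, 1:] * [:b, -1:]))
     + smult c (p * [:a + b, -2:])"

text \<open>One term of the exponential series gives
  \<open>(c / w) ^ (n + 2) / fact (n + 2) \<le> exp (c / w)\<close> for
  \<open>w = (t - a) * (b - t)\<close>. Two powers more than \<open>w ^ n\<close> requires are
  taken, because the factor \<open>w\<^sup>2\<close> makes the difference quotients at the endpoints
  tend to 0.\<close>

lemma bump_factor_bound:
  assumes "c > 0"
  shows "\<bar>bump_factor p n c a b t\<bar> \<le> \<bar>poly p t\<bar> * (fact (n + 2) / c ^ (n + 2)) * ((t - a) * (b - t))\<^sup>2"
proof (cases "(t - a) * (b - t) > 0")
  case True
  define w where "w = (t - a) * (b - t)"
  have w: "w > 0" using True by (simp add: w_def)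
  have "(c / w) ^ (n + 2) / fact (n + 2) \<le> exp (c / w)"
  proof -
    have "(\<Sum>k\<in>{n+2}. (c / w) ^ k /\<^sub>R fact k) \<le> (\<Sum>k. (c / w) ^ k /\<^sub>R fact k)"
      by (rule sum_le_suminf[OF summable_exp_generic]) (use assms w in auto)
    then show ?thesis by (simp add: exp_def divide_inverse mult.commute)
  qed
  then have "exp (- c / w) \<le> fact (n + 2) / (c / w) ^ (n + 2)"
  proof -
    have "exp (- y) \<le> F / X" if "X / F \<le> exp y" "X > 0" "F > 0" for X F y :: real
      using that by (simp add: exp_minus field_simps)
    from this[OF \<open>(c / w) ^ (n + 2) / fact (n + 2) \<le> exp (c / w)\<close>] show ?thesis
      using assms w by simp
  qed
  also have "\<dots> = fact (n + 2) / c ^ (n + 2) * w ^ n * w\<^sup>2"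
    using assms w by (simp add: power_divide power_add field_simps power2_eq_square)
  finally have "exp (- c / w) / w ^ n \<le> fact (n + 2) / c ^ (n + 2) * w\<^sup>2"
    using w by (simp add: field_simps)
  then have "\<bar>poly p t\<bar> * (exp (- c / w) / w ^ n) \<le> \<bar>poly p t\<bar> * (fact (n + 2) / c ^ (n + 2) * w\<^sup>2)"
    by (intro mult_left_mono) auto
  then show ?thesis
    using w unfolding bump_factor_def w_def[symmetric] by (simp add: abs_mult mult_ac)
next
  case False
  then show ?thesis using assms by (simp add: bump_factor_def)
qed

lemma bump_factor_DERIV:
  assumes c: "c > 0"
  shows "(bump_factor p n c a b has_real_derivative
           bump_factor (bump_deriv_poly p n c a b) (n + 2) c a b t) (at t)"
proof -
  define w where "w = (\<lambda>t. (t - a) * (b - t))"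
  have cw: "continuous_on UNIV w" unfolding w_def by (intro continuous_intros)
  consider "w t > 0" | "w t < 0" | "w t = 0" by linarith
  then show ?thesis
  proof cases
    case 1
    have dw: "(w has_real_derivative (a + b - 2 * t)) (at t)"
      unfolding w_def by (auto intro!: derivative_eq_intros)
    define E where "E = (poly (pderiv p) t * w t ^ n - poly p t * (real n * w t ^ (n - 1) * (a + b - 2 * t))) / (w t ^ n * w t ^ n)
          * exp (- c / w t)
        + poly p t / w t ^ n * (exp (- c / w t) * (c * (a + b - 2 * t) / (w t * w t)))"
    have d: "((\<lambda>t. poly p t / w t ^ n * exp (- c / w t)) has_real_derivative E) (at t)"
      unfolding E_def using 1 by (auto intro!: derivative_eq_intros dw poly_DERIV simp: field_simps)
    have eq: "E = bump_factor (bump_deriv_poly p n c a b) (n + 2) c a b t"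
    proof -
      have "real n * w t ^ (n - 1) * w t = real n * w t ^ n"
        by (cases n) auto
      then have e: "real n * w t ^ (n - 1) = real n * w t ^ n / w t" using 1 by (simp add: field_simps)
      have bf: "bump_factor (bump_deriv_poly p n c a b) (n + 2) c a b t =
         (poly (pderiv p) t * (w t)^2 - real n * (poly p t * (a + b - 2 * t) * w t) + c * (poly p t * (a + b - 2 * t)))
         / (w t ^ n * (w t * w t)) * exp (- c / w t)"
        using 1 by (simp add: bump_factor_def bump_deriv_poly_def w_def power_add power2_eq_square algebra_simps)
      then show ?thesis
        unfolding E_def e bf using 1
        by (simp add: divide_simps power2_eq_square) (simp add: algebra_simps)
    qed
    have "((\<lambda>t. poly p t / w t ^ n * exp (- c / w t)) has_real_derivative
            bump_factor (bump_deriv_poly p n c a b) (n + 2) c a b t) (at t)"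
      using d eq by simp
    moreover have "open {s. w s > 0}" using cw
      by (intro open_Collect_less) auto
    ultimately show ?thesis
      by (rule has_field_derivative_transform_within_open) (use 1 in \<open>auto simp: bump_factor_def w_def\<close>)
  next
    case 2
    have o: "open {s. w s < 0}" using cw by (intro open_Collect_less) auto
    have "bump_factor (bump_deriv_poly p n c a b) (n + 2) c a b t = 0"
      using 2 by (simp add: bump_factor_def w_def)
    then have d: "((\<lambda>_. 0) has_real_derivative bump_factor (bump_deriv_poly p n c a b) (n + 2) c a b t) (at t)"
      by simp
    show ?thesis
      by (rule has_field_derivative_transform_within_open[OF d o]) (use 2 in \<open>auto simp: bump_factor_def w_def\<close>)
  next
    case 3
    have z: "bump_factor q k c a b t = 0" for q k
      using 3 by (auto simp: bump_factor_def w_def)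
    \<comment> \<open>At a zero \<open>t\<close> of \<open>w\<close> one has
      \<open>w s = (s - t) * (a + b - s - t)\<close>, so the bound above makes the difference
      quotient at most \<open>B s\<close>, which still carries a factor
      \<open>\<bar>s - t\<bar>\<close>.\<close>
    define K where "K = fact (n + 2) / c ^ (n + 2)"
    define B where "B = (\<lambda>s. \<bar>poly p s\<bar> * K * (\<bar>s - t\<bar> * (a + b - s - t)\<^sup>2))"
    have "((\<lambda>s. (bump_factor p n c a b s - bump_factor p n c a b t) / (s - t)) \<longlongrightarrow> 0) (at t)"
    proof (rule Lim_null_comparison)
      show "\<forall>\<^sub>F s in at t. norm ((bump_factor p n c a b s - bump_factor p n c a b t) / (s - t)) \<le> B s"
      proof (rule eventually_at_filter[THEN iffD2], rule always_eventually, intro allI impI)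
        fix s :: real assume s: "s \<noteq> t" 
        have "w s = w s - w t" using 3 by simp
        also have "\<dots> = (s - t) * (a + b - s - t)" by (simp add: w_def algebra_simps)
        finally have ws: "(s - a) * (b - s) = (s - t) * (a + b - s - t)" by (simp add: w_def)
        have "\<bar>bump_factor p n c a b s\<bar> \<le> \<bar>poly p s\<bar> * K * ((s - t) * (a + b - s - t))\<^sup>2"
          using bump_factor_bound[OF c, of p n a b s] unfolding K_def ws .
        also have "\<dots> = B s * \<bar>s - t\<bar>"
          by (simp add: B_def power_mult_distrib power2_eq_square mult_ac)
        finally show "norm ((bump_factor p n c a b s - bump_factor p n c a b t) / (s - t)) \<le> B s"
          using s by (simp add: z field_simps)
      qed
      have "(B \<longlongrightarrow> B t) (at t)"
        unfolding B_def by (intro tendsto_intros)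
      then show "(B \<longlongrightarrow> 0) (at t)" by (simp add: B_def)
    qed
    then show ?thesis
      unfolding has_field_derivative_iff z by simp
  qed
qed

definition bump_product ::
    "('n::finite \<Rightarrow> real poly) \<Rightarrow> ('n \<Rightarrow> nat) \<Rightarrow> real \<Rightarrow> real^'n \<Rightarrow> real^'n \<Rightarrow> real^'n \<Rightarrow> real" where
  "bump_product p n c a b x = (\<Prod>j\<in>UNIV. bump_factor (p j) (n j) c (a $ j) (b $ j) (x $ j))"

lemma bump_product_has_derivative:
  assumes "c > 0"
  shows "(bump_product p n c a b has_derivative
     (\<lambda>h. \<Sum>i\<in>UNIV. (bump_factor (bump_deriv_poly (p i) (n i) c (a $ i) (b $ i)) (n i + 2) c (a $ i) (b $ i) (x $ i) * h $ i)
        * (\<Prod>j\<in>UNIV - {i}. bump_factor (p j) (n j) c (a $ j) (b $ j) (x $ j)))) (at x)"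
proof -
  have "((\<lambda>x. bump_factor (p i) (n i) c (a $ i) (b $ i) (x $ i)) has_derivative
     (\<lambda>h. bump_factor (bump_deriv_poly (p i) (n i) c (a $ i) (b $ i)) (n i + 2) c (a $ i) (b $ i) (x $ i) * h $ i)) (at x)" for i
    using has_derivative_compose[OF bounded_linear_imp_has_derivative[OF bounded_linear_vec_nth[of i], of "at x"]
        bump_factor_DERIV[OF assms, unfolded has_field_derivative_def]]
    by simp
  then show ?thesis
    unfolding bump_product_def[abs_def]
    by (intro has_derivative_prod) auto
qed

lemma partial_deriv_bump_product:
  assumes "c > 0"
  shows "partial_deriv i (bump_product p n c a b) =
     bump_product (p(i := bump_deriv_poly (p i) (n i) c (a $ i) (b $ i))) (n(i := n i + 2)) c a b"
proof
  fix x
  let ?D = "\<lambda>i. bump_factor (bump_deriv_poly (p i) (n i) c (a $ i) (b $ i)) (n i + 2) c (a $ i) (b $ i) (x $ i)"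
  let ?R = "\<lambda>i. \<Prod>j\<in>UNIV - {i}. bump_factor (p j) (n j) c (a $ j) (b $ j) (x $ j)"
  have "partial_deriv i (bump_product p n c a b) x = (\<Sum>k\<in>UNIV. ?D k * axis i 1 $ k * ?R k)"
    unfolding partial_deriv_def frechet_derivative_at[OF bump_product_has_derivative[OF assms], symmetric] ..
  also have "\<dots> = (\<Sum>k\<in>UNIV. if k = i then ?D k * ?R k else 0)"
    by (rule sum.cong) (auto simp: axis_def)
  also have "\<dots> = ?D i * ?R i" by simp
  also have "\<dots> = bump_product (p(i := bump_deriv_poly (p i) (n i) c (a $ i) (b $ i))) (n(i := n i + 2)) c a b x"
    unfolding bump_product_def by (subst (2) prod.remove[of _ i]) auto
  finally show "partial_deriv i (bump_product p n c a b) x =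
     bump_product (p(i := bump_deriv_poly (p i) (n i) c (a $ i) (b $ i))) (n(i := n i + 2)) c a b x" .
qed

text \<open>A partial derivative changes only the polynomial and the exponent of one factor, so
  iterated derivatives never leave the family, and every member of it is differentiable.\<close>

lemma smooth_bump_product:
  assumes "c > 0"
  shows "smooth (bump_product p n c a b)"
proof -
  have "\<exists>p' n'. foldr partial_deriv js (bump_product p n c a b) = bump_product p' n' c a b" for js
  proof (induction js)
    case (Cons i js)
    then show ?case using partial_deriv_bump_product[OF assms] by (metis foldr.simps(2) comp_apply)
  qed auto
  moreover have "bump_product p' n' c a b differentiable_on UNIV" for p' n'
    using bump_product_has_derivative[OF assms] unfolding differentiable_on_def differentiable_def by blast
  ultimately show ?thesis unfolding smooth_def by metis
qed

text \<open>The parameter \<open>c\<close> stays free: as it tends to 0 the bumps tend to the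
  indicator of the open box, which replaces approximation by convolution.\<close>

definition bump :: "real \<Rightarrow> real^'n \<Rightarrow> real^'n \<Rightarrow> real^'n \<Rightarrow> real" where
  "bump c a b = bump_product (\<lambda>_. 1) (\<lambda>_. 0) c a b"

lemma box_vec_iff: "(x::real^'n) \<in> box a b \<longleftrightarrow> (\<forall>i. a $ i < x $ i \<and> x $ i < b $ i)"
  by (auto simp: mem_box_cart)

text \<open>Nonemptiness of the box matters: for \<open>b $ i < a $ i\<close> the product
  \<open>(t - a $ i) * (b $ i - t)\<close> would be positive on the reversed interval.\<close>

lemma bump_outside: assumes "box a b \<noteq> {}" "x \<notin> box a b" shows "bump c a b x = 0"
proof -
  obtain i where i: "\<not> (a $ i < x $ i \<and> x $ i < b $ i)" using assms(2) by (auto simp: box_vec_iff)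
  have "a $ i < b $ i" using assms(1) by (auto simp: box_vec_iff) (meson less_trans)
  then have "\<not> (x $ i - a $ i) * (b $ i - x $ i) > 0" using i by (auto simp: zero_less_mult_iff)
  then show ?thesis unfolding bump_def bump_product_def
    by (intro prod_zero) (auto simp: bump_factor_def intro!: exI[of _ i])
qed

lemma bump_inside:
  assumes "x \<in> box a b"
  shows "bump c a b x = (\<Prod>j\<in>UNIV. exp (- c / ((x $ j - a $ j) * (b $ j - x $ j))))"
  using assms unfolding bump_def bump_product_def
  by (intro prod.cong) (auto simp: bump_factor_def box_vec_iff zero_less_mult_iff)

lemma bump_abs_le_1: assumes "c > 0" "box a b \<noteq> {}" shows "\<bar>bump c a b x\<bar> \<le> 1"
proof (cases "x \<in> box a b")
  case True
  have "(\<Prod>j\<in>UNIV. exp (- c / ((x $ j - a $ j) * (b $ j - x $ j)))) \<le> 1"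
    by (intro prod_le_1) (use True assms in \<open>auto simp: box_vec_iff zero_le_mult_iff less_imp_le divide_nonneg_nonneg\<close>)
  moreover have "(\<Prod>j\<in>UNIV. exp (- c / ((x $ j - a $ j) * (b $ j - x $ j)))) \<ge> 0"
    by (intro prod_nonneg) auto
  ultimately show ?thesis using bump_inside[OF True, of c] by simp
qed (simp add: bump_outside assms)

lemma bump_tendsto_indicator:
  assumes "box a b \<noteq> {}"
  shows "(\<lambda>k. bump (1 / real (Suc k)) a b x) \<longlonglongrightarrow> indicator (box a b) x"
proof (cases "x \<in> box a b")
  case True
  have "(\<lambda>k. \<Prod>j\<in>UNIV. exp (- (1 / real (Suc k)) / ((x $ j - a $ j) * (b $ j - x $ j)))) \<longlonglongrightarrow>
        (\<Prod>j\<in>UNIV. exp (- 0 / ((x $ j - a $ j) * (b $ j - x $ j))))"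
    by (intro tendsto_intros LIMSEQ_inverse_real_of_nat[unfolded inverse_eq_divide])
      (use True in \<open>auto simp: box_vec_iff less_imp_neq less_imp_neq[symmetric]\<close>)
  then show ?thesis using True by (simp add: bump_inside)
qed (simp add: bump_outside assms)

lemma test_function_bump:
  assumes "c > 0" "box a b \<noteq> {}" "cbox a b \<subseteq> \<Omega>"
  shows "test_function \<Omega> (bump c a b)"
  unfolding test_function_def
proof (intro conjI exI[of _ "cbox a b"])
  show "smooth (bump c a b)" unfolding bump_def by (rule smooth_bump_product) fact
  show "\<forall>x. x \<notin> cbox a b \<longrightarrow> bump c a b x = 0"
    using bump_outside[OF assms(2)] box_subset_cbox by blast
qed (use assms in auto)

section \<open>Functions orthogonal to all test functions\<close>

text \<open>Dynkin's argument: boxes are stable under intersection and generate the Borel sets. The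
  complement step needs the total integral to vanish, and this is where the support in a single box
  enters.\<close>

lemma AE_0_if_box_integrals_0:
  fixes k :: "'a::euclidean_space \<Rightarrow> real"
  assumes int: "integrable lborel k"
    and 0: "\<And>l u. (LINT x|lborel. indicator (box l u) x * k x) = 0"
    and out: "\<And>x. x \<notin> box a b \<Longrightarrow> k x = 0"
  shows "AE x in lborel. k x = 0"
proof (rule sigma_finite_measure.density_zero[OF sigma_finite_lborel int])
  fix A assume "A \<in> sets (lborel :: 'a measure)"
  then have A: "A \<in> sigma_sets UNIV (range (\<lambda>(a, b). box a b))"
    by (simp add: borel_eq_box[where 'a='a])
  have "Int_stable (range (\<lambda>(a, b::'a). box a b))"
    by (auto simp: Int_stable_def box_Int_box)
  moreover have "range (\<lambda>(a, b::'a). box a b) \<subseteq> Pow UNIV" by auto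
  ultimately have "set_integrable lborel A k \<and> set_lebesgue_integral lborel A k = 0"
    using A
  proof (induction A rule: sigma_sets_induct_disjoint)
    case (basic A)
    then obtain l u where A: "A = box l u" by auto
    have "set_integrable lborel (box l u) k"
      unfolding set_integrable_def by (intro integrable_mult_indicator int) auto
    then show ?case using 0 by (simp add: A set_lebesgue_integral_def)
  next
    case empty
    then show ?case by (simp add: set_integrable_def set_lebesgue_integral_def)
  next
    case (compl A)
    then have [measurable]: "A \<in> sets borel" by (simp add: borel_eq_box[where 'a='a])
    have full: "(LINT x|lborel. k x) = 0"
    proof -
      have "k = (\<lambda>x. indicator (box a b) x * k x)" using out by (intro ext) (case_tac "x \<in> box a b"; simp)
      then show ?thesis using 0[of a b] by metis
    qed
    have i: "set_integrable lborel A k" using compl by auto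
    have [measurable]: "UNIV - A \<in> sets borel" by measurable
    have j: "set_integrable lborel (UNIV - A) k"
      unfolding set_integrable_def by (intro integrable_mult_indicator int) simp
    have "set_lebesgue_integral lborel (A \<union> (UNIV - A)) k
        = set_lebesgue_integral lborel A k + set_lebesgue_integral lborel (UNIV - A) k"
      by (rule set_integral_Un[OF _ i j]) auto
    then show ?case using j compl full by (simp add: set_lebesgue_integral_def)
  next
    case (union A)
    then have [measurable]: "A i \<in> sets borel" for i by (simp add: borel_eq_box[where 'a='a] image_subset_iff)
    have [measurable]: "(\<Union>i. A i) \<in> sets borel" by measurable
    have j: "set_integrable lborel (\<Union>i. A i) k"
      unfolding set_integrable_def by (intro integrable_mult_indicator int) simp
    have "set_lebesgue_integral lborel (\<Union>i. A i) k = (\<Sum>i. set_lebesgue_integral lborel (A i) k)"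
      by (rule lebesgue_integral_countable_add[OF _ _ j])
        (use union(1) in \<open>auto simp: disjoint_family_on_def\<close>)
    then show ?case using union j by simp
  qed
  then show "set_lebesgue_integral lborel A k = 0" by blast
qed

text \<open>Dominated convergence along bumps with \<open>c = 1 / real (Suc k)\<close> and majorant
  \<open>\<bar>g x\<bar>\<close> turns orthogonality into vanishing integrals over boxes whose
  closed box lies in \<open>\<Omega>\<close>. The result for single boxes is then spread over a
  countable cover of \<open>\<Omega>\<close> by closed boxes, whose boundaries are null.\<close>

lemma AE_0_if_orthogonal_to_test_functions:
  fixes \<Omega> :: "(real^'n) set"
  assumes op: "open \<Omega>" and int: "integrable (lebesgue_on \<Omega>) g"
    and orth: "\<And>\<psi>. test_function \<Omega> \<psi> \<Longrightarrow> (LINT x|lebesgue_on \<Omega>. g x * \<psi> x) = 0"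
  shows "AE x in lebesgue_on \<Omega>. g x = 0"
proof -
  have [simp]: "\<Omega> \<in> sets lebesgue" using op by auto
  then have [simp]: "\<Omega> \<inter> space lebesgue \<in> sets lebesgue" by simp
  have box0: "(LINT x|lebesgue_on \<Omega>. g x * indicator (box a b) x) = 0"
    if ab: "cbox a b \<subseteq> \<Omega>" for a b
  proof (cases "box a b = {}")
    case False
    have t: "test_function \<Omega> (bump (1 / real (Suc k)) a b)" for k
      by (rule test_function_bump) (use False ab in auto)
    have sm: "bump (1 / real (Suc k)) a b \<in> borel_measurable (lebesgue_on \<Omega>)" for k
    proof -
      have "bump (1 / real (Suc k)) a b differentiable_on UNIV"
        using t[of k] unfolding test_function_def smooth_def by (metis foldr.simps(1) id_apply)
      then have "continuous_on UNIV (bump (1 / real (Suc k)) a b)"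
        by (rule differentiable_imp_continuous_on)
      then show ?thesis
        by (intro continuous_imp_measurable_on_sets_lebesgue) (auto intro: continuous_on_subset)
    qed
    have "(\<lambda>k. LINT x|lebesgue_on \<Omega>. g x * bump (1 / real (Suc k)) a b x) \<longlonglongrightarrow>
        (LINT x|lebesgue_on \<Omega>. g x * indicator (box a b) x)"
    proof (rule integral_dominated_convergence[where w="\<lambda>x. \<bar>g x\<bar>"])
      have "{x \<in> \<Omega>. x \<in> box a b} \<in> sets (lebesgue_on \<Omega>)"
        by (auto simp: sets_restrict_space intro!: image_eqI[of _ _ "box a b"])
      then show "(\<lambda>x. g x * indicator (box a b) x) \<in> borel_measurable (lebesgue_on \<Omega>)"
        using int by (intro borel_measurable_times borel_measurable_indicator') auto
      show "(\<lambda>x. g x * bump (1 / real (Suc k)) a b x) \<in> borel_measurable (lebesgue_on \<Omega>)" for k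
        using int by (intro borel_measurable_times sm) auto
      show "integrable (lebesgue_on \<Omega>) (\<lambda>x. \<bar>g x\<bar>)" using int by simp
      show "AE x in lebesgue_on \<Omega>. (\<lambda>k. g x * bump (1 / real (Suc k)) a b x) \<longlonglongrightarrow> g x * indicator (box a b) x"
        using bump_tendsto_indicator[OF False] by (intro AE_I2 tendsto_intros)
      show "AE x in lebesgue_on \<Omega>. norm (g x * bump (1 / real (Suc k)) a b x) \<le> \<bar>g x\<bar>" for k
        using bump_abs_le_1[OF _ False, of "1 / real (Suc k)"]
        by (intro AE_I2) (auto simp: abs_mult intro!: mult_left_le)
    qed
    then show ?thesis using orth[OF t] by (simp add: LIMSEQ_const_iff)
  qed simp
  have AEbox: "AE x in lborel. x \<in> box a b \<longrightarrow> g x = 0" if ab: "cbox a b \<subseteq> \<Omega>" for a b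
  proof -
    \<comment> \<open>\<open>g\<close> is only Lebesgue measurable. \<open>k0\<close> is replaced by
      a Borel function, which is cut off by the box once more so that it vanishes everywhere outside
      and not just almost everywhere.\<close>
    define k0 where "k0 = (\<lambda>x. indicator (box a b) x * (indicator \<Omega> x * g x))"
    have "integrable lebesgue (\<lambda>x. indicator \<Omega> x * g x)"
      using int by (simp add: integrable_restrict_space)
    then have k0: "integrable lebesgue k0" unfolding k0_def
      using integrable_mult_indicator[of "box a b" lebesgue "\<lambda>x. indicator \<Omega> x * g x"] by simp
    then obtain k1 where k1[measurable]: "k1 \<in> borel_measurable lborel" and eq: "AE x in lborel. k0 x = k1 x"
      using completion_ex_borel_measurable_real[of k0 lborel] by auto
    define k where "k = (\<lambda>x. indicator (box a b) x * k1 x)"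
    have [measurable]: "k \<in> borel_measurable lborel" unfolding k_def by measurable
    have eqk: "AE x in lborel. k0 x = k x"
      using eq by eventually_elim (auto simp: k_def k0_def indicator_def)
    then have eqk': "AE x in lebesgue. k0 x = k x" by (rule AE_completion)
    have ik: "integrable lebesgue k"
      by (rule integrable_cong_AE_imp[OF k0 _ eqk']) (simp add: measurable_completion)
    have "AE x in lborel. k x = 0"
    proof (rule AE_0_if_box_integrals_0)
      show "integrable lborel k" using ik by (simp add: integrable_completion)
      show "k x = 0" if "x \<notin> box a b" for x using that by (simp add: k_def)
      fix l u
      obtain l' u' where lu: "box l u \<inter> box a b = box l' u'"
        unfolding box_Int_box by blast
      have "(LINT x|lborel. indicator (box l u) x * k x) = (LINT x|lebesgue. indicator (box l u) x * k x)"
        by (rule integral_completion[symmetric]) auto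
      also have "\<dots> = (LINT x|lebesgue. indicator (box l u) x * k0 x)"
        by (rule integral_cong_AE) (use eqk' k0 ik in \<open>auto intro!: borel_measurable_times borel_measurable_indicator\<close>)
      also have "\<dots> = (LINT x|lebesgue. indicator \<Omega> x *\<^sub>R (g x * indicator (box l' u') x))"
        unfolding k0_def lu[symmetric] by (intro Bochner_Integration.integral_cong) (auto simp: indicator_def)
      also have "\<dots> = (LINT x|lebesgue_on \<Omega>. g x * indicator (box l' u') x)"
        by (subst integral_restrict_space) auto
      also have "\<dots> = 0"
      proof (cases "box l' u' = {}")
        case False
        then have "cbox l' u' \<subseteq> cbox a b" using lu
          by (metis box_subset_cbox closure_box closed_cbox closure_minimal inf_le2 order_trans)
        then show ?thesis using box0 ab by blast
      qed simp
      finally show "(LINT x|lborel. indicator (box l u) x * k x) = 0" .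
    qed
    with eqk show ?thesis
      by eventually_elim (use ab box_subset_cbox in \<open>auto simp: k0_def indicator_def\<close>)
  qed
  obtain \<D> where D: "countable \<D>" "\<D> \<subseteq> Pow \<Omega>" "\<And>X. X \<in> \<D> \<Longrightarrow> \<exists>a b. X = cbox a b" "\<Union>\<D> = \<Omega>"
    using open_countable_Union_open_cbox[OF op] by metis
  have "AE x in lebesgue. \<forall>X\<in>\<D>. x \<in> X \<longrightarrow> g x = 0"
  proof (subst AE_ball_countable[OF D(1)], intro ballI)
    fix X assume X: "X \<in> \<D>"
    then obtain a b where ab: "X = cbox a b" using D by blast
    have "AE x in lebesgue. x \<notin> cbox a b - box a b"
      using negligible_frontier_interval[of a b] unfolding negligible_iff_null_sets by (rule AE_not_in)
    moreover have "AE x in lebesgue. x \<in> box a b \<longrightarrow> g x = 0"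
      by (intro AE_completion AEbox) (use X ab D in auto)
    ultimately show "AE x in lebesgue. x \<in> X \<longrightarrow> g x = 0"
      by eventually_elim (auto simp: ab)
  qed
  then have "AE x in lebesgue. x \<in> \<Omega> \<longrightarrow> g x = 0"
    by eventually_elim (use D in auto)
  then show ?thesis by (subst AE_restrict_space_iff) auto
qed

section \<open>Gagliardo's inequality\<close>

lemma nn_integral_lborel_plus:
  fixes f :: "'a::euclidean_space \<Rightarrow> ennreal"
  assumes [measurable]: "f \<in> borel_measurable borel"
  shows "(\<integral>\<^sup>+x. f (a + x) \<partial>lborel) = (\<integral>\<^sup>+x. f x \<partial>lborel)"
proof -
  have "(\<integral>\<^sup>+x. f x \<partial>lborel) = (\<integral>\<^sup>+x. f x \<partial>distr lborel borel ((+) a))"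
    by (simp add: lborel_distr_plus)
  also have "\<dots> = (\<integral>\<^sup>+x. f (a + x) \<partial>lborel)"
    by (rule nn_integral_distr) auto
  finally show ?thesis ..
qed

text \<open>Averaging over the image \<open>B\<close> of the unit cube, Fubini's theorem and translation invariance
  give \<open>|B| \<integral> H (T s) ds = \<integral> H\<close>, whatever the spaces on which the two measures live.\<close>

lemma nn_integral_linear_bij:
  fixes T :: "'a::euclidean_space \<Rightarrow> 'b::euclidean_space"
  assumes lin: "linear T" and bij: "bij T"
  obtains c :: ennreal where "0 < c" "c < \<infinity>"
    "\<And>H. H \<in> borel_measurable borel \<Longrightarrow> (\<integral>\<^sup>+s. H (T s) \<partial>lborel) = c * (\<integral>\<^sup>+x. H x \<partial>lborel)"
proof -
  have "continuous_on UNIV T" using lin by (simp add: linear_continuous_on linear_conv_bounded_linear)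
  then have [measurable]: "T \<in> borel_measurable borel" by (rule borel_measurable_continuous_onI)
  define B where "B = T ` cbox 0 One"
  have "compact B" unfolding B_def
    by (rule compact_continuous_image) (auto intro: continuous_on_subset[OF \<open>continuous_on UNIV T\<close>])
  then have [measurable]: "B \<in> sets borel" by (rule borel_compact)
  define \<beta> where "\<beta> = emeasure lborel B"
  have fin: "\<beta> < \<infinity>" unfolding \<beta>_def
    using \<open>compact B\<close> emeasure_lborel_cbox_finite[] by (metis compact_imp_bounded emeasure_bounded_finite infinity_ennreal_def)
  have key: "\<beta> * (\<integral>\<^sup>+s. H (T s) \<partial>lborel) = (\<integral>\<^sup>+x. H x \<partial>lborel)"
    if [measurable]: "H \<in> borel_measurable borel" for H
  proof -
    have "(\<integral>\<^sup>+s. H (x + T s) \<partial>lborel) = (\<integral>\<^sup>+s. H (T s) \<partial>lborel)" for x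
    proof -
      obtain a where "x = T a" using bij by (metis bij_pointE)
      then show ?thesis
        using nn_integral_lborel_plus[of "\<lambda>s. H (T s)" a] lin by (simp add: linear_add)
    qed
    then have "\<beta> * (\<integral>\<^sup>+s. H (T s) \<partial>lborel) = (\<integral>\<^sup>+x. indicator B x * (\<integral>\<^sup>+s. H (x + T s) \<partial>lborel) \<partial>lborel)"
      by (simp add: nn_integral_multc \<beta>_def)
    also have "\<dots> = (\<integral>\<^sup>+x. (\<integral>\<^sup>+s. indicator B x * H (x + T s) \<partial>lborel) \<partial>lborel)"
      by (simp add: nn_integral_cmult)
    also have "\<dots> = (\<integral>\<^sup>+s. (\<integral>\<^sup>+x. indicator B x * H (x + T s) \<partial>lborel) \<partial>lborel)"
      by (rule lborel_pair.Fubini') measurable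
    also have "\<dots> = (\<integral>\<^sup>+s. (\<integral>\<^sup>+y. indicator B (y - T s) * H y \<partial>lborel) \<partial>lborel)"
    proof (rule nn_integral_cong)
      fix s :: 'a
      show "(\<integral>\<^sup>+x. indicator B x * H (x + T s) \<partial>lborel) = (\<integral>\<^sup>+y. indicator B (y - T s) * H y \<partial>lborel)"
        using nn_integral_lborel_plus[of "\<lambda>y. indicator B (y - T s) * H y" "T s"]
        by (simp add: add.commute)
    qed
    also have "\<dots> = (\<integral>\<^sup>+y. (\<integral>\<^sup>+s. indicator B (y - T s) * H y \<partial>lborel) \<partial>lborel)"
      by (rule lborel_pair.Fubini') measurable
    also have "\<dots> = (\<integral>\<^sup>+y. H y \<partial>lborel)"
    proof (rule nn_integral_cong)
      fix y :: 'b
      obtain b where b: "y = T b" using bij by (metis bij_pointE)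
      have "indicator B (y - T s) = (indicator (cbox (b - One) b) s :: ennreal)" for s
      proof -
        have "y - T s \<in> B \<longleftrightarrow> b - s \<in> cbox 0 One"
          unfolding B_def b using lin bij by (metis linear_diff bij_is_inj inj_image_mem_iff)
        also have "\<dots> \<longleftrightarrow> s \<in> cbox (b - One) b"
          by (auto simp: mem_box inner_diff_left)
        finally show ?thesis by (auto simp: indicator_def)
      qed
      then have "(\<integral>\<^sup>+s. indicator B (y - T s) * H y \<partial>lborel) = emeasure lborel (cbox (b - One) b) * H y"
        by (simp add: nn_integral_multc)
      also have "emeasure lborel (cbox (b - One) b) = 1"
        by (subst emeasure_lborel_cbox) (auto simp: inner_diff_left)
      finally show "(\<integral>\<^sup>+s. indicator B (y - T s) * H y \<partial>lborel) = H y" by simp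
    qed
    finally show ?thesis .
  qed
  \<comment> \<open>For \<open>H = 1\<close> the right-hand side of \<open>key\<close> is infinite,
    which excludes \<open>\<beta> = 0\<close>.\<close>
  have "\<beta> \<noteq> 0" using key[of "\<lambda>_. 1"] by auto
  show thesis
  proof (rule that[of "inverse \<beta>"])
    show "0 < inverse \<beta>" using fin by (simp add: ennreal_inverse_positive top.not_eq_extremum)
    show "inverse \<beta> < \<infinity>" using \<open>\<beta> \<noteq> 0\<close> by (simp add: less_top[symmetric])
    fix H :: "'b \<Rightarrow> ennreal" assume "H \<in> borel_measurable borel"
    from key[OF this] have "inverse \<beta> * (\<integral>\<^sup>+x. H x \<partial>lborel) = inverse \<beta> * \<beta> * (\<integral>\<^sup>+s. H (T s) \<partial>lborel)"
      by (simp add: mult.assoc)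
    also have "inverse \<beta> * \<beta> = 1"
      using fin \<open>\<beta> \<noteq> 0\<close> ennreal_divide_self[of \<beta>] by (simp add: divide_ennreal_def mult.commute)
    finally show "(\<integral>\<^sup>+s. H (T s) \<partial>lborel) = inverse \<beta> * (\<integral>\<^sup>+x. H x \<partial>lborel)" by simp
  qed
qed

text \<open>Integrating over \<open>a\<close> first leaves \<open>F1\<close> paired with the
  integral \<open>X\<close> of \<open>F2 a c * F3 a b\<close>. Cauchy-Schwarz in the pair
  \<open>(b, c)\<close> separates \<open>F1\<close>, and Cauchy-Schwarz in \<open>a\<close>
  separates \<open>F2\<close> from \<open>F3\<close>.\<close>

lemma loomis_whitney_3:
  fixes F1 F2 F3 :: "real \<Rightarrow> real \<Rightarrow> ennreal"
  assumes [measurable]: "case_prod F1 \<in> borel_measurable borel" "case_prod F2 \<in> borel_measurable borel"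
    "case_prod F3 \<in> borel_measurable borel"
  shows "(\<integral>\<^sup>+a. \<integral>\<^sup>+b. \<integral>\<^sup>+c. F1 b c * F2 a c * F3 a b \<partial>lborel \<partial>lborel \<partial>lborel)\<^sup>2
    \<le> (\<integral>\<^sup>+b. \<integral>\<^sup>+c. (F1 b c)\<^sup>2 \<partial>lborel \<partial>lborel) * (\<integral>\<^sup>+a. \<integral>\<^sup>+c. (F2 a c)\<^sup>2 \<partial>lborel \<partial>lborel)
       * (\<integral>\<^sup>+a. \<integral>\<^sup>+b. (F3 a b)\<^sup>2 \<partial>lborel \<partial>lborel)"
proof -
  have [measurable]: "case_prod F1 \<in> borel_measurable (borel \<Otimes>\<^sub>M borel)" "case_prod F2 \<in> borel_measurable (borel \<Otimes>\<^sub>M borel)"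
    "case_prod F3 \<in> borel_measurable (borel \<Otimes>\<^sub>M borel)"
    using assms by (simp_all add: borel_prod)
  define X where "X = (\<lambda>b c. \<integral>\<^sup>+a. F2 a c * F3 a b \<partial>lborel)"
  have [measurable]: "case_prod X \<in> borel_measurable (borel \<Otimes>\<^sub>M borel)" unfolding X_def by measurable
  have "(\<integral>\<^sup>+a. \<integral>\<^sup>+b. \<integral>\<^sup>+c. F1 b c * F2 a c * F3 a b \<partial>lborel \<partial>lborel \<partial>lborel)
     = (\<integral>\<^sup>+b. \<integral>\<^sup>+a. \<integral>\<^sup>+c. F1 b c * F2 a c * F3 a b \<partial>lborel \<partial>lborel \<partial>lborel)"
    by (rule lborel_pair.Fubini') measurable
  also have "\<dots> = (\<integral>\<^sup>+b. \<integral>\<^sup>+c. \<integral>\<^sup>+a. F1 b c * F2 a c * F3 a b \<partial>lborel \<partial>lborel \<partial>lborel)"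
    by (intro nn_integral_cong lborel_pair.Fubini') measurable
  also have "\<dots> = (\<integral>\<^sup>+b. \<integral>\<^sup>+c. F1 b c * X b c \<partial>lborel \<partial>lborel)"
    unfolding X_def by (simp add: nn_integral_cmult mult.assoc)
  also have "\<dots> = (\<integral>\<^sup>+z. case_prod F1 z * case_prod X z \<partial>(lborel \<Otimes>\<^sub>M lborel))"
    by (subst lborel.nn_integral_fst[symmetric]) auto
  finally have "(\<integral>\<^sup>+a. \<integral>\<^sup>+b. \<integral>\<^sup>+c. F1 b c * F2 a c * F3 a b \<partial>lborel \<partial>lborel \<partial>lborel)\<^sup>2
    \<le> (\<integral>\<^sup>+z. (case_prod F1 z)\<^sup>2 \<partial>(lborel \<Otimes>\<^sub>M lborel)) * (\<integral>\<^sup>+z. (case_prod X z)\<^sup>2 \<partial>(lborel \<Otimes>\<^sub>M lborel))"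
    using Cauchy_Schwarz_nn_integral[of "case_prod F1" "lborel \<Otimes>\<^sub>M lborel" "case_prod X"] by simp
  also have "(\<integral>\<^sup>+z. (case_prod F1 z)\<^sup>2 \<partial>(lborel \<Otimes>\<^sub>M lborel)) = (\<integral>\<^sup>+b. \<integral>\<^sup>+c. (F1 b c)\<^sup>2 \<partial>lborel \<partial>lborel)"
    by (subst lborel.nn_integral_fst[symmetric]) auto
  also have "(\<integral>\<^sup>+z. (case_prod X z)\<^sup>2 \<partial>(lborel \<Otimes>\<^sub>M lborel)) = (\<integral>\<^sup>+b. \<integral>\<^sup>+c. (X b c)\<^sup>2 \<partial>lborel \<partial>lborel)"
    by (subst lborel.nn_integral_fst[symmetric]) auto
  also have "(\<integral>\<^sup>+b. \<integral>\<^sup>+c. (X b c)\<^sup>2 \<partial>lborel \<partial>lborel)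
     \<le> (\<integral>\<^sup>+b. \<integral>\<^sup>+c. (\<integral>\<^sup>+a. (F2 a c)\<^sup>2 \<partial>lborel) * (\<integral>\<^sup>+a. (F3 a b)\<^sup>2 \<partial>lborel) \<partial>lborel \<partial>lborel)"
    unfolding X_def by (intro nn_integral_mono Cauchy_Schwarz_nn_integral) measurable
  also have "\<dots> = (\<integral>\<^sup>+c. \<integral>\<^sup>+a. (F2 a c)\<^sup>2 \<partial>lborel \<partial>lborel) * (\<integral>\<^sup>+b. \<integral>\<^sup>+a. (F3 a b)\<^sup>2 \<partial>lborel \<partial>lborel)"
    by (simp add: nn_integral_cmult nn_integral_multc)
  also have "(\<integral>\<^sup>+c. \<integral>\<^sup>+a. (F2 a c)\<^sup>2 \<partial>lborel \<partial>lborel) = (\<integral>\<^sup>+a. \<integral>\<^sup>+c. (F2 a c)\<^sup>2 \<partial>lborel \<partial>lborel)"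
    by (rule lborel_pair.Fubini') measurable
  also have "(\<integral>\<^sup>+b. \<integral>\<^sup>+a. (F3 a b)\<^sup>2 \<partial>lborel \<partial>lborel) = (\<integral>\<^sup>+a. \<integral>\<^sup>+b. (F3 a b)\<^sup>2 \<partial>lborel \<partial>lborel)"
    by (rule lborel_pair.Fubini') measurable
  finally show ?thesis by (simp add: mult.assoc mult_left_mono)
qed

text \<open>Line integrals may be infinite, and \<open>enn2real\<close> maps \<open>top\<close> to
  0; the value at \<open>top\<close> is therefore set by hand, so that squaring recovers the
  argument without a finiteness assumption.\<close>

definition ennsqrt :: "ennreal \<Rightarrow> ennreal" where
  "ennsqrt x = (if x = top then top else ennreal (sqrt (enn2real x)))"

lemma ennsqrt_power2: "(ennsqrt x)\<^sup>2 = x"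
proof (cases x)
  case (real r)
  then show ?thesis by (simp add: ennsqrt_def ennreal_power)
qed (simp add: ennsqrt_def power2_eq_square)

lemma measurable_ennsqrt [measurable]: "ennsqrt \<in> borel_measurable borel"
  unfolding ennsqrt_def by measurable

lemma le_ennsqrt:
  assumes "u \<ge> 0" "ennreal (u\<^sup>2) \<le> x"
  shows "ennreal u \<le> ennsqrt x"
proof (cases x)
  case (real r)
  then have "u\<^sup>2 \<le> r" using assms by simp
  then have "u \<le> sqrt r" using assms by (simp add: real_le_rsqrt)
  then show ?thesis using real by (simp add: ennsqrt_def ennreal_leI)
qed (simp add: ennsqrt_def)

text \<open>This makes a line integral a function of the remaining coordinates only.\<close>

lemma line_integral_invariant:
  fixes g :: "'b::euclidean_space \<Rightarrow> ennreal"
  assumes [measurable]: "g \<in> borel_measurable borel"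
  shows "(\<integral>\<^sup>+t. g (x + a *\<^sub>R v + t *\<^sub>R v) \<partial>lborel) = (\<integral>\<^sup>+t. g (x + t *\<^sub>R v) \<partial>lborel)"
  using nn_integral_lborel_plus[of "\<lambda>t. g (x + t *\<^sub>R v)" a] by (simp add: scaleR_add_left add.assoc)

lemma nn_integral_lborel_pair:
  fixes f :: "'a::euclidean_space \<times> 'b::euclidean_space \<Rightarrow> ennreal"
  assumes "f \<in> borel_measurable borel"
  shows "(\<integral>\<^sup>+z. f z \<partial>lborel) = (\<integral>\<^sup>+x. \<integral>\<^sup>+y. f (x, y) \<partial>lborel \<partial>lborel)"
  using assms by (subst lborel.nn_integral_fst) (auto simp: lborel_prod)

lemma ennreal_cancel_powers:
  fixes c X Y :: ennreal
  assumes c: "0 < c" "c < \<infinity>" and le: "c\<^sup>2 * X \<le> c ^ 3 * Y"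
  shows "X \<le> c * Y"
proof -
  have i: "inverse c * c = 1"
    using c ennreal_divide_self[of c] by (simp add: divide_ennreal_def mult.commute)
  have "X = (inverse c * c)\<^sup>2 * X" by (simp add: i)
  also have "\<dots> = (inverse c)\<^sup>2 * (c\<^sup>2 * X)" by (simp add: power_mult_distrib mult.assoc)
  also have "\<dots> \<le> (inverse c)\<^sup>2 * (c ^ 3 * Y)" by (intro mult_left_mono le) auto
  also have "\<dots> = (inverse c * c)\<^sup>2 * (c * Y)"
    by (simp add: power_mult_distrib power3_eq_cube power2_eq_square mult_ac)
  finally show ?thesis by (simp add: i)
qed

text \<open>In the plane \<open>g\<close> itself plays the role of the third line integral, so that both dimensions
  give the same exponents.\<close>

lemma gagliardo_2:
  fixes v w :: "'b::euclidean_space"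
  assumes bij: "bij (\<lambda>(a, b). a *\<^sub>R v + b *\<^sub>R w)"
  shows "\<exists>c<\<infinity>. \<forall>U g. U \<in> borel_measurable borel \<longrightarrow> g \<in> borel_measurable borel \<longrightarrow> (\<forall>x. U x \<ge> 0) \<longrightarrow>
    (\<forall>u\<in>{v, w}. AE x in lborel. ennreal ((U x)\<^sup>2) \<le> (\<integral>\<^sup>+t. g (x + t *\<^sub>R u) \<partial>lborel)) \<longrightarrow>
    (AE x in lborel. ennreal ((U x)\<^sup>2) \<le> g x) \<longrightarrow>
    (\<integral>\<^sup>+x. ennreal (U x ^ 3) \<partial>lborel)\<^sup>2 \<le> c * (\<integral>\<^sup>+x. g x \<partial>lborel) ^ 3"
proof -
  define T where "T = (\<lambda>(a :: real, b :: real). a *\<^sub>R v + b *\<^sub>R w)"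
  have lin: "linear T" unfolding T_def by (rule linearI) (auto simp: algebra_simps)
  have "continuous_on UNIV T" using lin by (simp add: linear_continuous_on linear_conv_bounded_linear)
  then have T[measurable]: "T \<in> borel_measurable borel" by (rule borel_measurable_continuous_onI)
  obtain c where c: "0 < c" "c < \<infinity>"
    and cT: "\<And>H. H \<in> borel_measurable borel \<Longrightarrow> (\<integral>\<^sup>+s. H (T s) \<partial>lborel) = c * (\<integral>\<^sup>+x. H x \<partial>lborel)"
    using nn_integral_linear_bij[OF lin] bij unfolding T_def by blast
  have nested: "(\<integral>\<^sup>+a. \<integral>\<^sup>+b. H (T (a, b)) \<partial>lborel \<partial>lborel) = c * (\<integral>\<^sup>+x. H x \<partial>lborel)"
    if [measurable]: "H \<in> borel_measurable borel" for H
    using cT[OF that] by (subst (asm) nn_integral_lborel_pair) auto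
  show ?thesis
  proof (intro exI[of _ c] conjI allI impI c)
    fix U :: "'b \<Rightarrow> real" and g :: "'b \<Rightarrow> ennreal"
    assume [measurable]: "U \<in> borel_measurable borel" "g \<in> borel_measurable borel"
      and U0: "\<forall>x. U x \<ge> 0"
      and Uv: "\<forall>u\<in>{v, w}. AE x in lborel. ennreal ((U x)\<^sup>2) \<le> (\<integral>\<^sup>+t. g (x + t *\<^sub>R u) \<partial>lborel)"
      and Ug: "AE x in lborel. ennreal ((U x)\<^sup>2) \<le> g x"
    define I where "I = (\<integral>\<^sup>+x. g x \<partial>lborel)"
    define f where "f = (\<lambda>u x. \<integral>\<^sup>+t. g (x + t *\<^sub>R u) \<partial>lborel)"
    have fm[measurable]: "f u \<in> borel_measurable borel" for u unfolding f_def by measurable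
    have fT: "f v (T (a, b)) = f v (T (0, b))" "f w (T (a, b)) = f w (T (a, 0))" for a b
      using line_integral_invariant[of g "b *\<^sub>R w" a v] line_integral_invariant[of g "a *\<^sub>R v" b w]
      by (simp_all add: f_def T_def add.commute)
    have gT[measurable]: "(\<lambda>s. g (T s)) \<in> borel_measurable (borel \<Otimes>\<^sub>M borel)" by (simp add: borel_prod)
    \<comment> \<open>Each of the two line integrals depends on one coordinate only, so the integral
      of their product factorizes.\<close>
    have "c * (\<integral>\<^sup>+x. f v x * f w x \<partial>lborel) = (\<integral>\<^sup>+a. \<integral>\<^sup>+b. f v (T (0, b)) * f w (T (a, 0)) \<partial>lborel \<partial>lborel)"
    proof -
      have e: "f v (T (a, b)) * f w (T (a, b)) = f v (T (0, b)) * f w (T (a, 0))" for a b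
        unfolding fT(1)[of a b] fT(2)[of a b] ..
      show ?thesis unfolding e[symmetric] by (rule nested[symmetric]) measurable
    qed
    also have "\<dots> = (\<integral>\<^sup>+b. f v (T (0, b)) \<partial>lborel) * (\<integral>\<^sup>+a. f w (T (a, 0)) \<partial>lborel)"
      by (simp add: nn_integral_cmult nn_integral_multc)
    also have "(\<integral>\<^sup>+b. f v (T (0, b)) \<partial>lborel) = (\<integral>\<^sup>+b. \<integral>\<^sup>+a. g (T (a, b)) \<partial>lborel \<partial>lborel)"
      by (simp add: f_def T_def add.commute)
    also have "\<dots> = (\<integral>\<^sup>+a. \<integral>\<^sup>+b. g (T (a, b)) \<partial>lborel \<partial>lborel)"
      by (rule lborel_pair.Fubini') measurable
    also have "\<dots> = c * I" unfolding I_def by (rule nested) simp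
    also have "(\<integral>\<^sup>+a. f w (T (a, 0)) \<partial>lborel) = c * I"
      unfolding I_def by (subst nested[symmetric]) (simp_all add: f_def T_def)
    finally have ff: "c * (\<integral>\<^sup>+x. f v x * f w x \<partial>lborel) = c * I * (c * I)" .
    have "(\<integral>\<^sup>+x. ennreal (U x ^ 3) \<partial>lborel) \<le> (\<integral>\<^sup>+x. ennsqrt (f v x) * ennsqrt (f w x) * ennsqrt (g x) \<partial>lborel)"
    proof (rule nn_integral_mono_AE)
      have "AE x in lborel. ennreal ((U x)\<^sup>2) \<le> f v x" "AE x in lborel. ennreal ((U x)\<^sup>2) \<le> f w x"
        using Uv by (auto simp: f_def)
      with Ug show "AE x in lborel. ennreal (U x ^ 3) \<le> ennsqrt (f v x) * ennsqrt (f w x) * ennsqrt (g x)"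
      proof eventually_elim
        case (elim x)
        have "ennreal (U x ^ 3) = ennreal (U x) * ennreal (U x) * ennreal (U x)"
          using U0 by (simp add: power3_eq_cube ennreal_mult')
        also have "\<dots> \<le> ennsqrt (f v x) * ennsqrt (f w x) * ennsqrt (g x)"
          by (intro mult_mono le_ennsqrt) (use U0 elim in auto)
        finally show ?case .
      qed
    qed
    then have "(\<integral>\<^sup>+x. ennreal (U x ^ 3) \<partial>lborel)\<^sup>2
       \<le> (\<integral>\<^sup>+x. (ennsqrt (f v x) * ennsqrt (f w x)) * ennsqrt (g x) \<partial>lborel)\<^sup>2"
      by (intro power_mono) auto
    also have "\<dots> \<le> (\<integral>\<^sup>+x. (ennsqrt (f v x) * ennsqrt (f w x))\<^sup>2 \<partial>lborel) * (\<integral>\<^sup>+x. (ennsqrt (g x))\<^sup>2 \<partial>lborel)"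
      by (rule Cauchy_Schwarz_nn_integral) measurable
    also have "\<dots> = (\<integral>\<^sup>+x. f v x * f w x \<partial>lborel) * I"
      by (simp add: power_mult_distrib ennsqrt_power2 I_def)
    finally have le: "(\<integral>\<^sup>+x. ennreal (U x ^ 3) \<partial>lborel)\<^sup>2 \<le> (\<integral>\<^sup>+x. f v x * f w x \<partial>lborel) * I" .
    have "c\<^sup>2 * (\<integral>\<^sup>+x. ennreal (U x ^ 3) \<partial>lborel)\<^sup>2 \<le> c\<^sup>2 * ((\<integral>\<^sup>+x. f v x * f w x \<partial>lborel) * I)"
      by (intro mult_left_mono le) auto
    also have "\<dots> = c * (c * (\<integral>\<^sup>+x. f v x * f w x \<partial>lborel)) * I"
      by (simp add: power2_eq_square mult_ac)
    also have "\<dots> = c ^ 3 * I ^ 3" unfolding ff by (simp add: power3_eq_cube mult_ac)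
    finally show "(\<integral>\<^sup>+x. ennreal (U x ^ 3) \<partial>lborel)\<^sup>2 \<le> c * I ^ 3"
      by (rule ennreal_cancel_powers[OF c])
  qed
qed

text \<open>In coordinates of the basis, the line integral in direction \<open>u\<close> does not
  see the coordinate along \<open>u\<close>, and likewise for \<open>v\<close> and \<open>w\<close>.
  Loomis-Whitney is applied to the three square roots; by Fubini each squared factor integrates to
  \<open>c\<close> times the full integral of \<open>g\<close>. The change of variables thus gives
  \<open>c ^ 3\<close> on the right but only \<open>c\<^sup>2\<close> on the left, so one
  \<open>c\<close> survives.\<close>

lemma gagliardo_3:
  fixes u v w :: "'b::euclidean_space"
  assumes bij: "bij (\<lambda>(a, b, d). a *\<^sub>R u + b *\<^sub>R v + d *\<^sub>R w)"
  shows "\<exists>c<\<infinity>. \<forall>U g. U \<in> borel_measurable borel \<longrightarrow> g \<in> borel_measurable borel \<longrightarrow> (\<forall>x. U x \<ge> 0) \<longrightarrow>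
    (\<forall>z\<in>{u, v, w}. AE x in lborel. ennreal ((U x)\<^sup>2) \<le> (\<integral>\<^sup>+t. g (x + t *\<^sub>R z) \<partial>lborel)) \<longrightarrow>
    (\<integral>\<^sup>+x. ennreal (U x ^ 3) \<partial>lborel)\<^sup>2 \<le> c * (\<integral>\<^sup>+x. g x \<partial>lborel) ^ 3"
proof -
  define T where "T = (\<lambda>(a :: real, b :: real, d :: real). a *\<^sub>R u + b *\<^sub>R v + d *\<^sub>R w)"
  have lin: "linear T" unfolding T_def by (rule linearI) (auto simp: algebra_simps)
  have "continuous_on UNIV T" using lin by (simp add: linear_continuous_on linear_conv_bounded_linear)
  then have T[measurable]: "T \<in> borel_measurable borel" by (rule borel_measurable_continuous_onI)
  obtain c where c: "0 < c" "c < \<infinity>"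
    and cT: "\<And>H. H \<in> borel_measurable borel \<Longrightarrow> (\<integral>\<^sup>+s. H (T s) \<partial>lborel) = c * (\<integral>\<^sup>+x. H x \<partial>lborel)"
    using nn_integral_linear_bij[OF lin] bij unfolding T_def by blast
  have TT[measurable]: "(\<lambda>(a, b, d). H (T (a, b, d))) \<in> borel_measurable (borel \<Otimes>\<^sub>M borel \<Otimes>\<^sub>M borel)"
    if [measurable]: "H \<in> borel_measurable borel" for H :: "'b \<Rightarrow> ennreal"
  proof -
    have "(\<lambda>s. H (T s)) \<in> borel_measurable borel" by measurable
    then show ?thesis by (simp add: borel_prod case_prod_unfold)
  qed
  have nested: "(\<integral>\<^sup>+a. \<integral>\<^sup>+b. \<integral>\<^sup>+d. H (T (a, b, d)) \<partial>lborel \<partial>lborel \<partial>lborel) = c * (\<integral>\<^sup>+x. H x \<partial>lborel)"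
    if [measurable]: "H \<in> borel_measurable borel" for H
  proof -
    have "c * (\<integral>\<^sup>+x. H x \<partial>lborel) = (\<integral>\<^sup>+a. \<integral>\<^sup>+z. H (T (a, z)) \<partial>lborel \<partial>lborel)"
      by (subst cT[symmetric]) (auto intro!: nn_integral_lborel_pair)
    also have "\<dots> = (\<integral>\<^sup>+a. \<integral>\<^sup>+b. \<integral>\<^sup>+d. H (T (a, b, d)) \<partial>lborel \<partial>lborel \<partial>lborel)"
    proof (rule nn_integral_cong)
      fix a :: real
      have "(\<lambda>z. T (a, z)) \<in> borel_measurable borel"
        by (rule borel_measurable_continuous_onI)
          (auto intro!: continuous_on_compose2[OF \<open>continuous_on UNIV T\<close>] continuous_intros)
      then have "(\<lambda>z. H (T (a, z))) \<in> borel_measurable borel"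
        by (rule measurable_compose) fact
      then show "(\<integral>\<^sup>+z. H (T (a, z)) \<partial>lborel) = (\<integral>\<^sup>+b. \<integral>\<^sup>+d. H (T (a, b, d)) \<partial>lborel \<partial>lborel)"
        by (rule nn_integral_lborel_pair)
    qed
    finally show ?thesis ..
  qed
  show ?thesis
  proof (intro exI[of _ c] conjI allI impI c)
    fix U :: "'b \<Rightarrow> real" and g :: "'b \<Rightarrow> ennreal"
    assume [measurable]: "U \<in> borel_measurable borel" "g \<in> borel_measurable borel"
      and U0: "\<forall>x. U x \<ge> 0"
      and Uv: "\<forall>z\<in>{u, v, w}. AE x in lborel. ennreal ((U x)\<^sup>2) \<le> (\<integral>\<^sup>+t. g (x + t *\<^sub>R z) \<partial>lborel)"
    define I where "I = (\<integral>\<^sup>+x. g x \<partial>lborel)"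
    define f where "f = (\<lambda>z x. \<integral>\<^sup>+t. g (x + t *\<^sub>R z) \<partial>lborel)"
    have fm[measurable]: "f z \<in> borel_measurable borel" for z unfolding f_def by measurable
    have fT: "f u (T (a, b, d)) = f u (T (0, b, d))" "f v (T (a, b, d)) = f v (T (a, 0, d))"
      "f w (T (a, b, d)) = f w (T (a, b, 0))" for a b d
      using line_integral_invariant[of g "b *\<^sub>R v + d *\<^sub>R w" a u]
        line_integral_invariant[of g "a *\<^sub>R u + d *\<^sub>R w" b v]
        line_integral_invariant[of g "a *\<^sub>R u + b *\<^sub>R v" d w]
      by (simp_all add: f_def T_def add_ac)
    define F where "F = (\<lambda>z x. ennsqrt (f z x))"
    have [measurable]: "F z \<in> borel_measurable borel" for z unfolding F_def by measurable
    have "(\<integral>\<^sup>+x. ennreal (U x ^ 3) \<partial>lborel) \<le> (\<integral>\<^sup>+x. F u x * F v x * F w x \<partial>lborel)"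
    proof (rule nn_integral_mono_AE)
      have "AE x in lborel. ennreal ((U x)\<^sup>2) \<le> f u x" "AE x in lborel. ennreal ((U x)\<^sup>2) \<le> f v x"
        "AE x in lborel. ennreal ((U x)\<^sup>2) \<le> f w x"
        using Uv by (auto simp: f_def)
      then show "AE x in lborel. ennreal (U x ^ 3) \<le> F u x * F v x * F w x"
        unfolding F_def
      proof eventually_elim
        case (elim x)
        \<comment> \<open>One factor \<open>U x\<close> is spent on each of the three bounds for its
          square.\<close>
        have "ennreal (U x ^ 3) = ennreal (U x) * ennreal (U x) * ennreal (U x)"
          using U0 by (simp add: power3_eq_cube ennreal_mult')
        also have "\<dots> \<le> ennsqrt (f u x) * ennsqrt (f v x) * ennsqrt (f w x)"
          by (intro mult_mono le_ennsqrt) (use U0 elim in auto)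
        finally show ?case .
      qed
    qed
    then have "c\<^sup>2 * (\<integral>\<^sup>+x. ennreal (U x ^ 3) \<partial>lborel)\<^sup>2 \<le> c\<^sup>2 * (\<integral>\<^sup>+x. F u x * F v x * F w x \<partial>lborel)\<^sup>2"
      by (intro mult_left_mono power_mono) auto
    also have "\<dots> = (c * (\<integral>\<^sup>+x. F u x * F v x * F w x \<partial>lborel))\<^sup>2"
      by (simp add: power_mult_distrib)
    also have "c * (\<integral>\<^sup>+x. F u x * F v x * F w x \<partial>lborel)
      = (\<integral>\<^sup>+a. \<integral>\<^sup>+b. \<integral>\<^sup>+d. F u (T (0, b, d)) * F v (T (a, 0, d)) * F w (T (a, b, 0)) \<partial>lborel \<partial>lborel \<partial>lborel)"
    proof -
      have e: "F u (T (a, b, d)) * F v (T (a, b, d)) * F w (T (a, b, d))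
         = F u (T (0, b, d)) * F v (T (a, 0, d)) * F w (T (a, b, 0))" for a b d
        unfolding F_def fT(1)[of a b d] fT(2)[of a b d] fT(3)[of a b d] ..
      show ?thesis unfolding e[symmetric] by (rule nested[symmetric]) measurable
    qed
    also have "\<dots>\<^sup>2 \<le> (\<integral>\<^sup>+b. \<integral>\<^sup>+d. (F u (T (0, b, d)))\<^sup>2 \<partial>lborel \<partial>lborel)
         * (\<integral>\<^sup>+a. \<integral>\<^sup>+d. (F v (T (a, 0, d)))\<^sup>2 \<partial>lborel \<partial>lborel)
         * (\<integral>\<^sup>+a. \<integral>\<^sup>+b. (F w (T (a, b, 0)))\<^sup>2 \<partial>lborel \<partial>lborel)"
    proof (rule loomis_whitney_3)
      have "(\<lambda>p. F z (T (S p))) \<in> borel_measurable borel" if "continuous_on UNIV S"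
        for z and S :: "real \<times> real \<Rightarrow> real \<times> real \<times> real"
      proof -
        have "S \<in> borel_measurable borel" using that by (rule borel_measurable_continuous_onI)
        then show ?thesis by measurable
      qed
      note m = this[unfolded comp_def]
      show "(\<lambda>(b, d). F u (T (0, b, d))) \<in> borel_measurable borel"
        "(\<lambda>(a, d). F v (T (a, 0, d))) \<in> borel_measurable borel"
        "(\<lambda>(a, b). F w (T (a, b, 0))) \<in> borel_measurable borel"
        unfolding case_prod_unfold by (rule m; intro continuous_intros)+
    qed
    also have "(\<integral>\<^sup>+b. \<integral>\<^sup>+d. (F u (T (0, b, d)))\<^sup>2 \<partial>lborel \<partial>lborel) = c * I"
    proof -
      have "(\<integral>\<^sup>+b. \<integral>\<^sup>+d. (F u (T (0, b, d)))\<^sup>2 \<partial>lborel \<partial>lborel)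
         = (\<integral>\<^sup>+b. \<integral>\<^sup>+d. \<integral>\<^sup>+a. g (T (a, b, d)) \<partial>lborel \<partial>lborel \<partial>lborel)"
        by (simp add: F_def ennsqrt_power2 f_def T_def add_ac)
      also have "\<dots> = (\<integral>\<^sup>+b. \<integral>\<^sup>+a. \<integral>\<^sup>+d. g (T (a, b, d)) \<partial>lborel \<partial>lborel \<partial>lborel)"
        by (intro nn_integral_cong lborel_pair.Fubini') measurable
      also have "\<dots> = (\<integral>\<^sup>+a. \<integral>\<^sup>+b. \<integral>\<^sup>+d. g (T (a, b, d)) \<partial>lborel \<partial>lborel \<partial>lborel)"
        by (rule lborel_pair.Fubini') measurable
      also have "\<dots> = c * I" unfolding I_def by (rule nested) simp
      finally show ?thesis .
    qed
    also have "(\<integral>\<^sup>+a. \<integral>\<^sup>+d. (F v (T (a, 0, d)))\<^sup>2 \<partial>lborel \<partial>lborel) = c * I"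
    proof -
      have "(\<integral>\<^sup>+a. \<integral>\<^sup>+d. (F v (T (a, 0, d)))\<^sup>2 \<partial>lborel \<partial>lborel)
         = (\<integral>\<^sup>+a. \<integral>\<^sup>+d. \<integral>\<^sup>+b. g (T (a, b, d)) \<partial>lborel \<partial>lborel \<partial>lborel)"
        by (simp add: F_def ennsqrt_power2 f_def T_def add_ac)
      also have "\<dots> = (\<integral>\<^sup>+a. \<integral>\<^sup>+b. \<integral>\<^sup>+d. g (T (a, b, d)) \<partial>lborel \<partial>lborel \<partial>lborel)"
        by (intro nn_integral_cong lborel_pair.Fubini') measurable
      also have "\<dots> = c * I" unfolding I_def by (rule nested) simp
      finally show ?thesis .
    qed
    also have "(\<integral>\<^sup>+a. \<integral>\<^sup>+b. (F w (T (a, b, 0)))\<^sup>2 \<partial>lborel \<partial>lborel) = c * I"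
      unfolding I_def by (subst nested[symmetric]) (simp_all add: F_def ennsqrt_power2 f_def T_def)
    finally have "c\<^sup>2 * (\<integral>\<^sup>+x. ennreal (U x ^ 3) \<partial>lborel)\<^sup>2 \<le> c ^ 3 * I ^ 3"
      by (simp add: power3_eq_cube mult_ac)
    then show "(\<integral>\<^sup>+x. ennreal (U x ^ 3) \<partial>lborel)\<^sup>2 \<le> c * I ^ 3"
      by (rule ennreal_cancel_powers[OF c])
  qed
qed

section \<open>Cone condition\<close>

text \<open>The coordinate map of a basis is a linear bijection, which puts both dimensions into one
  form; nothing later distinguishes them.\<close>

lemma gagliardo:
  fixes B :: "'b::euclidean_space set"
  assumes dim: "DIM('b) \<in> {2, 3}" and B: "independent B" "span B = UNIV"
  shows "\<exists>c<\<infinity>. \<forall>U g. U \<in> borel_measurable borel \<longrightarrow> g \<in> borel_measurable borel \<longrightarrow> (\<forall>x. U x \<ge> 0) \<longrightarrow>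
    (\<forall>u\<in>B. AE x in lborel. ennreal ((U x)\<^sup>2) \<le> (\<integral>\<^sup>+t. g (x + t *\<^sub>R u) \<partial>lborel)) \<longrightarrow>
    (AE x in lborel. ennreal ((U x)\<^sup>2) \<le> g x) \<longrightarrow>
    (\<integral>\<^sup>+x. ennreal (U x ^ 3) \<partial>lborel)\<^sup>2 \<le> c * (\<integral>\<^sup>+x. g x \<partial>lborel) ^ 3"
proof -
  have "card B = dim (UNIV :: 'b set)"
    using B dim_span_eq_card_independent by metis
  then have "card B = 2 \<or> card B = 3" using dim by auto
  then show ?thesis
  proof
    assume "card B = 2"
    then obtain v w where Bvw: "B = {v, w}" "v \<noteq> w" by (auto simp: card_2_iff)
    have "bij (\<lambda>(a, b). a *\<^sub>R v + b *\<^sub>R w)"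
    proof (rule bijI)
      have "linear (\<lambda>(a, b). a *\<^sub>R v + b *\<^sub>R w)" by (rule linearI) (auto simp: algebra_simps)
      moreover have "a = 0 \<and> b = 0" if "a *\<^sub>R v + b *\<^sub>R w = 0" for a b
      proof -
        let ?f = "\<lambda>z. if z = v then a else b"
        have "(\<Sum>z\<in>B. ?f z *\<^sub>R z) = 0" using that Bvw by simp
        moreover have "finite B" using Bvw by simp
        ultimately have f0: "?f z = 0" if "z \<in> B" for z
          using that by (intro independentD[OF B(1), of B]) auto
        show ?thesis using Bvw f0[of v] f0[of w] by simp
      qed
      ultimately show "inj (\<lambda>(a, b). a *\<^sub>R v + b *\<^sub>R w)"
        by (subst linear_injective_0) (auto simp: prod_eq_iff)
      show "surj (\<lambda>(a, b). a *\<^sub>R v + b *\<^sub>R w)"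
      proof (unfold surj_def, rule allI)
        fix x :: 'b
        have "x \<in> span {v, w}" using B Bvw by simp
        then obtain a where "x - a *\<^sub>R v \<in> span {w}" unfolding span_insert[of v] by blast
        then obtain b where "x - a *\<^sub>R v = b *\<^sub>R w" unfolding span_singleton by blast
        then have "x = a *\<^sub>R v + b *\<^sub>R w" by (simp add: diff_eq_eq add_ac)
        then show "\<exists>s. x = (case s of (a, b) \<Rightarrow> a *\<^sub>R v + b *\<^sub>R w)" by (intro exI[of _ "(a, b)"]) simp
      qed
    qed
    from gagliardo_2[OF this] show ?thesis unfolding Bvw .
  next
    assume "card B = 3"
    then obtain u v w where Buvw: "B = {u, v, w}" "u \<noteq> v" "u \<noteq> w" "v \<noteq> w" by (auto simp: card_3_iff)
    have "bij (\<lambda>(a, b, d). a *\<^sub>R u + b *\<^sub>R v + d *\<^sub>R w)"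
    proof (rule bijI)
      have "linear (\<lambda>(a, b, d). a *\<^sub>R u + b *\<^sub>R v + d *\<^sub>R w)" by (rule linearI) (auto simp: algebra_simps)
      moreover have "a = 0 \<and> b = 0 \<and> d = 0" if "a *\<^sub>R u + b *\<^sub>R v + d *\<^sub>R w = 0" for a b d
      proof -
        let ?f = "\<lambda>z. if z = u then a else if z = v then b else d"
        have "(\<Sum>z\<in>B. ?f z *\<^sub>R z) = 0" using that Buvw by (simp add: add.assoc)
        moreover have "finite B" using Buvw by simp
        ultimately have f0: "?f z = 0" if "z \<in> B" for z
          using that by (intro independentD[OF B(1), of B]) auto
        show ?thesis using Buvw f0[of u] f0[of v] f0[of w] by simp
      qed
      ultimately show "inj (\<lambda>(a, b, d). a *\<^sub>R u + b *\<^sub>R v + d *\<^sub>R w)"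
        by (subst linear_injective_0) (auto simp: prod_eq_iff)
      show "surj (\<lambda>(a, b, d). a *\<^sub>R u + b *\<^sub>R v + d *\<^sub>R w)"
      proof (unfold surj_def, rule allI)
        fix x :: 'b
        have "x \<in> span {u, v, w}" using B Buvw by simp
        then obtain a where "x - a *\<^sub>R u \<in> span {v, w}" unfolding span_insert[of u] by blast
        then obtain b where "x - a *\<^sub>R u - b *\<^sub>R v \<in> span {w}" unfolding span_insert[of v] by blast
        then obtain d where "x - a *\<^sub>R u - b *\<^sub>R v = d *\<^sub>R w" unfolding span_singleton by blast
        then have "x = a *\<^sub>R u + b *\<^sub>R v + d *\<^sub>R w" by (simp add: diff_eq_eq add_ac)
        then show "\<exists>s. x = (case s of (a, b, d) \<Rightarrow> a *\<^sub>R u + b *\<^sub>R v + d *\<^sub>R w)"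
          by (intro exI[of _ "(a, b, d)"]) simp
      qed
    qed
    from gagliardo_3[OF this] obtain c where c: "c < \<infinity>" and
      "\<forall>U g. U \<in> borel_measurable borel \<longrightarrow> g \<in> borel_measurable borel \<longrightarrow> (\<forall>x. U x \<ge> 0) \<longrightarrow>
        (\<forall>z\<in>B. AE x in lborel. ennreal ((U x)\<^sup>2) \<le> (\<integral>\<^sup>+t. g (x + t *\<^sub>R z) \<partial>lborel)) \<longrightarrow>
        (\<integral>\<^sup>+x. ennreal (U x ^ 3) \<partial>lborel)\<^sup>2 \<le> c * (\<integral>\<^sup>+x. g x \<partial>lborel) ^ 3"
      unfolding Buvw by (elim exE conjE)
    then show ?thesis by (intro exI[of _ c] conjI c allI impI) simp
  qed
qed

text \<open>Every vector is a multiple of a difference of two points of a small ball.\<close>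

lemma span_open_UNIV:
  fixes S :: "'a::euclidean_space set"
  assumes "open S" "S \<noteq> {}"
  shows "span S = UNIV"
proof -
  obtain x e where x: "x \<in> S" "e > 0" "ball x e \<subseteq> S" using assms open_contains_ball by blast
  have "v \<in> span S" for v
  proof (cases "v = 0")
    case False
    define y where "y = x + (e / (2 * norm v)) *\<^sub>R v"
    have "y \<in> S" using x False by (auto simp: y_def dist_norm intro!: subsetD[OF x(3)])
    then have "(2 * norm v / e) *\<^sub>R (y - x) \<in> span S"
      using x by (intro span_scale span_diff span_base)
    then show ?thesis using x False by (simp add: y_def)
  qed (simp add: span_zero)
  then show ?thesis by auto
qed

text \<open>Only the edges of the cone are recorded, since the line integrals are taken along a
  basis. The lengths are scaled into \<open>B\<close>. The value \<open>s = 0\<close> is excluded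
  because points of \<open>A\<close> may lie on the boundary of \<open>\<Omega>\<close>.\<close>

definition cone_condition :: "'a::euclidean_space set \<Rightarrow> 'a set \<Rightarrow> bool" where
  "cone_condition \<Omega> A \<longleftrightarrow> (\<exists>B. independent B \<and> span B = UNIV \<and>
     (\<forall>x\<in>A. \<forall>b\<in>B. \<forall>s. 0 < s \<and> s \<le> 1 \<longrightarrow> x + s *\<^sub>R b \<in> \<Omega>))"

lemma cone_condition_mono: "cone_condition \<Omega> A \<Longrightarrow> \<Omega> \<subseteq> \<Omega>' \<Longrightarrow> cone_condition \<Omega>' A"
  unfolding cone_condition_def by (meson subsetD)

text \<open>A point of \<open>P = conv V\<close> puts weight at least \<open>1/|V|\<close> on some vertex \<open>v\<close>, and so can be moved
  inside \<open>P\<close> in all directions \<open>y - v\<close>.  This is the cone condition for \<open>P\<close>, with finitely many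
  cones.\<close>

lemma polytope_cone_cover:
  fixes P :: "'a::euclidean_space set"
  assumes "polytope P" and int: "interior P \<noteq> {}"
  obtains \<A> where "finite \<A>" "P \<subseteq> \<Union>\<A>" "\<And>A. A \<in> \<A> \<Longrightarrow> closed A"
    "\<And>A. A \<in> \<A> \<Longrightarrow> cone_condition (interior P) A"
proof -
  obtain V where V: "finite V" "P = convex hull V" using assms unfolding polytope_def by auto
  have cP: "convex P" and compP: "compact P" using V by (auto simp: finite_imp_compact_convex_hull)
  have "V \<noteq> {}" using int V by auto
  define r where "r = 1 / real (card V)"
  have "card V \<ge> 1" using \<open>V \<noteq> {}\<close> V by (simp add: Suc_leI card_gt_0_iff)
  then have r: "0 < r" "r \<le> 1" by (auto simp: r_def)
  \<comment> \<open>The points that put weight at least \<open>r\<close> on \<open>v\<close>: the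
    polytope shrunk towards \<open>v\<close>.\<close>
  define A where "A = (\<lambda>v. (\<lambda>p. r *\<^sub>R v + (1 - r) *\<^sub>R p) ` P)"
  show thesis
  proof (rule that[of "A ` V"])
    show "finite (A ` V)" using V by auto
    show "P \<subseteq> \<Union> (A ` V)"
    proof
      fix p assume "p \<in> P"
      then obtain u where u: "\<forall>v\<in>V. u v \<ge> 0" "sum u V = 1" "(\<Sum>v\<in>V. u v *\<^sub>R v) = p"
        unfolding V(2) convex_hull_finite[OF V(1)] by auto
      have "\<exists>v\<in>V. u v \<ge> r"
      proof (rule ccontr)
        assume "\<not> (\<exists>v\<in>V. u v \<ge> r)"
        then have "sum u V < (\<Sum>v\<in>V. r)" using V \<open>V \<noteq> {}\<close> by (intro sum_strict_mono) auto
        also have "\<dots> = 1" using \<open>card V \<ge> 1\<close> by (simp add: r_def)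
        finally show False using u by simp
      qed
      then obtain v where v: "v \<in> V" "u v \<ge> r" by auto
      have "\<exists>q\<in>P. p = r *\<^sub>R v + (1 - r) *\<^sub>R q"
      proof (cases "r = 1")
        case True
        have "sum u V = u v + sum u (V - {v})" using V v by (simp add: sum.remove)
        moreover have "sum u (V - {v}) \<ge> 0" using u by (intro sum_nonneg) auto
        ultimately have "sum u (V - {v}) = 0" using u v True by simp
        then have "\<forall>w\<in>V - {v}. u w = 0" using u V by (subst (asm) sum_nonneg_eq_0_iff) auto
        then have "p = u v *\<^sub>R v" unfolding u(3)[symmetric] using V v by (simp add: sum.remove)
        then have "p = v" using \<open>sum u V = u v + sum u (V - {v})\<close> \<open>sum u (V - {v}) = 0\<close> u by simp
        then show ?thesis using True \<open>p \<in> P\<close> by auto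
      next
        case False
        then have r1: "1 - r > 0" using r by simp
        \<comment> \<open>The weights of \<open>p\<close> after removing \<open>r\<close> from the
          vertex \<open>v\<close>, normalized again to sum 1.\<close>
        define w where "w = (\<lambda>z. (u z - (if z = v then r else 0)) / (1 - r))"
        have "(\<Sum>z\<in>V. w z *\<^sub>R z) \<in> P"
          unfolding V(2) convex_hull_finite[OF V(1)]
        proof (intro CollectI exI[of _ w] conjI ballI)
          show "w z \<ge> 0" if "z \<in> V" for z using that u v r1 by (simp add: w_def)
          show "sum w V = 1" unfolding w_def using u v V r1
            by (simp add: sum_divide_distrib[symmetric] sum_subtractf)
        qed simp
        moreover have "(1 - r) *\<^sub>R (\<Sum>z\<in>V. w z *\<^sub>R z) = (\<Sum>z\<in>V. u z *\<^sub>R z - (if z = v then r *\<^sub>R z else 0))"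
          unfolding scaleR_sum_right
        proof (rule sum.cong)
          fix z
          have "(1 - r) * w z = u z - (if z = v then r else 0)" using r1 by (simp add: w_def)
          then have "(1 - r) *\<^sub>R w z *\<^sub>R z = (u z - (if z = v then r else 0)) *\<^sub>R z"
            unfolding scaleR_scaleR by (rule arg_cong)
          then show "(1 - r) *\<^sub>R w z *\<^sub>R z = u z *\<^sub>R z - (if z = v then r *\<^sub>R z else 0)"
            unfolding scaleR_diff_left by (cases "z = v") simp_all
        qed simp
        then have "(1 - r) *\<^sub>R (\<Sum>z\<in>V. w z *\<^sub>R z) = p - r *\<^sub>R v"
          using u v V by (simp add: sum_subtractf)
        ultimately show ?thesis by (intro bexI[of _ "\<Sum>z\<in>V. w z *\<^sub>R z"]) auto
      qed
      then show "p \<in> \<Union> (A ` V)" using v by (auto simp: A_def)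
    qed
    show "closed C" if "C \<in> A ` V" for C
      using that compP by (auto simp: A_def intro!: compact_imp_closed compact_continuous_image continuous_intros)
    fix C assume "C \<in> A ` V"
    then obtain v where v: "v \<in> V" "C = A v" by auto
    \<comment> \<open>All admissible directions for \<open>v\<close>. They form an open set, which
      therefore contains a basis of the whole space.\<close>
    define S where "S = (\<lambda>y. r *\<^sub>R (y - v)) ` interior P"
    have "S = (\<lambda>y. (- r *\<^sub>R v) + r *\<^sub>R y) ` interior P" by (simp add: S_def algebra_simps)
    then have "open S" using open_affinity[of "interior P" r "- r *\<^sub>R v"] r by simp
    moreover have "S \<noteq> {}" using int by (simp add: S_def)
    ultimately have "span S = UNIV" by (rule span_open_UNIV)
    obtain B where "B \<subseteq> S" "independent B" "S \<subseteq> span B" by (rule basis_exists[of S]) blast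
    with \<open>span S = UNIV\<close> have B: "B \<subseteq> S" "independent B" "span B = UNIV"
      using span_minimal[of S "span B"] by auto
    have "x + s *\<^sub>R b \<in> interior P" if x: "x \<in> C" and b: "b \<in> B" and s: "0 < s" "s \<le> 1" for x b s
    proof -
      obtain p where p: "p \<in> P" "x = r *\<^sub>R v + (1 - r) *\<^sub>R p" using x v by (auto simp: A_def)
      obtain y where y: "y \<in> interior P" "b = r *\<^sub>R (y - v)" using b B by (auto simp: S_def)
      define t where "t = s * r"
      have t: "0 < t" "t \<le> r" using s r by (auto simp: t_def mult_left_le_one_le)
      have vP: "v \<in> P" using v V by (simp add: hull_inc)
      \<comment> \<open>The move takes the weight \<open>t\<close> from \<open>v\<close> and gives
        it to the interior point \<open>y\<close>. The remaining weight \<open>1 - t\<close> sits on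
        a point \<open>q\<close> of \<open>P\<close>, and a convex combination with positive weight
        on an interior point is interior.\<close>
      have e: "x + s *\<^sub>R b = ((r - t) *\<^sub>R v + (1 - r) *\<^sub>R p) + t *\<^sub>R y"
        by (simp add: p y t_def algebra_simps)
      show ?thesis
      proof (cases "t = 1")
        case True
        then show ?thesis using t r y e by simp
      next
        case False
        then have t1: "1 - t > 0" using t r by simp
        define q where "q = ((r - t) / (1 - t)) *\<^sub>R v + ((1 - r) / (1 - t)) *\<^sub>R p"
        have "q \<in> P" unfolding q_def
          by (rule convexD[OF cP vP p(1)]) (use t r t1 in \<open>auto simp: add_divide_distrib[symmetric]\<close>)
        have "q - t *\<^sub>R (q - y) \<in> interior P"
          by (rule mem_interior_convex_shrink[OF cP y(1) \<open>q \<in> P\<close>]) (use t r in auto)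
        also have "q - t *\<^sub>R (q - y) = (1 - t) *\<^sub>R q + t *\<^sub>R y" by (simp add: algebra_simps)
        also have "(1 - t) *\<^sub>R q = (r - t) *\<^sub>R v + (1 - r) *\<^sub>R p"
          using t1 by (simp add: q_def scaleR_add_right)
        finally show ?thesis unfolding e .
      qed
    qed
    with B show "cone_condition (interior P) C"
      unfolding cone_condition_def by (intro exI[of _ B]) simp
  qed
qed

text \<open>Polytopes with empty interior equal their frontier and are null, so they may be
  discarded at the price of covering \<open>\<Omega>\<close> only up to a null set. The interiors of
  the others lie in \<open>interior (closure \<Omega>) = \<Omega>\<close>.\<close>

lemma polyhedral_domain_cone_cover:
  fixes \<Omega> :: "(real^'n) set"
  assumes "polyhedral_domain \<Omega>"
  obtains \<A> where "finite \<A>" "negligible (\<Omega> - \<Union>\<A>)" "\<And>A. A \<in> \<A> \<Longrightarrow> closed A"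
    "\<And>A. A \<in> \<A> \<Longrightarrow> cone_condition \<Omega> A"
proof -
  have ic: "interior (closure \<Omega>) = \<Omega>"
    using assms unfolding polyhedral_domain_def by (elim conjE)
  have "\<exists>\<P>. finite \<P> \<and> (\<forall>P\<in>\<P>. polytope P) \<and> closure \<Omega> = \<Union>\<P>"
    using assms unfolding polyhedral_domain_def by (elim conjE)
  then obtain \<P> where P: "finite \<P>" "\<forall>P\<in>\<P>. polytope P" "closure \<Omega> = \<Union>\<P>" by (elim exE conjE)
  define \<P>' where "\<P>' = {P\<in>\<P>. interior P \<noteq> {}}"
  have sub: "interior P \<subseteq> \<Omega>" if "P \<in> \<P>" for P
  proof -
    have "interior P \<subseteq> interior (closure \<Omega>)" using that P(3) by (intro interior_mono) auto
    then show ?thesis by (simp add: ic)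
  qed
  have "\<exists>\<A>. finite \<A> \<and> P \<subseteq> \<Union>\<A> \<and> (\<forall>A\<in>\<A>. closed A \<and> cone_condition \<Omega> A)" if P: "P \<in> \<P>'" for P
  proof -
    have *: "polytope P" "interior P \<noteq> {}" "interior P \<subseteq> \<Omega>" using P sub \<open>\<forall>P\<in>\<P>. polytope P\<close> by (auto simp: \<P>'_def)
    obtain \<A> where "finite \<A>" "P \<subseteq> \<Union>\<A>" "\<And>A. A \<in> \<A> \<Longrightarrow> closed A"
      "\<And>A. A \<in> \<A> \<Longrightarrow> cone_condition (interior P) A"
      by (rule polytope_cone_cover[OF *(1,2)], rule that)
    then show ?thesis by (intro exI[of _ \<A>]) (simp add: cone_condition_mono[OF _ *(3)])
  qed
  then have "\<forall>P\<in>\<P>'. \<exists>\<A>. finite \<A> \<and> P \<subseteq> \<Union>\<A> \<and> (\<forall>A\<in>\<A>. closed A \<and> cone_condition \<Omega> A)" by blast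
  from bchoice[OF this] obtain \<A> where A: "\<And>P. P \<in> \<P>' \<Longrightarrow> finite (\<A> P) \<and> P \<subseteq> \<Union>(\<A> P) \<and>
      (\<forall>A\<in>\<A> P. closed A \<and> cone_condition \<Omega> A)" by auto
  show thesis
  proof (rule that[of "\<Union>(\<A> ` \<P>')"])
    show "finite (\<Union>(\<A> ` \<P>'))" using P A by (auto simp: \<P>'_def)
    show "closed A" if "A \<in> \<Union>(\<A> ` \<P>')" for A using that A by auto
    show "cone_condition \<Omega> A" if "A \<in> \<Union>(\<A> ` \<P>')" for A using that A by auto
    have "negligible (\<Union>(\<P> - \<P>'))"
    proof (rule negligible_Union)
      fix P assume "P \<in> \<P> - \<P>'"
      then have "polytope P" "interior P = {}" using P by (auto simp: \<P>'_def)
      then have "frontier P = P" "convex P"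
        by (simp_all add: frontier_def closure_closed polytope_imp_closed polytope_imp_convex)
      then show "negligible P" using negligible_convex_frontier[of P] by simp
    qed (use P in auto)
    moreover have "\<Omega> - \<Union>(\<Union>(\<A> ` \<P>')) \<subseteq> \<Union>(\<P> - \<P>')"
    proof
      fix x assume x: "x \<in> \<Omega> - \<Union>(\<Union>(\<A> ` \<P>'))"
      then have "x \<in> \<Union>\<P>" using closure_subset[of \<Omega>] unfolding P(3)[symmetric] by auto
      then obtain P where "P \<in> \<P>" "x \<in> P" by auto
      moreover have "P \<notin> \<P>'" using A[of P] x \<open>x \<in> P\<close> by auto
      ultimately show "x \<in> \<Union>(\<P> - \<P>')" by auto
    qed
    ultimately show "negligible (\<Omega> - \<Union>(\<Union>(\<A> ` \<P>')))" by (rule negligible_subset)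
  qed
qed

section \<open>Finite element functions\<close>

text \<open>Of three distinct frontier points the middle one would lie in an open interval inside
  the closure, hence in the interior.\<close>

lemma finite_frontier_convex_real:
  fixes S :: "real set"
  assumes "convex S"
  shows "finite (frontier S)"
proof (rule ccontr)
  assume "infinite (frontier S)"
  then obtain T where T: "finite T" "card T = 3" "T \<subseteq> frontier S"
    using infinite_arbitrarily_large by blast
  then obtain x y z where xyz: "T = {x, y, z}" "x \<noteq> y" "x \<noteq> z" "y \<noteq> z" by (auto simp: card_3_iff)
  have mid: "b \<in> interior S" if "a \<in> frontier S" "c \<in> frontier S" "a < b" "b < c" for a b c
  proof -
    have "is_interval (closure S)" using assms by (simp add: is_interval_convex_1)
    moreover have "a \<in> closure S" "c \<in> closure S" using that by (auto simp: frontier_def)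
    ultimately have "{a<..<c} \<subseteq> closure S"
      unfolding is_interval_1 by (meson greaterThanLessThan_iff less_imp_le subsetI)
    then have "{a<..<c} \<subseteq> interior (closure S)" by (intro interior_maximal) auto
    then show ?thesis using that assms by (auto simp: convex_interior_closure)
  qed
  have no: "b \<le> a \<or> c \<le> b" if "a \<in> frontier S" "b \<in> frontier S" "c \<in> frontier S" for a b c
    using mid[OF that(1,3), of b] that(2)
    by (cases "a < b"; cases "b < c") (auto simp: frontier_def)
  have "x \<in> frontier S" "y \<in> frontier S" "z \<in> frontier S" using T xyz by auto
  then show False
    using xyz no[of x y z] no[of x z y] no[of y x z] no[of y z x] no[of z x y] no[of z y x]
    by linarith
qed

lemma polynomial_has_continuous_gradient:
  fixes p :: "real^'n \<Rightarrow> real"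
  assumes "polynomial_of_degree_le q p"
  obtains p' where "continuous_on UNIV p'" "\<And>x. (p has_derivative (\<lambda>h. p' x \<bullet> h)) (at x)"
proof -
  obtain c where c: "\<And>x. p x = (\<Sum>\<alpha> | (\<Sum>i\<in>UNIV. \<alpha> i) \<le> q. c \<alpha> * (\<Prod>i\<in>UNIV. (x $ i) ^ \<alpha> i))"
    using assms unfolding polynomial_of_degree_le_def by blast
  define D where "D = (\<lambda>\<alpha> (i::'n) (x::real^'n). (real (\<alpha> i) * (x $ i) ^ (\<alpha> i - 1)) * (\<Prod>j\<in>UNIV - {i}. (x $ j) ^ \<alpha> j))"
  define p' where "p' = (\<lambda>x. \<chi> i. \<Sum>\<alpha> | (\<Sum>i\<in>UNIV. \<alpha> i) \<le> q. c \<alpha> * D \<alpha> i x)"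
  show thesis
  proof (rule that[of p'])
    show "continuous_on UNIV p'"
      unfolding p'_def D_def by (intro continuous_intros)
    fix x
    have m: "((\<lambda>x. \<Prod>i\<in>UNIV. (x $ i) ^ \<alpha> i) has_derivative (\<lambda>h. \<Sum>i\<in>UNIV. D \<alpha> i x * h $ i)) (at x)" for \<alpha> :: "'n \<Rightarrow> nat"
    proof -
      have "((\<lambda>x. \<Prod>i\<in>UNIV. (x $ i) ^ \<alpha> i) has_derivative
        (\<lambda>h. \<Sum>i\<in>UNIV. (real (\<alpha> i) * h $ i * (x $ i) ^ (\<alpha> i - 1)) * (\<Prod>j\<in>UNIV - {i}. (x $ j) ^ \<alpha> j))) (at x)"
        by (rule has_derivative_prod) (intro has_derivative_power bounded_linear_imp_has_derivative bounded_linear_vec_nth)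
      then show ?thesis by (simp add: D_def mult_ac)
    qed
    have "(p has_derivative (\<lambda>h. \<Sum>\<alpha> | (\<Sum>i\<in>UNIV. \<alpha> i) \<le> q. c \<alpha> * (\<Sum>i\<in>UNIV. D \<alpha> i x * h $ i))) (at x)"
      unfolding c[abs_def] by (intro has_derivative_sum has_derivative_mult_right m)
    also have "(\<lambda>h. \<Sum>\<alpha> | (\<Sum>i\<in>UNIV. \<alpha> i) \<le> q. c \<alpha> * (\<Sum>i\<in>UNIV. D \<alpha> i x * h $ i)) = (\<lambda>h. p' x \<bullet> h)"
    proof
      fix h
      have "p' x \<bullet> h = (\<Sum>i\<in>UNIV. (\<Sum>\<alpha> | (\<Sum>i\<in>UNIV. \<alpha> i) \<le> q. c \<alpha> * D \<alpha> i x) * h $ i)"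
        by (simp add: p'_def inner_vec_def)
      also have "\<dots> = (\<Sum>\<alpha> | (\<Sum>i\<in>UNIV. \<alpha> i) \<le> q. c \<alpha> * (\<Sum>i\<in>UNIV. D \<alpha> i x * h $ i))"
        unfolding sum_distrib_left sum_distrib_right by (subst sum.swap) (simp add: mult.assoc)
      finally show "(\<Sum>\<alpha> | (\<Sum>i\<in>UNIV. \<alpha> i) \<le> q. c \<alpha> * (\<Sum>i\<in>UNIV. D \<alpha> i x * h $ i)) = p' x \<bullet> h" ..
    qed
    finally show "(p has_derivative (\<lambda>h. p' x \<bullet> h)) (at x)" .
  qed
qed

text \<open>Fubini's theorem and translation invariance: every translate of \<open>N\<close> in
  direction \<open>v\<close> is null, so the time that a line spends in \<open>N\<close> integrates
  to 0 over all starting points.\<close>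

lemma AE_line_notin_null_set:
  fixes N :: "'a::euclidean_space set"
  assumes N: "N \<in> null_sets lborel"
  shows "AE x in lborel. AE t in lborel. x + t *\<^sub>R v \<notin> N"
proof -
  have [measurable]: "N \<in> sets borel" using N by auto
  have "(\<integral>\<^sup>+x. \<integral>\<^sup>+t. indicator N (x + t *\<^sub>R v) \<partial>lborel \<partial>lborel)
      = (\<integral>\<^sup>+t. \<integral>\<^sup>+x. indicator N (t *\<^sub>R v + x) \<partial>lborel \<partial>lborel)"
    unfolding add.commute[of _ "_ *\<^sub>R v"] by (rule lborel_pair.Fubini') measurable
  also have "\<dots> = (\<integral>\<^sup>+t. emeasure lborel N \<partial>(lborel :: real measure))"
    by (intro nn_integral_cong) (subst nn_integral_lborel_plus, auto)
  also have "\<dots> = 0" using N by auto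
  finally have "AE x in lborel. (\<integral>\<^sup>+t. indicator N (x + t *\<^sub>R v) \<partial>lborel) = 0"
    by (subst (asm) nn_integral_0_iff_AE) auto
  then show ?thesis
  proof eventually_elim
    case (elim x)
    then have "AE t in lborel. (indicator N (x + t *\<^sub>R v) :: ennreal) = 0"
      by (subst (asm) nn_integral_0_iff_AE) auto
    then show ?case by eventually_elim (auto simp: indicator_def split: if_splits)
  qed
qed

text \<open>A derivative almost everywhere would not suffice for the conclusion, as the Cantor
  function shows; hence the additional differentiability off a finite set. The fundamental theorem
  is applied to \<open>deriv f\<close>, which agrees with \<open>k\<close> almost
  everywhere.\<close>

lemma fundamental_theorem_of_calculus_AE:
  fixes f k :: "real \<Rightarrow> real"
  assumes "finite F" and cont: "continuous_on {0..1} f"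
    and diff: "\<And>t. 0 < t \<Longrightarrow> t < 1 \<Longrightarrow> t \<notin> F \<Longrightarrow> f differentiable (at t)"
    and ae: "AE t in lborel. 0 < t \<and> t < 1 \<longrightarrow> (f has_real_derivative k t) (at t)"
    and int: "set_integrable lborel {0..1} k"
  shows "(LINT t:{0..1}|lborel. k t) = f 1 - f 0"
proof -
  have "(deriv f has_integral (f 1 - f 0)) {0..1}"
  proof (rule fundamental_theorem_of_calculus_interior_strong[OF \<open>finite F\<close> _ _ cont])
    fix t :: real assume t: "t \<in> {0<..<1} - F"
    then have "(f has_real_derivative deriv f t) (at t)"
      using diff[of t] DERIV_deriv_iff_real_differentiable by auto
    then show "(f has_vector_derivative deriv f t) (at t)"
      by (simp add: has_real_derivative_iff_has_vector_derivative)
  qed simp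
  moreover have "AE t in lborel. t \<in> {0..1} \<longrightarrow> deriv f t = k t"
    using ae AE_lborel_singleton[of 0] AE_lborel_singleton[of 1]
    by eventually_elim (auto intro: DERIV_imp_deriv)
  then obtain N where N: "N \<in> null_sets lborel" "{t. \<not> (t \<in> {0..1} \<longrightarrow> deriv f t = k t)} \<subseteq> N"
    unfolding eventually_ae_filter by auto
  then have "negligible N" by (auto simp: negligible_iff_null_sets intro: null_sets_completionI)
  ultimately have "(k has_integral (f 1 - f 0)) {0..1}"
    using N(2) by (elim has_integral_spike[rotated 2]) auto
  moreover have "(k has_integral (LINT t:{0..1}|lborel. k t)) {0..1}"
    using set_borel_integral_eq_integral[OF int] by (simp add: has_integral_integral)
  ultimately show ?thesis by (metis has_integral_unique)
qed

definition gradient :: "(real^'n \<Rightarrow> real) \<Rightarrow> real^'n \<Rightarrow> real^'n" where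
  "gradient u x = (\<chi> i. partial_deriv i u x)"

lemma gradient_eqI:
  assumes "(u has_derivative (\<lambda>h. d \<bullet> h)) (at x)"
  shows "gradient u x = d"
proof -
  have "frechet_derivative u (at x) = (\<lambda>h. d \<bullet> h)" using assms by (rule frechet_derivative_at[symmetric])
  then show ?thesis by (simp add: gradient_def partial_deriv_def vec_eq_iff inner_axis)
qed

text \<open>The geometric facts behind the calculus of finite element functions. The Sobolev
  constant is obtained before quantifying over all \<open>\<K>\<close> with this property, which is
  how it becomes independent of the mesh.\<close>

locale mesh =
  fixes \<Omega> :: "(real^'n) set" and \<K> :: "(real^'n) set set" and q :: nat
  assumes open_domain: "open \<Omega>" and bounded_domain: "bounded \<Omega>"
    and finite_cells: "finite \<K>"
    and compact_cell: "K \<in> \<K> \<Longrightarrow> compact K" and convex_cell: "K \<in> \<K> \<Longrightarrow> convex K"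
    and interior_cell: "K \<in> \<K> \<Longrightarrow> interior K \<subseteq> \<Omega>" and cells_cover: "\<Omega> \<subseteq> \<Union>\<K>"
begin

definition S :: "(real^'n \<Rightarrow> real) set" where "S = fe_space \<Omega> \<K> q"

definition W :: "(real^'n) set" where "W = (\<Union>K\<in>\<K>. interior K)"

lemma open_W: "open W" unfolding W_def by auto

lemma W_subset: "W \<subseteq> \<Omega>" unfolding W_def using interior_cell by auto

lemma sets_borel [measurable]: "\<Omega> \<in> sets borel" "W \<in> sets borel"
  using open_domain open_W by auto

text \<open>A point of \<open>\<Omega>\<close> outside all cell interiors lies on the frontier of a
  cell, and frontiers of convex sets are null.\<close>

lemma null_skeleton: "\<Omega> - W \<in> null_sets lborel"
proof -
  have "negligible (\<Union>K\<in>\<K>. frontier K)"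
    by (rule negligible_Union) (use finite_cells convex_cell negligible_convex_frontier in auto)
  moreover have "\<Omega> - W \<subseteq> (\<Union>K\<in>\<K>. frontier K)"
  proof
    fix x assume x: "x \<in> \<Omega> - W"
    then obtain K where K: "K \<in> \<K>" "x \<in> K" using cells_cover by auto
    then have "x \<in> closure K" using closure_subset[of K] by auto
    then show "x \<in> (\<Union>K\<in>\<K>. frontier K)" using K x by (auto simp: frontier_def W_def)
  qed
  ultimately have "negligible (\<Omega> - W)" by (rule negligible_subset)
  then show ?thesis by (simp add: negligible_iff_null_sets null_sets_completion_iff)
qed

lemma continuous_on_fe: "u \<in> S \<Longrightarrow> continuous_on \<Omega> u"
  by (simp add: S_def fe_space_def)

lemma fe_cell:
  assumes "u \<in> S" "K \<in> \<K>"
  obtains p p' where "continuous_on UNIV p'" "\<And>x. (p has_derivative (\<lambda>h. p' x \<bullet> h)) (at x)"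
    "\<And>x. x \<in> K \<Longrightarrow> x \<in> \<Omega> \<Longrightarrow> u x = p x"
    "\<And>x. x \<in> interior K \<Longrightarrow> (u has_derivative (\<lambda>h. p' x \<bullet> h)) (at x)"
proof -
  obtain p where p: "polynomial_of_degree_le q p" "\<And>x. x \<in> K \<Longrightarrow> x \<in> \<Omega> \<Longrightarrow> u x = p x"
    using assms by (auto simp: S_def fe_space_def)
  obtain p' where p': "continuous_on UNIV p'" "\<And>x. (p has_derivative (\<lambda>h. p' x \<bullet> h)) (at x)"
    by (rule polynomial_has_continuous_gradient[OF p(1)], rule that)
  have "(u has_derivative (\<lambda>h. p' x \<bullet> h)) (at x)" if x: "x \<in> interior K" for x
    by (rule has_derivative_transform_within_open[OF p'(2) open_interior x])
      (use p(2) interior_cell[OF assms(2)] interior_subset[of K] in \<open>metis subsetD\<close>)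
  then show thesis using that[OF p' p(2)] by simp
qed

lemma fe_has_derivative:
  assumes "u \<in> S" "x \<in> W"
  shows "(u has_derivative (\<lambda>h. gradient u x \<bullet> h)) (at x)"
proof -
  obtain K where K: "K \<in> \<K>" "x \<in> interior K" using assms by (auto simp: W_def)
  obtain p p' where "\<And>x. x \<in> interior K \<Longrightarrow> (u has_derivative (\<lambda>h. p' x \<bullet> h)) (at x)"
    by (rule fe_cell[OF assms(1) K(1)], rule that)
  from this[OF K(2)] show ?thesis using gradient_eqI by metis
qed

lemma continuous_on_gradient:
  assumes "u \<in> S"
  shows "continuous_on W (gradient u)"
  unfolding W_def
proof (rule continuous_on_open_UN)
  fix K assume K: "K \<in> \<K>"
  obtain p p' where p: "continuous_on UNIV p'" "\<And>x. x \<in> interior K \<Longrightarrow> (u has_derivative (\<lambda>h. p' x \<bullet> h)) (at x)"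
    by (rule fe_cell[OF assms K], rule that)
  have "continuous_on (interior K) p'" using p(1) by (rule continuous_on_subset) simp
  then show "continuous_on (interior K) (gradient u)"
    by (rule continuous_on_eq) (use gradient_eqI[OF p(2)] in auto)
qed auto

text \<open>Polynomials and their gradients are bounded on each of finitely many compact cells. The
  bound depends on the mesh and serves integrability only; no estimate uses its size.\<close>

lemma fe_bounded:
  assumes "u \<in> S"
  obtains L where "L \<ge> 0" "\<And>x. x \<in> \<Omega> \<Longrightarrow> \<bar>u x\<bar> \<le> L" "\<And>x. x \<in> W \<Longrightarrow> norm (gradient u x) \<le> L"
proof -
  have "\<exists>l\<ge>0. (\<forall>x\<in>K \<inter> \<Omega>. \<bar>u x\<bar> \<le> l) \<and> (\<forall>x\<in>interior K. norm (gradient u x) \<le> l)" if K: "K \<in> \<K>" for K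
  proof -
    obtain p p' where p: "continuous_on UNIV p'" "\<And>x. (p has_derivative (\<lambda>h. p' x \<bullet> h)) (at x)"
      "\<And>x. x \<in> K \<Longrightarrow> x \<in> \<Omega> \<Longrightarrow> u x = p x"
      "\<And>x. x \<in> interior K \<Longrightarrow> (u has_derivative (\<lambda>h. p' x \<bullet> h)) (at x)"
      by (rule fe_cell[OF assms K], rule that)
    have "continuous_on K p'" using p(1) by (rule continuous_on_subset) simp
    then have "bounded (p' ` K)" using compact_cell[OF K] compact_continuous_image compact_imp_bounded by blast
    then obtain l1 where l1: "\<And>x. x \<in> K \<Longrightarrow> norm (p' x) \<le> l1" by (auto simp: bounded_iff)
    have "continuous_on K p" using p(2) by (intro continuous_at_imp_continuous_on ballI has_derivative_continuous)
    then have "bounded (p ` K)" using compact_cell[OF K] compact_continuous_image compact_imp_bounded by blast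
    then obtain l2 where l2: "\<And>x. x \<in> K \<Longrightarrow> \<bar>p x\<bar> \<le> l2" by (auto simp: bounded_iff)
    have "\<bar>u x\<bar> \<le> \<bar>l1\<bar> + \<bar>l2\<bar>" if "x \<in> K \<inter> \<Omega>" for x using l2[of x] p(3)[of x] that by auto
    moreover have "norm (gradient u x) \<le> \<bar>l1\<bar> + \<bar>l2\<bar>" if "x \<in> interior K" for x
      using l1[of x] gradient_eqI[OF p(4)[OF that]] that interior_subset[of K] by auto
    ultimately show ?thesis by (intro exI[of _ "\<bar>l1\<bar> + \<bar>l2\<bar>"]) auto
  qed
  then have "\<forall>K\<in>\<K>. \<exists>l. l \<ge> 0 \<and> (\<forall>x\<in>K \<inter> \<Omega>. \<bar>u x\<bar> \<le> l) \<and> (\<forall>x\<in>interior K. norm (gradient u x) \<le> l)" by blast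
  from bchoice[OF this] obtain l where l: "\<And>K. K \<in> \<K> \<Longrightarrow> l K \<ge> 0 \<and> (\<forall>x\<in>K \<inter> \<Omega>. \<bar>u x\<bar> \<le> l K) \<and>
      (\<forall>x\<in>interior K. norm (gradient u x) \<le> l K)" by auto
  have le: "l K \<le> sum l \<K>" if "K \<in> \<K>" for K
    using that finite_cells l by (intro member_le_sum) auto
  show thesis
  proof (rule that[of "sum l \<K>"])
    show "sum l \<K> \<ge> 0" using l by (intro sum_nonneg) auto
    show "\<bar>u x\<bar> \<le> sum l \<K>" if x: "x \<in> \<Omega>" for x
    proof -
      obtain K where K: "K \<in> \<K>" "x \<in> K" using x cells_cover by auto
      then have "\<bar>u x\<bar> \<le> l K" using l[OF K(1)] x by auto
      then show ?thesis using le[OF K(1)] by linarith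
    qed
    show "norm (gradient u x) \<le> sum l \<K>" if x: "x \<in> W" for x
    proof -
      obtain K where K: "K \<in> \<K>" "x \<in> interior K" using x by (auto simp: W_def)
      then have "norm (gradient u x) \<le> l K" using l[OF K(1)] by auto
      then show ?thesis using le[OF K(1)] by linarith
    qed
  qed
qed

text \<open>Along a line every cell is an interval, so only finitely many parameters are exceptional.\<close>

lemma fe_differentiable_on_line:
  assumes "u \<in> S"
  obtains F where "finite F" "\<And>t. t \<notin> F \<Longrightarrow> x + t *\<^sub>R v \<in> \<Omega> \<Longrightarrow> (\<lambda>t. u (x + t *\<^sub>R v)) differentiable (at t)"
proof (rule that[of "\<Union>K\<in>\<K>. frontier {t. x + t *\<^sub>R v \<in> K}"])
  have "convex {t. x + t *\<^sub>R v \<in> K}" if "K \<in> \<K>" for K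
  proof (rule convexI)
    fix s t a b :: real
    assume *: "s \<in> {t. x + t *\<^sub>R v \<in> K}" "t \<in> {t. x + t *\<^sub>R v \<in> K}" "0 \<le> a" "0 \<le> b" "a + b = 1"
    then have "a *\<^sub>R (x + s *\<^sub>R v) + b *\<^sub>R (x + t *\<^sub>R v) \<in> K"
      using convexD[OF convex_cell[OF that]] by auto
    also have "a *\<^sub>R (x + s *\<^sub>R v) + b *\<^sub>R (x + t *\<^sub>R v) = (a + b) *\<^sub>R x + (a * s + b * t) *\<^sub>R v"
      by (simp add: algebra_simps)
    finally show "a *\<^sub>R s + b *\<^sub>R t \<in> {t. x + t *\<^sub>R v \<in> K}" using * by simp
  qed
  then show "finite (\<Union>K\<in>\<K>. frontier {t. x + t *\<^sub>R v \<in> K})"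
    using finite_cells finite_frontier_convex_real by auto
next
  fix t assume t: "t \<notin> (\<Union>K\<in>\<K>. frontier {t. x + t *\<^sub>R v \<in> K})" "x + t *\<^sub>R v \<in> \<Omega>"
  then obtain K where K: "K \<in> \<K>" "x + t *\<^sub>R v \<in> K" using cells_cover by auto
  obtain p p' where p: "\<And>x. (p has_derivative (\<lambda>h. p' x \<bullet> h)) (at x)" "\<And>x. x \<in> K \<Longrightarrow> x \<in> \<Omega> \<Longrightarrow> u x = p x"
    by (rule fe_cell[OF assms K(1)], rule that)
  \<comment> \<open>A neighbourhood of \<open>t\<close> on which the line stays in one cell and in
    \<open>\<Omega>\<close>, so that \<open>u\<close> coincides there with a single
    polynomial.\<close>
  define I where "I = interior {t. x + t *\<^sub>R v \<in> K} \<inter> {t. x + t *\<^sub>R v \<in> \<Omega>}"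
  have "{t. x + t *\<^sub>R v \<in> \<Omega>} = (\<lambda>t. x + t *\<^sub>R v) -` \<Omega>" by auto
  then have "open I" unfolding I_def
    by (auto intro!: open_Int open_vimage open_domain continuous_intros)
  have "t \<in> closure {t. x + t *\<^sub>R v \<in> K}" using K closure_subset[of "{t. x + t *\<^sub>R v \<in> K}"] by auto
  then have "t \<in> I" using t K by (auto simp: I_def frontier_def)
  have "((\<lambda>t. p (x + t *\<^sub>R v)) has_derivative (\<lambda>h. p' (x + t *\<^sub>R v) \<bullet> (h *\<^sub>R v))) (at t)"
    by (rule has_derivative_compose[OF _ p(1)]) (auto intro!: derivative_eq_intros)
  then have "((\<lambda>t. u (x + t *\<^sub>R v)) has_derivative (\<lambda>h. p' (x + t *\<^sub>R v) \<bullet> (h *\<^sub>R v))) (at t)"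
    by (rule has_derivative_transform_within_open[OF _ \<open>open I\<close> \<open>t \<in> I\<close>])
      (use p(2) interior_subset[of "{t. x + t *\<^sub>R v \<in> K}"] in \<open>auto simp: I_def\<close>)
  then show "(\<lambda>t. u (x + t *\<^sub>R v)) differentiable (at t)" by (rule differentiableI)
qed

lemma fe_DERIV_line:
  assumes "u \<in> S" "x + t *\<^sub>R v \<in> W"
  shows "((\<lambda>t. u (x + t *\<^sub>R v)) has_real_derivative (gradient u (x + t *\<^sub>R v) \<bullet> v)) (at t)"
proof -
  have "((\<lambda>t. u (x + t *\<^sub>R v)) has_derivative (\<lambda>h. gradient u (x + t *\<^sub>R v) \<bullet> (h *\<^sub>R v))) (at t)"
    by (rule has_derivative_compose[where f="\<lambda>t. x + t *\<^sub>R v", OF _ fe_has_derivative[OF assms]])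
      (auto intro!: derivative_eq_intros)
  then show ?thesis by (simp add: has_field_derivative_def mult.commute[of _ "gradient u (x + t *\<^sub>R v) \<bullet> v"] mult_commute_abs)
qed

text \<open>Extension by zero gives Borel functions on the whole space, so that translations and
  Fubini's theorem for Lebesgue measure apply. \<open>grad\<close> is likewise set to 0 on the
  skeleton.\<close>

definition ext :: "(real^'n \<Rightarrow> real) \<Rightarrow> real^'n \<Rightarrow> real" where
  "ext u x = indicator \<Omega> x *\<^sub>R u x"

definition grad :: "(real^'n \<Rightarrow> real) \<Rightarrow> real^'n \<Rightarrow> real^'n" where
  "grad u x = indicator W x *\<^sub>R gradient u x"

lemma measurable_ext [measurable]: "u \<in> S \<Longrightarrow> ext u \<in> borel_measurable borel"
  unfolding ext_def by (intro borel_measurable_continuous_on_indicator continuous_on_fe sets_borel)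

lemma measurable_grad [measurable]: "u \<in> S \<Longrightarrow> grad u \<in> borel_measurable borel"
  unfolding grad_def by (intro borel_measurable_continuous_on_indicator continuous_on_gradient sets_borel)

end

section \<open>Integration by parts\<close>

lemma integral_lborel_plus:
  fixes f :: "'a::euclidean_space \<Rightarrow> real"
  assumes [measurable]: "f \<in> borel_measurable borel"
  shows "(LINT x|lborel. f (a + x)) = (LINT x|lborel. f x)"
proof -
  have "(LINT x|lborel. f x) = (LINT x|distr lborel borel ((+) a). f x)"
    by (simp add: lborel_distr_plus)
  also have "\<dots> = (LINT x|lborel. f (a + x))"
    by (rule integral_distr) auto
  finally show ?thesis ..
qed

lemma integrable_lborel_bounded_support:
  fixes f :: "'a::euclidean_space \<Rightarrow> real"
  assumes "f \<in> borel_measurable borel" "\<And>x. \<bar>f x\<bar> \<le> B" "bounded A" "\<And>x. x \<notin> A \<Longrightarrow> f x = 0"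
  shows "integrable lborel f"
proof -
  obtain a where "A \<subseteq> cbox (-a) a" using bounded_subset_cbox_symmetric[OF assms(3)] by blast
  then show ?thesis
    using assms
    by (intro integrableI_bounded_set[where A="cbox (-a) a" and B=B]) (auto intro!: emeasure_bounded_finite[unfolded infinity_ennreal_def])
qed

lemma test_functionD:
  assumes "test_function \<Omega> \<psi>"
  obtains K where "compact K" "K \<subseteq> \<Omega>" "\<And>x. x \<notin> K \<Longrightarrow> \<psi> x = 0" "\<And>x i. x \<notin> K \<Longrightarrow> partial_deriv i \<psi> x = 0"
    "\<And>x. \<psi> differentiable (at x)" "continuous_on UNIV \<psi>" "\<And>i. continuous_on UNIV (partial_deriv i \<psi>)"
proof -
  have sm: "foldr partial_deriv js \<psi> differentiable_on UNIV" for js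
    using assms unfolding test_function_def smooth_def by blast
  obtain K where K: "compact K" "K \<subseteq> \<Omega>" "\<And>x. x \<notin> K \<Longrightarrow> \<psi> x = 0"
    using assms unfolding test_function_def by blast
  have "partial_deriv i \<psi> x = 0" if "x \<notin> K" for x i
  proof -
    have "((\<lambda>_. 0) has_derivative (\<lambda>_. 0)) (at x)" by simp
    then have "(\<psi> has_derivative (\<lambda>_. 0)) (at x)"
      by (rule has_derivative_transform_within_open[of _ _ _ _ "- K"])
        (use K that compact_imp_closed in \<open>auto simp: open_Compl\<close>)
    then have "frechet_derivative \<psi> (at x) = (\<lambda>_. 0)" by (rule frechet_derivative_at[symmetric])
    then show ?thesis by (simp add: partial_deriv_def)
  qed
  moreover have "\<psi> differentiable (at x)" for x
    using sm[of "[]"] by (simp add: differentiable_on_def)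
  moreover have "continuous_on UNIV \<psi>" using sm[of "[]"] by (simp add: differentiable_imp_continuous_on)
  moreover have "continuous_on UNIV (partial_deriv i \<psi>)" for i
    using sm[of "[i]"] by (simp add: differentiable_imp_continuous_on)
  ultimately show thesis using that K by blast
qed

lemma bounded_if_compact_support:
  fixes f :: "'a::euclidean_space \<Rightarrow> real"
  assumes "continuous_on UNIV f" "compact K" "\<And>x. x \<notin> K \<Longrightarrow> f x = 0"
  obtains B where "\<And>x. \<bar>f x\<bar> \<le> B"
proof -
  have "bounded (f ` K)"
    using assms by (intro compact_imp_bounded compact_continuous_image) (auto intro: continuous_on_subset)
  then obtain B where "\<And>x. x \<in> K \<Longrightarrow> \<bar>f x\<bar> \<le> B" by (auto simp: bounded_iff)
  then have "\<bar>f x\<bar> \<le> \<bar>B\<bar>" for x using assms(3)[of x] by (cases "x \<in> K") force+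
  then show thesis by (rule that)
qed

context mesh
begin

lemma measurable_grad_nth [measurable]:
  assumes "u \<in> S"
  shows "(\<lambda>x. grad u x $ i) \<in> borel_measurable borel"
  by (rule measurable_compose[OF measurable_grad[OF assms]])
    (auto intro!: borel_measurable_continuous_onI continuous_intros)

lemma open_line: "open {t. x + t *\<^sub>R v \<in> \<Omega>}"
proof -
  have "{t. x + t *\<^sub>R v \<in> \<Omega>} = (\<lambda>t. x + t *\<^sub>R v) -` \<Omega>" by auto
  then show ?thesis by (auto intro!: open_vimage open_domain continuous_intros)
qed

lemma ext_line_differentiable:
  assumes "u \<in> S"
  obtains F where "finite F"
    "\<And>t. t \<notin> F \<Longrightarrow> x + t *\<^sub>R v \<in> \<Omega> \<Longrightarrow> (\<lambda>t. ext u (x + t *\<^sub>R v)) differentiable (at t)"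
proof -
  obtain F where F: "finite F"
    "\<And>t. t \<notin> F \<Longrightarrow> x + t *\<^sub>R v \<in> \<Omega> \<Longrightarrow> (\<lambda>t. u (x + t *\<^sub>R v)) differentiable (at t)"
    by (rule fe_differentiable_on_line[OF assms, of x v], rule that)
  have "(\<lambda>t. ext u (x + t *\<^sub>R v)) differentiable (at t)" if t: "t \<notin> F" "x + t *\<^sub>R v \<in> \<Omega>" for t
  proof -
    obtain D where "((\<lambda>t. u (x + t *\<^sub>R v)) has_derivative D) (at t)"
      using F(2)[OF t] unfolding differentiable_def by blast
    then have "((\<lambda>t. ext u (x + t *\<^sub>R v)) has_derivative D) (at t)"
      by (rule has_derivative_transform_within_open[OF _ open_line]) (use t in \<open>auto simp: ext_def\<close>)
    then show ?thesis by (rule differentiableI)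
  qed
  then show thesis using F that by blast
qed

lemma ext_line_DERIV:
  assumes "u \<in> S" "x + t *\<^sub>R v \<in> W"
  shows "((\<lambda>t. ext u (x + t *\<^sub>R v)) has_real_derivative (grad u (x + t *\<^sub>R v) \<bullet> v)) (at t)"
proof -
  have "((\<lambda>t. ext u (x + t *\<^sub>R v)) has_real_derivative (gradient u (x + t *\<^sub>R v) \<bullet> v)) (at t)"
    by (rule has_field_derivative_transform_within_open[OF fe_DERIV_line[OF assms] open_line])
      (use assms W_subset in \<open>auto simp: ext_def\<close>)
  then show ?thesis using assms by (simp add: grad_def)
qed

lemma ext_grad_bounded:
  assumes "u \<in> S"
  obtains L where "L \<ge> 0" "\<And>x. \<bar>ext u x\<bar> \<le> L" "\<And>x. norm (grad u x) \<le> L"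
proof -
  obtain L where L: "L \<ge> 0" "\<And>x. x \<in> \<Omega> \<Longrightarrow> \<bar>u x\<bar> \<le> L" "\<And>x. x \<in> W \<Longrightarrow> norm (gradient u x) \<le> L"
    by (rule fe_bounded[OF assms], rule that)
  have "\<bar>ext u x\<bar> \<le> L" "norm (grad u x) \<le> L" for x
    using L by (cases "x \<in> \<Omega>"; simp add: ext_def)(cases "x \<in> W"; simp add: L grad_def)
  then show thesis using that L(1) by blast
qed

lemma continuous_on_ext_line:
  assumes "u \<in> S" "\<And>t. t \<in> T \<Longrightarrow> x + t *\<^sub>R v \<in> \<Omega>"
  shows "continuous_on T (\<lambda>t. ext u (x + t *\<^sub>R v))"
proof -
  have "continuous_on T (\<lambda>t. u (x + t *\<^sub>R v))"
    by (rule continuous_on_compose2[OF continuous_on_fe[OF assms(1)]]) (use assms in \<open>auto intro!: continuous_intros\<close>)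
  then show ?thesis by (rule continuous_on_eq) (use assms in \<open>auto simp: ext_def\<close>)
qed

text \<open>With \<open>w = u \<psi>\<close> and \<open>e\<close> the \<open>i\<close>-th unit vector, \<open>\<integral> \<partial>\<^sub>i w\<close> equals the average over
  \<open>t \<in> [0, 1]\<close> of the integrals of its translates, which by Fubini's theorem is
  \<open>\<integral> w (x + e) - w x dx = 0\<close>.\<close>

lemma fe_integration_by_parts:
  assumes u: "u \<in> S" and \<psi>: "test_function \<Omega> \<psi>"
  shows "(LINT x|lborel. ext u x * partial_deriv i \<psi> x + (grad u x $ i) * \<psi> x) = 0"
proof -
  obtain K where K: "compact K" "K \<subseteq> \<Omega>" "\<And>x. x \<notin> K \<Longrightarrow> \<psi> x = 0" "\<And>x i. x \<notin> K \<Longrightarrow> partial_deriv i \<psi> x = 0"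
    "\<And>x. \<psi> differentiable (at x)" "continuous_on UNIV \<psi>" "\<And>i. continuous_on UNIV (partial_deriv i \<psi>)"
    by (rule test_functionD[OF \<psi>], rule that)
  obtain L where L: "L \<ge> 0" "\<And>x. \<bar>ext u x\<bar> \<le> L" "\<And>x. norm (grad u x) \<le> L"
    by (rule ext_grad_bounded[OF u], rule that)
  obtain B1 where B1: "\<And>x. \<bar>\<psi> x\<bar> \<le> B1"
    using bounded_if_compact_support[OF K(6) K(1) K(3)] by blast
  obtain B2 where B2: "\<And>x. \<bar>partial_deriv i \<psi> x\<bar> \<le> B2"
    using bounded_if_compact_support[OF K(7)[of i] K(1) K(4)] by blast
  have [measurable]: "\<psi> \<in> borel_measurable borel" "partial_deriv i \<psi> \<in> borel_measurable borel"
    using K by (auto intro: borel_measurable_continuous_onI)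
  note [measurable] = u
  define F where "F = (\<lambda>x. ext u x * partial_deriv i \<psi> x + (grad u x $ i) * \<psi> x)"
  define w where "w = (\<lambda>x. ext u x * \<psi> x)"
  define e where "e = (axis i 1 :: real^'n)"
  have Fm[measurable]: "F \<in> borel_measurable borel"
    unfolding F_def
    by (intro borel_measurable_add borel_measurable_times measurable_ext measurable_grad_nth u) fact+
  have wm[measurable]: "w \<in> borel_measurable borel"
    unfolding w_def by (intro borel_measurable_times measurable_ext u) fact
  have Fb: "\<bar>F x\<bar> \<le> L * B2 + L * B1" for x
  proof -
    have "\<bar>grad u x $ i\<bar> \<le> L" using L(3)[of x] component_le_norm_cart[of "grad u x" i] by linarith
    then have "\<bar>(grad u x $ i) * \<psi> x\<bar> \<le> L * B1" unfolding abs_mult using B1 L by (intro mult_mono) auto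
    moreover have "\<bar>ext u x * partial_deriv i \<psi> x\<bar> \<le> L * B2"
      unfolding abs_mult using B2 L by (intro mult_mono) auto
    ultimately show ?thesis unfolding F_def by linarith
  qed
  have wb: "\<bar>w x\<bar> \<le> L * B1" for x
    unfolding w_def abs_mult using B1 L by (intro mult_mono) auto
  have F0: "F x = 0" "w x = 0" if "x \<notin> K" for x using K(3,4)[OF that] by (auto simp: F_def w_def)
  have bK: "bounded K" using K(1) by (rule compact_imp_bounded)
  have Fi: "integrable lborel F" by (rule integrable_lborel_bounded_support[OF Fm Fb bK F0(1)])
  have wi: "integrable lborel w" by (rule integrable_lborel_bounded_support[OF wm wb bK F0(2)])
  \<comment> \<open>Off the compact set \<open>K\<close> the product \<open>w\<close> vanishes on a
    neighbourhood, so the jump of \<open>ext u\<close> at the boundary of \<open>\<Omega>\<close> is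
    never seen.\<close>
  have diff0: "((\<lambda>t. w (x + t *\<^sub>R e)) has_real_derivative 0) (at t)" if "x + t *\<^sub>R e \<notin> K" for x t
  proof (rule has_field_derivative_transform_within_open[of "\<lambda>_. 0" _ _ "{t. x + t *\<^sub>R e \<in> - K}"])
    have "{t. x + t *\<^sub>R e \<in> - K} = (\<lambda>t. x + t *\<^sub>R e) -` (- K)" by auto
    then show "open {t. x + t *\<^sub>R e \<in> - K}"
      using K(1) by (auto intro!: open_vimage continuous_intros simp: open_Compl compact_imp_closed)
  qed (use that F0 in auto)
  have \<psi>d: "((\<lambda>t. \<psi> (x + t *\<^sub>R e)) has_real_derivative partial_deriv i \<psi> (x + t *\<^sub>R e)) (at t)" for x t
  proof -
    have "(\<psi> has_derivative frechet_derivative \<psi> (at (x + t *\<^sub>R e))) (at (x + t *\<^sub>R e))"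
      using K(5) frechet_derivative_works by blast
    then have "((\<lambda>t. \<psi> (x + t *\<^sub>R e)) has_derivative (\<lambda>h. frechet_derivative \<psi> (at (x + t *\<^sub>R e)) (h *\<^sub>R e))) (at t)"
      by (rule has_derivative_compose[where f="\<lambda>t. x + t *\<^sub>R e", rotated]) (auto intro!: derivative_eq_intros)
    moreover have "frechet_derivative \<psi> (at (x + t *\<^sub>R e)) (h *\<^sub>R e) = partial_deriv i \<psi> (x + t *\<^sub>R e) * h" for h
      using linear_frechet_derivative[OF K(5)] by (simp add: linear_scale partial_deriv_def e_def)
    ultimately show ?thesis by (simp add: has_field_derivative_def mult_commute_abs)
  qed
  \<comment> \<open>\<open>F\<close> is the derivative of \<open>w\<close> in direction
    \<open>e\<close> wherever the line avoids the skeleton; kinks of \<open>u\<close> at cell faces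
    are covered by continuity and the finite exceptional set.\<close>
  have line: "(LINT t:{0..1}|lborel. F (x + t *\<^sub>R e)) = w (x + e) - w x"
    if ae: "AE t in lborel. x + t *\<^sub>R e \<notin> \<Omega> - W" for x
  proof -
    obtain E where E: "finite E"
      "\<And>t. t \<notin> E \<Longrightarrow> x + t *\<^sub>R e \<in> \<Omega> \<Longrightarrow> (\<lambda>t. ext u (x + t *\<^sub>R e)) differentiable (at t)"
      by (rule ext_line_differentiable[OF u, of x e], rule that)
    have "(LINT t:{0..1}|lborel. F (x + t *\<^sub>R e)) = w (x + 1 *\<^sub>R e) - w (x + 0 *\<^sub>R e)"
    proof (rule fundamental_theorem_of_calculus_AE[OF E(1)])
      show "continuous_on {0..1} (\<lambda>t. w (x + t *\<^sub>R e))"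
      proof (rule continuous_at_imp_continuous_on, rule ballI)
        fix t :: real
        show "isCont (\<lambda>t. w (x + t *\<^sub>R e)) t"
        proof (cases "x + t *\<^sub>R e \<in> K")
          case True
          then have "t \<in> {t. x + t *\<^sub>R e \<in> \<Omega>}" using K by auto
          then have "isCont (\<lambda>t. ext u (x + t *\<^sub>R e)) t"
            using continuous_on_ext_line[OF u, of "{t. x + t *\<^sub>R e \<in> \<Omega>}" x e] open_line[of x e]
            by (auto simp: continuous_on_eq_continuous_at)
          then show ?thesis unfolding w_def
            using DERIV_isCont[OF \<psi>d] by (intro continuous_intros)
        qed (use diff0 DERIV_isCont in blast)
      qed
      fix t :: real assume t: "t \<notin> E"
      show "(\<lambda>t. w (x + t *\<^sub>R e)) differentiable at t"
      proof (cases "x + t *\<^sub>R e \<in> K")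
        case True
        then have "(\<lambda>t. ext u (x + t *\<^sub>R e)) differentiable (at t)" using E t K by auto
        moreover have "(\<lambda>t. \<psi> (x + t *\<^sub>R e)) differentiable (at t)"
          using \<psi>d real_differentiable_def by blast
        ultimately show ?thesis unfolding w_def by (rule differentiable_mult)
      qed (use diff0 real_differentiable_def in blast)
    next
      show "AE t in lborel. 0 < t \<and> t < 1 \<longrightarrow> ((\<lambda>t. w (x + t *\<^sub>R e)) has_real_derivative F (x + t *\<^sub>R e)) (at t)"
        using ae
      proof eventually_elim
        case (elim t)
        have "((\<lambda>t. w (x + t *\<^sub>R e)) has_real_derivative F (x + t *\<^sub>R e)) (at t)"
        proof (cases "x + t *\<^sub>R e \<in> K")
          case True
          then have "x + t *\<^sub>R e \<in> W" using elim K by auto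
          from DERIV_mult[OF ext_line_DERIV[OF u this] \<psi>d]
          show ?thesis unfolding w_def F_def
            by (simp add: e_def inner_axis algebra_simps)
        qed (use diff0 F0 in auto)
        then show ?case by blast
      qed
      show "set_integrable lborel {0..1} (\<lambda>t. F (x + t *\<^sub>R e))"
        unfolding set_integrable_def
      proof (rule integrable_lborel_bounded_support[where A="{0..1}" and B="L * B2 + L * B1"])
        show "\<bar>indicator {0..1} t *\<^sub>R F (x + t *\<^sub>R e)\<bar> \<le> L * B2 + L * B1" for t
          using Fb[of "x + t *\<^sub>R e"] abs_ge_zero[of "F x"] Fb[of x] by (auto simp: indicator_def)
      qed auto
    qed
    then show ?thesis by simp
  qed
  define H where "H = (\<lambda>t x. indicator {0..1} t * F (x + t *\<^sub>R e))"
  \<comment> \<open>Translations by \<open>t\<close> times the unit vector \<open>e\<close> with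
    \<open>t\<close> in the unit interval enlarge the support by at most 1, whence the radius
    \<open>R + 1\<close> below.\<close>
  obtain R where R: "\<And>x. x \<in> K \<Longrightarrow> norm x \<le> R" using bK by (auto simp: bounded_iff)
  have "integrable lborel (case_prod H)"
  proof (rule integrable_lborel_bounded_support[where A="{0..1} \<times> cball 0 (R + 1)" and B="L * B2 + L * B1"])
    have "(\<lambda>p. H (fst p) (snd p)) \<in> borel_measurable (borel \<Otimes>\<^sub>M borel)"
      unfolding H_def by measurable
    then show "case_prod H \<in> borel_measurable borel" by (simp add: borel_prod case_prod_unfold)
    show "\<bar>case_prod H p\<bar> \<le> L * B2 + L * B1" for p
      using Fb[of "snd p + fst p *\<^sub>R e"] abs_ge_zero[of "F 0"] Fb[of 0]
      by (auto simp: indicator_def H_def case_prod_unfold)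
    show "bounded ({0..1::real} \<times> cball (0 :: real^'n) (R + 1))"
      by (intro bounded_Times) auto
    fix p :: "real \<times> (real^'n)" assume p: "p \<notin> {0..1} \<times> cball 0 (R + 1)"
    obtain t x where tx: "p = (t, x)" by (cases p)
    have "x + t *\<^sub>R e \<notin> K" if "t \<in> {0..1}"
    proof
      assume "x + t *\<^sub>R e \<in> K"
      then have "norm (x + t *\<^sub>R e) \<le> R" by (rule R)
      moreover have "norm x \<le> norm (x + t *\<^sub>R e) + norm (t *\<^sub>R e)"
        using norm_triangle_ineq4[of "x + t *\<^sub>R e" "t *\<^sub>R e"] by simp
      moreover have "norm (t *\<^sub>R e) \<le> 1" using that by (simp add: e_def)
      ultimately show False using p that tx by auto
    qed
    then show "case_prod H p = 0" using F0 by (auto simp: tx H_def indicator_def)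
  qed
  then have "integrable (lborel \<Otimes>\<^sub>M lborel) (case_prod H)" by (simp add: lborel_prod)
  from lborel_pair.Fubini_integral[OF this]
  have "(LINT x|lborel. LINT t|lborel. H t x) = (LINT t|lborel. LINT x|lborel. H t x)" .
  also have "(LINT t|lborel. LINT x|lborel. H t x) = (LINT t|lborel. indicator {0..1::real} t * (LINT x|lborel. F x))"
  proof (rule Bochner_Integration.integral_cong[OF refl])
    fix t :: real
    show "(LINT x|lborel. H t x) = indicator {0..1} t * (LINT x|lborel. F x)"
      using integral_lborel_plus[OF Fm, of "t *\<^sub>R e"] by (simp add: H_def add.commute)
  qed
  also have "\<dots> = (LINT x|lborel. F x)" by simp
  also have "(LINT x|lborel. LINT t|lborel. H t x) = (LINT x|lborel. w (x + e) - w x)"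
  proof (rule integral_cong_AE)
    show "AE x in lborel. (LINT t|lborel. H t x) = w (x + e) - w x"
      using AE_line_notin_null_set[OF null_skeleton, of e]
    proof eventually_elim
      case (elim x)
      from line[OF this] show ?case by (simp add: H_def set_lebesgue_integral_def)
    qed
    have "(\<lambda>(x, t). H t x) \<in> borel_measurable (lborel \<Otimes>\<^sub>M lborel)"
      unfolding H_def case_prod_unfold by measurable
    then show "(\<lambda>x. LINT t|lborel. H t x) \<in> borel_measurable lborel"
      by (rule lborel.borel_measurable_lebesgue_integral)
  qed measurable
  also have "\<dots> = (LINT x|lborel. w (e + x)) - (LINT x|lborel. w x)"
  proof -
    have "integrable lborel (\<lambda>x. w (x + e))"
    proof (rule integrable_lborel_bounded_support)
      show "bounded ((\<lambda>x. x - e) ` K)" using bK by (rule bounded_translation_minus)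
      show "w (x + e) = 0" if "x \<notin> (\<lambda>x. x - e) ` K" for x
        using F0(2)[of "x + e"] that by (metis add_diff_cancel_right' imageI)
    qed (use wb in auto)
    then show ?thesis using wi by (simp add: add.commute)
  qed
  also have "\<dots> = 0" using integral_lborel_plus[OF wm] by simp
  finally show ?thesis by (simp add: F_def)
qed

end

section \<open>Weak gradients of finite element functions\<close>

text \<open>All integrands of the energy arguments are polynomials in such functions. The class is
  closed under algebraic operations and is integrable over a finite measure, so integrability
  becomes automatic.\<close>

definition bounded_measurable :: "'a measure \<Rightarrow> ('a \<Rightarrow> real) \<Rightarrow> bool" where
  "bounded_measurable M f \<longleftrightarrow> f \<in> borel_measurable M \<and> (\<exists>B. \<forall>x\<in>space M. \<bar>f x\<bar> \<le> B)"

lemma bounded_measurableI: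
  "f \<in> borel_measurable M \<Longrightarrow> (\<And>x. x \<in> space M \<Longrightarrow> \<bar>f x\<bar> \<le> B) \<Longrightarrow> bounded_measurable M f"
  unfolding bounded_measurable_def by blast

lemma bounded_measurable_const [intro, simp]: "bounded_measurable M (\<lambda>_. c)"
  by (rule bounded_measurableI[where B="\<bar>c\<bar>"]) auto

lemma bounded_measurable_add [intro, simp]:
  assumes "bounded_measurable M f" "bounded_measurable M g"
  shows "bounded_measurable M (\<lambda>x. f x + g x)"
proof -
  obtain B C where "\<forall>x\<in>space M. \<bar>f x\<bar> \<le> B" "\<forall>x\<in>space M. \<bar>g x\<bar> \<le> C"
    using assms unfolding bounded_measurable_def by blast
  then have "\<forall>x\<in>space M. \<bar>f x + g x\<bar> \<le> B + C" by (meson abs_triangle_ineq add_mono order_trans)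
  then show ?thesis using assms unfolding bounded_measurable_def by (blast intro: borel_measurable_add)
qed

lemma bounded_measurable_mult [intro, simp]:
  assumes "bounded_measurable M f" "bounded_measurable M g"
  shows "bounded_measurable M (\<lambda>x. f x * g x)"
proof -
  obtain B C where BC: "\<forall>x\<in>space M. \<bar>f x\<bar> \<le> B" "\<forall>x\<in>space M. \<bar>g x\<bar> \<le> C"
    using assms unfolding bounded_measurable_def by blast
  have "\<forall>x\<in>space M. \<bar>f x * g x\<bar> \<le> B * C"
    unfolding abs_mult using BC by (meson abs_ge_zero mult_mono order_trans)
  then show ?thesis using assms unfolding bounded_measurable_def by (blast intro: borel_measurable_times)
qed

lemma bounded_measurable_uminus [intro, simp]:
  "bounded_measurable M f \<Longrightarrow> bounded_measurable M (\<lambda>x. - f x)"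
  using bounded_measurable_mult[of M "\<lambda>_. -1" f] by simp

lemma bounded_measurable_diff [intro, simp]:
  "bounded_measurable M f \<Longrightarrow> bounded_measurable M g \<Longrightarrow> bounded_measurable M (\<lambda>x. f x - g x)"
  using bounded_measurable_add[of M f "\<lambda>x. - g x"] by simp

lemma bounded_measurable_divide [intro, simp]:
  "bounded_measurable M f \<Longrightarrow> bounded_measurable M (\<lambda>x. f x / c)"
  using bounded_measurable_mult[of M f "\<lambda>_. 1 / c"] by simp

lemma bounded_measurable_power [intro, simp]:
  "bounded_measurable M f \<Longrightarrow> bounded_measurable M (\<lambda>x. f x ^ n)"
  by (induction n) auto

lemma bounded_measurable_abs [intro, simp]:
  "bounded_measurable M f \<Longrightarrow> bounded_measurable M (\<lambda>x. \<bar>f x\<bar>)"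
  unfolding bounded_measurable_def by auto

lemma bounded_measurable_sum [intro, simp]:
  "(\<And>i. i \<in> I \<Longrightarrow> bounded_measurable M (f i)) \<Longrightarrow> bounded_measurable M (\<lambda>x. \<Sum>i\<in>I. f i x)"
  by (induction I rule: infinite_finite_induct) auto

context finite_measure
begin

lemma integrable_bounded_measurable [intro, simp]:
  assumes "bounded_measurable M f"
  shows "integrable M f"
proof -
  obtain B where "\<forall>x\<in>space M. \<bar>f x\<bar> \<le> B" "f \<in> borel_measurable M"
    using assms unfolding bounded_measurable_def by blast
  then show ?thesis by (intro integrable_const_bound[of _ B]) auto
qed

lemma integral_Cauchy_Schwarz:
  assumes f: "bounded_measurable M f" and g: "bounded_measurable M g"
  shows "(LINT x|M. f x * g x)\<^sup>2 \<le> (LINT x|M. (f x)\<^sup>2) * (LINT x|M. (g x)\<^sup>2)"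
proof -
  define a b c where "a = (LINT x|M. (f x)\<^sup>2)" "b = (LINT x|M. f x * g x)" "c = (LINT x|M. (g x)\<^sup>2)"
  note abc = this
  have q: "a - 2 * t * b + t\<^sup>2 * c \<ge> 0" for t
  proof -
    have "0 \<le> (LINT x|M. (f x - t * g x)\<^sup>2)" by simp
    also have "(LINT x|M. (f x - t * g x)\<^sup>2) = (LINT x|M. (f x)\<^sup>2 - 2 * t * (f x * g x) + t\<^sup>2 * (g x)\<^sup>2)"
      by (simp add: power2_eq_square algebra_simps)
    also have "\<dots> = a - 2 * t * b + t\<^sup>2 * c" unfolding abc using f g by simp
    finally show ?thesis .
  qed
  have "c \<ge> 0" unfolding abc by simp
  show ?thesis
  proof (cases "c = 0")
    case True
    have "b = 0"
    proof (rule ccontr)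
      assume "b \<noteq> 0"
      \<comment> \<open>This choice of \<open>t\<close> makes \<open>a - 2 * t * b\<close> equal to
        -1.\<close>
      then show False using q[of "(a + 1) / (2 * b)"] True by simp
    qed
    then show ?thesis using True unfolding abc by simp
  next
    case False
    with \<open>c \<ge> 0\<close> have "c > 0" by simp
    then have "0 \<le> (a - 2 * (b / c) * b + (b / c)\<^sup>2 * c) * c" using q[of "b / c"] by simp
    also have "\<dots> = a * c - b\<^sup>2" using \<open>c > 0\<close> by (simp add: field_simps power2_eq_square)
    finally show ?thesis unfolding abc by simp
  qed
qed

end

context mesh
begin

abbreviation M :: "(real^'n) measure" where "M \<equiv> lebesgue_on \<Omega>"

lemma lebesgue_domain [simp]: "\<Omega> \<in> sets lebesgue"
  using open_domain by auto

lemma finite_measure_M: "finite_measure M"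
proof
  have "emeasure lborel \<Omega> < \<infinity>" using bounded_domain by (rule emeasure_bounded_finite)
  then have "emeasure lebesgue \<Omega> \<noteq> \<infinity>" by (simp add: emeasure_completion)
  then show "emeasure M (space M) \<noteq> \<infinity>" by (simp add: emeasure_restrict_space space_restrict_space)
qed

sublocale finite_measure M by (rule finite_measure_M)

lemma measurable_M: "f \<in> borel_measurable borel \<Longrightarrow> f \<in> borel_measurable M"
  by (intro measurable_restrict_space1 measurable_completion) simp

lemma integral_M_eq:
  fixes f f' :: "real^'n \<Rightarrow> real"
  assumes "f' \<in> borel_measurable borel" "\<And>x. x \<in> \<Omega> \<Longrightarrow> f x = f' x" "\<And>x. x \<notin> \<Omega> \<Longrightarrow> f' x = 0"
  shows "(LINT x|M. f x) = (LINT x|lborel. f' x)"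
proof -
  have "(LINT x|M. f x) = (LINT x|lebesgue. indicator \<Omega> x *\<^sub>R f x)"
    by (rule integral_restrict_space) simp
  also have "\<dots> = (LINT x|lebesgue. f' x)"
    by (rule Bochner_Integration.integral_cong) (use assms in \<open>auto simp: indicator_def\<close>)
  also have "\<dots> = (LINT x|lborel. f' x)" by (rule integral_completion) (use assms in simp)
  finally show ?thesis .
qed

lemma bounded_measurable_fe [intro, simp]: "u \<in> S \<Longrightarrow> bounded_measurable M u"
proof -
  assume u: "u \<in> S"
  obtain L where L: "L \<ge> 0" "\<And>x. \<bar>ext u x\<bar> \<le> L" "\<And>x. norm (grad u x) \<le> L"
    by (rule ext_grad_bounded[OF u], rule that)
  have "ext u \<in> borel_measurable M" by (intro measurable_M measurable_ext u)
  then have "u \<in> borel_measurable M"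
    by (rule measurable_cong[THEN iffD1, rotated]) (simp add: ext_def)
  then show ?thesis
  proof (rule bounded_measurableI)
    show "\<bar>u x\<bar> \<le> L" if "x \<in> space M" for x using L(2)[of x] that by (simp add: ext_def)
  qed
qed

lemma bounded_measurable_grad [intro, simp]:
  assumes u: "u \<in> S"
  shows "bounded_measurable M (\<lambda>x. grad u x $ i)" "bounded_measurable M (\<lambda>x. norm (grad u x))"
proof -
  obtain L where L: "L \<ge> 0" "\<And>x. \<bar>ext u x\<bar> \<le> L" "\<And>x. norm (grad u x) \<le> L"
    by (rule ext_grad_bounded[OF u], rule that)
  show "bounded_measurable M (\<lambda>x. grad u x $ i)"
  proof (rule bounded_measurableI)
    show "(\<lambda>x. grad u x $ i) \<in> borel_measurable M" by (intro measurable_M measurable_grad_nth u)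
    show "\<bar>grad u x $ i\<bar> \<le> L" for x
      using L(3)[of x] component_le_norm_cart[of "grad u x" i] by linarith
  qed
  show "bounded_measurable M (\<lambda>x. norm (grad u x))"
  proof (rule bounded_measurableI)
    show "(\<lambda>x. norm (grad u x)) \<in> borel_measurable M"
      by (intro measurable_M measurable_compose[OF measurable_grad[OF u]]
          borel_measurable_continuous_onI continuous_intros)
  qed (use L in auto)
qed

lemma bounded_measurable_inner_grad [intro, simp]:
  "u \<in> S \<Longrightarrow> v \<in> S \<Longrightarrow> bounded_measurable M (\<lambda>x. grad u x \<bullet> grad v x)"
  unfolding inner_vec_def by auto

lemma bounded_measurable_test_function:
  assumes "test_function \<Omega> \<psi>"
  shows "bounded_measurable M \<psi>" "bounded_measurable M (partial_deriv i \<psi>)"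
proof -
  obtain K where K: "compact K" "K \<subseteq> \<Omega>" "\<And>x. x \<notin> K \<Longrightarrow> \<psi> x = 0" "\<And>x i. x \<notin> K \<Longrightarrow> partial_deriv i \<psi> x = 0"
    "\<And>x. \<psi> differentiable (at x)" "continuous_on UNIV \<psi>" "\<And>i. continuous_on UNIV (partial_deriv i \<psi>)"
    by (rule test_functionD[OF assms], rule that)
  obtain B1 where B1: "\<And>x. \<bar>\<psi> x\<bar> \<le> B1"
    using bounded_if_compact_support[OF K(6) K(1) K(3)] by blast
  obtain B2 where B2: "\<And>x. \<bar>partial_deriv i \<psi> x\<bar> \<le> B2"
    using bounded_if_compact_support[OF K(7)[of i] K(1) K(4)] by blast
  show "bounded_measurable M \<psi>"
    by (rule bounded_measurableI[OF measurable_M[OF borel_measurable_continuous_onI[OF K(6)]] B1])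
  show "bounded_measurable M (partial_deriv i \<psi>)"
    by (rule bounded_measurableI[OF measurable_M[OF borel_measurable_continuous_onI[OF K(7)]] B2])
qed

lemma L2_if_bounded_measurable: "bounded_measurable M f \<Longrightarrow> f \<in> L2 \<Omega>"
  unfolding L2_def by (auto simp: bounded_measurable_def[of M f])

lemma has_weak_gradient_fe:
  assumes u: "u \<in> S"
  shows "has_weak_gradient \<Omega> u (grad u)"
  unfolding has_weak_gradient_def
proof (intro conjI allI impI)
  show "u \<in> L2 \<Omega>" "(\<lambda>x. grad u x $ i) \<in> L2 \<Omega>" for i
    using u by (auto intro: L2_if_bounded_measurable)
  fix \<psi> i assume \<psi>: "test_function \<Omega> \<psi>"
  obtain K where K: "compact K" "K \<subseteq> \<Omega>" "\<And>x. x \<notin> K \<Longrightarrow> \<psi> x = 0" "\<And>x i. x \<notin> K \<Longrightarrow> partial_deriv i \<psi> x = 0"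
    "\<And>x. \<psi> differentiable (at x)" "continuous_on UNIV \<psi>" "\<And>i. continuous_on UNIV (partial_deriv i \<psi>)"
    by (rule test_functionD[OF \<psi>], rule that)
  have "(LINT x|M. u x * partial_deriv i \<psi> x + (grad u x $ i) * \<psi> x) =
        (LINT x|lborel. ext u x * partial_deriv i \<psi> x + (grad u x $ i) * \<psi> x)"
  proof (rule integral_M_eq)
    show "(\<lambda>x. ext u x * partial_deriv i \<psi> x + (grad u x $ i) * \<psi> x) \<in> borel_measurable borel"
      by (intro borel_measurable_add borel_measurable_times measurable_ext measurable_grad_nth u
          borel_measurable_continuous_onI K)
  qed (use W_subset in \<open>auto simp: ext_def grad_def indicator_def\<close>)
  also have "\<dots> = 0" by (rule fe_integration_by_parts[OF u \<psi>])
  finally show "L2_inner \<Omega> u (partial_deriv i \<psi>) = - L2_inner \<Omega> (\<lambda>x. grad u x $ i) \<psi>"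
    using u bounded_measurable_test_function[OF \<psi>] by (simp add: L2_inner_def)
qed

lemma integrable_if_L2: 
  assumes "f \<in> L2 \<Omega>"
  shows "integrable M f"
proof (rule Bochner_Integration.integrable_bound)
  show "integrable M (\<lambda>x. 1 + (f x)\<^sup>2)" using assms by (simp add: L2_def)
  show "AE x in M. norm (f x) \<le> norm (1 + (f x)\<^sup>2)"
  proof (rule AE_I2)
    fix x
    have "0 \<le> (\<bar>f x\<bar> - 1)\<^sup>2" by simp
    then have "2 * \<bar>f x\<bar> \<le> 1 + (f x)\<^sup>2" by (simp add: power2_eq_square algebra_simps)
    then show "norm (f x) \<le> norm (1 + (f x)\<^sup>2)" by simp
  qed
qed (use assms in \<open>simp add: L2_def\<close>)

text \<open>Each component of the difference is orthogonal to all test functions. This identifies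
  the chosen representative \<open>weak_gradient \<Omega> u\<close> with the piecewise gradient,
  after which \<open>grad_form\<close> and \<open>energy\<close> are explicit integrals.\<close>

lemma weak_gradient_unique:
  assumes u: "u \<in> S" and g: "has_weak_gradient \<Omega> u g"
  shows "AE x in M. g x = grad u x"
proof -
  have "AE x in M. g x $ i - grad u x $ i = 0" for i
  proof (rule AE_0_if_orthogonal_to_test_functions[OF open_domain])
    have gi: "integrable M (\<lambda>x. g x $ i)" using g by (intro integrable_if_L2) (simp add: has_weak_gradient_def)
    then show "integrable M (\<lambda>x. g x $ i - grad u x $ i)" using u by simp
    fix \<psi> assume \<psi>: "test_function \<Omega> \<psi>"
    note b = bounded_measurable_test_function[OF \<psi>]
    have "L2_inner \<Omega> (\<lambda>x. g x $ i) \<psi> = L2_inner \<Omega> (\<lambda>x. grad u x $ i) \<psi>"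
      using g has_weak_gradient_fe[OF u] \<psi> unfolding has_weak_gradient_def by (metis neg_equal_iff_equal)
    moreover have "integrable M (\<lambda>x. g x $ i * \<psi> x)"
    proof -
      obtain B where B: "\<forall>x\<in>space M. \<bar>\<psi> x\<bar> \<le> B" "\<psi> \<in> borel_measurable M"
        using b(1) unfolding bounded_measurable_def by blast
      show ?thesis
      proof (rule Bochner_Integration.integrable_bound)
        show "integrable M (\<lambda>x. B * (g x $ i))" using gi by simp
        show "AE x in M. norm (g x $ i * \<psi> x) \<le> norm (B * (g x $ i))"
        proof (rule AE_I2)
          fix x assume "x \<in> space M"
          then have "\<bar>\<psi> x\<bar> \<le> \<bar>B\<bar>" using B(1) by force
          then show "norm (g x $ i * \<psi> x) \<le> norm (B * (g x $ i))"
            by (simp add: abs_mult mult.commute[of "\<bar>B\<bar>"] mult_left_mono)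
        qed
      qed (use gi B(2) in auto)
    qed
    ultimately show "(LINT x|M. (g x $ i - grad u x $ i) * \<psi> x) = 0"
      using u b by (simp add: L2_inner_def left_diff_distrib)
  qed
  then have "AE x in M. \<forall>i\<in>UNIV. g x $ i - grad u x $ i = 0" by (subst AE_finite_all) auto
  then show ?thesis by eventually_elim (simp add: vec_eq_iff)
qed

lemma weak_gradient_fe:
  assumes u: "u \<in> S"
  shows "AE x in M. weak_gradient \<Omega> u x = grad u x" "(\<lambda>x. weak_gradient \<Omega> u x $ i) \<in> borel_measurable M"
proof -
  have h: "has_weak_gradient \<Omega> u (weak_gradient \<Omega> u)"
    unfolding weak_gradient_def using someI[of "has_weak_gradient \<Omega> u", OF has_weak_gradient_fe[OF u]] .
  then show "AE x in M. weak_gradient \<Omega> u x = grad u x" by (rule weak_gradient_unique[OF u])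
  show "(\<lambda>x. weak_gradient \<Omega> u x $ i) \<in> borel_measurable M"
    using h by (simp add: has_weak_gradient_def L2_def)
qed

lemma grad_form_fe:
  assumes u: "u \<in> S" and v: "v \<in> S"
  shows "grad_form \<Omega> u v = (LINT x|M. grad u x \<bullet> grad v x)"
  unfolding grad_form_def
proof (rule integral_cong_AE)
  show "(\<lambda>x. weak_gradient \<Omega> u x \<bullet> weak_gradient \<Omega> v x) \<in> borel_measurable M"
    unfolding inner_vec_def using weak_gradient_fe(2)[OF u] weak_gradient_fe(2)[OF v]
    by (auto intro!: borel_measurable_sum borel_measurable_times)
  show "(\<lambda>x. grad u x \<bullet> grad v x) \<in> borel_measurable M"
    using bounded_measurable_inner_grad[OF u v] by (simp add: bounded_measurable_def)
  show "AE x in M. weak_gradient \<Omega> u x \<bullet> weak_gradient \<Omega> v x = grad u x \<bullet> grad v x"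
    using weak_gradient_fe(1)[OF u] weak_gradient_fe(1)[OF v] by eventually_elim simp
qed

lemma energy_fe:
  assumes u: "u \<in> S"
  shows "energy \<Omega> \<epsilon> u = 1 / (4 * \<epsilon>) * (LINT x|M. ((u x)\<^sup>2 - 1)\<^sup>2) + \<epsilon> / 2 * grad_form \<Omega> u u"
proof -
  have "energy \<Omega> \<epsilon> u = (LINT x|M. 1 / (4 * \<epsilon>) * ((u x)\<^sup>2 - 1)\<^sup>2 + \<epsilon> / 2 * (grad u x \<bullet> grad u x))"
    unfolding energy_def
  proof (rule integral_cong_AE)
    have um[measurable]: "u \<in> borel_measurable M" using bounded_measurable_fe[OF u] by (simp add: bounded_measurable_def)
    have "(\<lambda>x. weak_gradient \<Omega> u x \<bullet> weak_gradient \<Omega> u x) \<in> borel_measurable M"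
      unfolding inner_vec_def using weak_gradient_fe(2)[OF u]
      by (auto intro!: borel_measurable_sum borel_measurable_times)
    then have [measurable]: "(\<lambda>x. (norm (weak_gradient \<Omega> u x))\<^sup>2) \<in> borel_measurable M"
      by (simp add: power2_norm_eq_inner)
    show "(\<lambda>x. 1 / (4 * \<epsilon>) * ((u x)\<^sup>2 - 1)\<^sup>2 + \<epsilon> / 2 * (norm (weak_gradient \<Omega> u x))\<^sup>2) \<in> borel_measurable M"
      by measurable
    have "bounded_measurable M (\<lambda>x. 1 / (4 * \<epsilon>) * ((u x)\<^sup>2 - 1)\<^sup>2 + \<epsilon> / 2 * (grad u x \<bullet> grad u x))"
      using u by (intro bounded_measurable_add bounded_measurable_mult bounded_measurable_power bounded_measurable_diff) auto
    then show "(\<lambda>x. 1 / (4 * \<epsilon>) * ((u x)\<^sup>2 - 1)\<^sup>2 + \<epsilon> / 2 * (grad u x \<bullet> grad u x)) \<in> borel_measurable M"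
      by (simp add: bounded_measurable_def)
    show "AE x in M. 1 / (4 * \<epsilon>) * ((u x)\<^sup>2 - 1)\<^sup>2 + \<epsilon> / 2 * (norm (weak_gradient \<Omega> u x))\<^sup>2
        = 1 / (4 * \<epsilon>) * ((u x)\<^sup>2 - 1)\<^sup>2 + \<epsilon> / 2 * (grad u x \<bullet> grad u x)"
      using weak_gradient_fe(1)[OF u] by eventually_elim (simp add: power2_norm_eq_inner)
  qed
  also have "\<dots> = 1 / (4 * \<epsilon>) * (LINT x|M. ((u x)\<^sup>2 - 1)\<^sup>2) + \<epsilon> / 2 * (LINT x|M. grad u x \<bullet> grad u x)"
    using u by (subst Bochner_Integration.integral_add) (auto intro!: integrable_mult_right)
  finally show ?thesis by (simp add: grad_form_fe[OF u u])
qed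

text \<open>The gradient identity holds at every point and not only almost everywhere, because
  \<open>grad\<close> is 0 off \<open>W\<close>.\<close>

lemma fe_linear:
  assumes u: "u \<in> S" and v: "v \<in> S"
  shows "(\<lambda>x. a * u x + b * v x) \<in> S" "grad (\<lambda>x. a * u x + b * v x) x = a *\<^sub>R grad u x + b *\<^sub>R grad v x"
proof -
  have p: "polynomial_of_degree_le q (\<lambda>x. a * p1 x + b * p2 x)"
    if "polynomial_of_degree_le q p1" "polynomial_of_degree_le q p2" for p1 p2 :: "real^'n \<Rightarrow> real"
  proof -
    obtain c1 c2 where "\<forall>x. p1 x = (\<Sum>\<alpha> | (\<Sum>i\<in>UNIV. \<alpha> i) \<le> q. c1 \<alpha> * (\<Prod>i\<in>UNIV. (x $ i) ^ \<alpha> i))"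
      "\<forall>x. p2 x = (\<Sum>\<alpha> | (\<Sum>i\<in>UNIV. \<alpha> i) \<le> q. c2 \<alpha> * (\<Prod>i\<in>UNIV. (x $ i) ^ \<alpha> i))"
      using \<open>polynomial_of_degree_le q p1\<close> \<open>polynomial_of_degree_le q p2\<close>
      unfolding polynomial_of_degree_le_def by blast
    then have "\<forall>x. a * p1 x + b * p2 x =
        (\<Sum>\<alpha> | (\<Sum>i\<in>UNIV. \<alpha> i) \<le> q. (a * c1 \<alpha> + b * c2 \<alpha>) * (\<Prod>i\<in>UNIV. (x $ i) ^ \<alpha> i))"
      by (simp add: sum_distrib_left sum.distrib algebra_simps)
    then show ?thesis unfolding polynomial_of_degree_le_def by (rule exI[of _ "\<lambda>\<alpha>. a * c1 \<alpha> + b * c2 \<alpha>"])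
  qed
  show S: "(\<lambda>x. a * u x + b * v x) \<in> S"
    unfolding S_def fe_space_def
  proof (intro CollectI conjI ballI)
    show "continuous_on \<Omega> (\<lambda>x. a * u x + b * v x)"
      using continuous_on_fe[OF u] continuous_on_fe[OF v] by (intro continuous_intros)
    fix K assume K: "K \<in> \<K>"
    obtain p1 where "polynomial_of_degree_le q p1" "\<forall>x\<in>K \<inter> \<Omega>. u x = p1 x"
      using u K unfolding S_def fe_space_def by blast
    moreover obtain p2 where "polynomial_of_degree_le q p2" "\<forall>x\<in>K \<inter> \<Omega>. v x = p2 x"
      using v K unfolding S_def fe_space_def by blast
    ultimately show "\<exists>p. polynomial_of_degree_le q p \<and> (\<forall>x\<in>K \<inter> \<Omega>. a * u x + b * v x = p x)"
      by (intro exI[of _ "\<lambda>x. a * p1 x + b * p2 x"]) (simp add: p)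
  qed
  show "grad (\<lambda>x. a * u x + b * v x) x = a *\<^sub>R grad u x + b *\<^sub>R grad v x"
  proof (cases "x \<in> W")
    case True
    have "((\<lambda>x. a * u x + b * v x) has_derivative (\<lambda>h. a * (gradient u x \<bullet> h) + b * (gradient v x \<bullet> h))) (at x)"
      by (intro has_derivative_add has_derivative_mult_right fe_has_derivative u v True)
    then have "((\<lambda>x. a * u x + b * v x) has_derivative (\<lambda>h. (a *\<^sub>R gradient u x + b *\<^sub>R gradient v x) \<bullet> h)) (at x)"
      by (simp add: inner_add_left)
    then show ?thesis using True by (simp add: grad_def gradient_eqI)
  qed (simp add: grad_def)
qed

end

section \<open>Sobolev inequality\<close>

text \<open>The function \<open>(1 - t) * v t ^ 4\<close> along the segment vanishes at
  \<open>t = 1\<close> and equals \<open>u x ^ 4\<close> at \<open>t = 0\<close>, so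
  \<open>u x ^ 4\<close> is minus the integral of its derivative \<open>k\<close>. The weight
  \<open>1 - t\<close> removes the need for any boundary value; differentiating it costs
  \<open>v ^ 4\<close>, and the chain rule costs \<open>4 * norm b\<close>, whence the condition on
  \<open>m\<close>.\<close>

lemma (in mesh) fe_pointwise_bound:
  assumes u: "u \<in> S" and seg: "\<And>s. 0 \<le> s \<Longrightarrow> s \<le> 1 \<Longrightarrow> x + s *\<^sub>R b \<in> \<Omega>"
    and ae: "AE t in lborel. x + t *\<^sub>R b \<notin> \<Omega> - W"
    and m: "1 + 4 * norm b \<le> m"
  shows "ennreal ((ext u x) ^ 4) \<le>
    (\<integral>\<^sup>+t. ennreal (m * ((ext u (x + t *\<^sub>R b)) ^ 4 + \<bar>ext u (x + t *\<^sub>R b)\<bar> ^ 3 * norm (grad u (x + t *\<^sub>R b)))) \<partial>lborel)"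
proof -
  define v where "v = (\<lambda>t. ext u (x + t *\<^sub>R b))"
  define G where "G = (\<lambda>t. grad u (x + t *\<^sub>R b))"
  define k where "k = (\<lambda>t. - (v t ^ 4) + (1 - t) * (4 * v t ^ 3 * (G t \<bullet> b)))"
  define g where "g = (\<lambda>t. m * (v t ^ 4 + \<bar>v t\<bar> ^ 3 * norm (G t)))"
  have m0: "m \<ge> 1" using m norm_ge_zero[of b] by linarith
  have g0: "g t \<ge> 0" for t unfolding g_def using m0 by auto
  have line: "(\<lambda>t. x + t *\<^sub>R b) \<in> borel_measurable borel"
    by (intro borel_measurable_continuous_onI continuous_intros)
  have vm[measurable]: "v \<in> borel_measurable borel"
    unfolding v_def by (rule measurable_compose[OF line measurable_ext[OF u]])
  have Gm: "G \<in> borel_measurable borel"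
    unfolding G_def by (rule measurable_compose[OF line measurable_grad[OF u]])
  have [measurable]: "(\<lambda>t. G t \<bullet> b) \<in> borel_measurable borel" "(\<lambda>t. norm (G t)) \<in> borel_measurable borel"
    by (intro measurable_compose[OF Gm] borel_measurable_continuous_onI continuous_intros)+
  have km[measurable]: "k \<in> borel_measurable borel" unfolding k_def by measurable
  have gm[measurable]: "g \<in> borel_measurable borel" unfolding g_def by measurable
  obtain L where L: "L \<ge> 0" "\<And>x. \<bar>ext u x\<bar> \<le> L" "\<And>x. norm (grad u x) \<le> L"
    by (rule ext_grad_bounded[OF u], rule that)
  have kg: "\<bar>k t\<bar> \<le> g t" if "t \<in> {0..1}" for t
  proof -
    have "\<bar>(1 - t) * (4 * v t ^ 3 * (G t \<bullet> b))\<bar> \<le> 1 * (4 * \<bar>v t\<bar> ^ 3 * (norm (G t) * norm b))"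
      unfolding abs_mult power_abs using that
      by (intro mult_mono Cauchy_Schwarz_ineq2) auto
    moreover have "\<bar>k t\<bar> \<le> v t ^ 4 + \<bar>(1 - t) * (4 * v t ^ 3 * (G t \<bullet> b))\<bar>"
      unfolding k_def using abs_triangle_ineq[of "- (v t ^ 4)" "(1 - t) * (4 * v t ^ 3 * (G t \<bullet> b))"]
      by (simp only: abs_minus_cancel) (simp add: mult_ac)
    ultimately have "\<bar>k t\<bar> \<le> v t ^ 4 + 1 * (4 * \<bar>v t\<bar> ^ 3 * (norm (G t) * norm b))" by linarith
    then have "\<bar>k t\<bar> \<le> 1 * (v t ^ 4) + (4 * norm b) * (\<bar>v t\<bar> ^ 3 * norm (G t))"
      by (simp only: mult_1 mult_ac)
    also have "\<dots> \<le> m * (v t ^ 4) + m * (\<bar>v t\<bar> ^ 3 * norm (G t))"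
      using m m0 by (intro add_mono mult_right_mono) (linarith | simp)+
    finally show ?thesis by (simp add: g_def distrib_left)
  qed
  have gb: "g t \<le> m * (L ^ 4 + L ^ 3 * L)" for t
  proof -
    have "v t ^ 4 = \<bar>v t\<bar> ^ 4" by simp
    also have "\<dots> \<le> L ^ 4" using L unfolding v_def by (intro power_mono) auto
    finally have "v t ^ 4 \<le> L ^ 4" .
    moreover have "\<bar>v t\<bar> ^ 3 * norm (G t) \<le> L ^ 3 * L"
      using L unfolding v_def G_def by (intro mult_mono power_mono) auto
    ultimately show ?thesis unfolding g_def using m0 by (intro mult_left_mono add_mono) auto
  qed
  define Bd where "Bd = m * (L ^ 4 + L ^ 3 * L)"
  have Bd0: "Bd \<ge> 0" using g0[of 0] gb[of 0] by (simp add: Bd_def)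
  have gi: "integrable lborel (\<lambda>t. indicator {0..1} t * g t)"
    by (rule integrable_lborel_bounded_support[where A="{0..1}" and B=Bd])
      (use g0 gb Bd0 in \<open>auto simp: indicator_def Bd_def\<close>)
  have ki: "integrable lborel (\<lambda>t. indicator {0..1} t * k t)"
  proof (rule integrable_lborel_bounded_support[where A="{0..1}" and B=Bd])
    show "\<bar>indicator {0..1} t * k t\<bar> \<le> Bd" for t
      using kg[of t] gb[of t] Bd0 by (auto simp: indicator_def Bd_def)
  qed auto
  obtain F where F: "finite F"
    "\<And>t. t \<notin> F \<Longrightarrow> x + t *\<^sub>R b \<in> \<Omega> \<Longrightarrow> (\<lambda>t. ext u (x + t *\<^sub>R b)) differentiable (at t)"
    by (rule ext_line_differentiable[OF u, of x b], rule that)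
  have ftc: "(LINT t:{0..1}|lborel. k t) = (1 - 1) * v 1 ^ 4 - (1 - 0) * v 0 ^ 4"
  proof (rule fundamental_theorem_of_calculus_AE[OF F(1)])
    have "continuous_on {0..1} v" unfolding v_def
      by (rule continuous_on_ext_line[OF u]) (use seg in auto)
    then show "continuous_on {0..1} (\<lambda>t. (1 - t) * v t ^ 4)" by (intro continuous_intros)
    show "(\<lambda>t. (1 - t) * v t ^ 4) differentiable at t" if "0 < t" "t < 1" "t \<notin> F" for t
    proof -
      have "v differentiable (at t)" unfolding v_def using F(2)[OF that(3)] seg[of t] that by auto
      then show ?thesis by (intro derivative_intros differentiable_power) auto
    qed
    show "AE t in lborel. 0 < t \<and> t < 1 \<longrightarrow> ((\<lambda>t. (1 - t) * v t ^ 4) has_real_derivative k t) (at t)"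
      using ae
    proof eventually_elim
      case (elim t)
      show ?case
      proof
        assume "0 < t \<and> t < 1"
        then have "x + t *\<^sub>R b \<in> W" using seg[of t] elim by auto
        from ext_line_DERIV[OF u this] have "(v has_real_derivative G t \<bullet> b) (at t)"
          by (simp add: v_def G_def)
        then show "((\<lambda>t. (1 - t) * v t ^ 4) has_real_derivative k t) (at t)"
          unfolding k_def by (auto intro!: derivative_eq_intros)
      qed
    qed
    show "set_integrable lborel {0..1} k" using ki by (simp add: set_integrable_def)
  qed
  have "(ext u x) ^ 4 = - (LINT t|lborel. indicator {0..1} t * k t)"
    using ftc by (simp add: v_def set_lebesgue_integral_def)
  also have "\<dots> = (LINT t|lborel. - (indicator {0..1} t * k t))" by simp
  also have "\<dots> \<le> (LINT t|lborel. indicator {0..1} t * g t)"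
  proof (rule integral_mono)
    show "- (indicator {0..1} t * k t) \<le> indicator {0..1} t * g t" for t
      using kg[of t] by (auto simp: indicator_def)
  qed (use ki gi in auto)
  finally have "ennreal ((ext u x) ^ 4) \<le> ennreal (LINT t|lborel. indicator {0..1} t * g t)"
    by (rule ennreal_leI)
  also have "\<dots> = (\<integral>\<^sup>+t. ennreal (indicator {0..1} t * g t) \<partial>lborel)"
    by (rule nn_integral_eq_integral[symmetric]) (use gi g0 in auto)
  also have "\<dots> \<le> (\<integral>\<^sup>+t. ennreal (g t) \<partial>lborel)"
    by (intro nn_integral_mono ennreal_leI) (use g0 in \<open>auto simp: indicator_def\<close>)
  finally show ?thesis by (simp add: g_def v_def G_def)
qed

lemma (in mesh) nn_integral_M_eq:
  fixes f f' :: "real^'n \<Rightarrow> real"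
  assumes "f' \<in> borel_measurable borel" "\<And>x. x \<in> \<Omega> \<Longrightarrow> f x = f' x" "\<And>x. x \<notin> \<Omega> \<Longrightarrow> f' x = 0"
    "\<And>x. f' x \<ge> 0" "\<And>x. f' x \<le> B"
  shows "(\<integral>\<^sup>+x. ennreal (f' x) \<partial>lborel) = ennreal (LINT x|M. f x)"
proof -
  have "integrable lborel f'"
    by (rule integrable_lborel_bounded_support[OF assms(1) _ bounded_domain assms(3), where B=B])
      (use assms in auto)
  then have "(\<integral>\<^sup>+x. ennreal (f' x) \<partial>lborel) = ennreal (LINT x|lborel. f' x)"
    by (rule nn_integral_eq_integral) (use assms in auto)
  then show ?thesis using integral_M_eq[OF assms(1-3)] by simp
qed

text \<open>Gagliardo's inequality for \<open>U = u\<^sup>2\<close>.\<close>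

lemma sobolev_on_cone:
  fixes \<Omega> A :: "(real^'n) set"
  assumes dim: "CARD('n) \<in> {2, 3}" and A: "closed A" "cone_condition \<Omega> A"
  shows "\<exists>C\<ge>0. \<forall>\<K> q u. mesh \<Omega> \<K> \<longrightarrow> u \<in> mesh.S \<Omega> \<K> q \<longrightarrow>
    (LINT x|lebesgue_on \<Omega>. indicator A x * u x ^ 6)\<^sup>2 \<le>
    C * (LINT x|lebesgue_on \<Omega>. u x ^ 4 + \<bar>u x\<bar> ^ 3 * norm (mesh.grad \<K> u x)) ^ 3"
proof -
  obtain B where B: "independent B" "span B = UNIV" and
    cone: "\<forall>x\<in>A. \<forall>b\<in>B. \<forall>s. 0 < s \<and> s \<le> 1 \<longrightarrow> x + s *\<^sub>R b \<in> \<Omega>"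
    using A(2) unfolding cone_condition_def by (elim exE conjE)
  have "DIM(real^'n) \<in> {2, 3}" using dim by simp
  from gagliardo[OF this B] obtain c where c: "c < \<infinity>" and
    gag: "\<forall>U g. U \<in> borel_measurable borel \<longrightarrow> g \<in> borel_measurable borel \<longrightarrow> (\<forall>x. U x \<ge> 0) \<longrightarrow>
    (\<forall>u\<in>B. AE x in lborel. ennreal ((U x)\<^sup>2) \<le> (\<integral>\<^sup>+t. g (x + t *\<^sub>R u) \<partial>lborel)) \<longrightarrow>
    (AE x in lborel. ennreal ((U x)\<^sup>2) \<le> g x) \<longrightarrow>
    (\<integral>\<^sup>+x. ennreal (U x ^ 3) \<partial>lborel)\<^sup>2 \<le> c * (\<integral>\<^sup>+x. g x \<partial>lborel) ^ 3"
    by (elim exE conjE)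
  have "finite B" using B(1) by (rule independent_imp_finite)
  \<comment> \<open>One weight that serves all directions of the basis in
    \<open>fe_pointwise_bound\<close>.\<close>
  define m where "m = 1 + (\<Sum>b\<in>B. 4 * norm b)"
  have mb: "1 + 4 * norm b \<le> m" if "b \<in> B" for b
    unfolding m_def using member_le_sum[OF that, of "\<lambda>b. 4 * norm b"] \<open>finite B\<close> by auto
  have m1: "m \<ge> 1" unfolding m_def by (simp add: sum_nonneg)
  show ?thesis
  proof (intro exI[of _ "enn2real c * m ^ 3"] conjI allI impI)
    show "enn2real c * m ^ 3 \<ge> 0" using m1 by simp
    fix \<K> q u assume mesh: "mesh \<Omega> \<K>" and u: "u \<in> mesh.S \<Omega> \<K> q"
    interpret mesh \<Omega> \<K> q by fact
    define h where "h = (\<lambda>x. (ext u x) ^ 4 + \<bar>ext u x\<bar> ^ 3 * norm (grad u x))"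
    define g where "g = (\<lambda>x. ennreal (m * h x))"
    \<comment> \<open>Cut off to \<open>A\<close>, since only segments that start in
      \<open>A\<close> are known to stay in \<open>\<Omega>\<close>.\<close>
    define U where "U = (\<lambda>x. indicator A x * (ext u x)\<^sup>2)"
    have [measurable]: "ext u \<in> borel_measurable borel" by (rule measurable_ext[OF u])
    have [measurable]: "(\<lambda>x. norm (grad u x)) \<in> borel_measurable borel"
      by (intro measurable_compose[OF measurable_grad[OF u]] borel_measurable_continuous_onI continuous_intros)
    have [measurable]: "A \<in> sets borel" using A by auto
    have hm[measurable]: "h \<in> borel_measurable borel" unfolding h_def by measurable
    have gm: "g \<in> borel_measurable borel" unfolding g_def by measurable
    have Um: "U \<in> borel_measurable borel" unfolding U_def by measurable
    have h0: "h x \<ge> 0" for x unfolding h_def by auto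
    have U0: "\<forall>x. U x \<ge> 0" unfolding U_def by auto
    have U2: "(U x)\<^sup>2 \<le> h x" for x unfolding U_def h_def by (auto simp: indicator_def)
    have Ug: "AE x in lborel. ennreal ((U x)\<^sup>2) \<le> g x"
    proof (rule AE_I2)
      fix x
      have "(U x)\<^sup>2 \<le> m * h x" using U2[of x] h0[of x] m1 mult_right_mono[of 1 m "h x"] by simp
      then show "ennreal ((U x)\<^sup>2) \<le> g x" unfolding g_def by (rule ennreal_leI)
    qed
    have Ul: "\<forall>b\<in>B. AE x in lborel. ennreal ((U x)\<^sup>2) \<le> (\<integral>\<^sup>+t. g (x + t *\<^sub>R b) \<partial>lborel)"
    proof
      fix b assume b: "b \<in> B"
      show "AE x in lborel. ennreal ((U x)\<^sup>2) \<le> (\<integral>\<^sup>+t. g (x + t *\<^sub>R b) \<partial>lborel)"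
        using AE_line_notin_null_set[OF null_skeleton, of b]
      proof eventually_elim
        case (elim x)
        show ?case
        proof (cases "x \<in> A \<inter> \<Omega>")
          case True
          have seg: "x + s *\<^sub>R b \<in> \<Omega>" if "0 \<le> s" "s \<le> 1" for s
            using True cone b that by (cases "s = 0") auto
          have "ennreal ((U x)\<^sup>2) = ennreal ((ext u x) ^ 4)" using True by (simp add: U_def)
          also have "\<dots> \<le> (\<integral>\<^sup>+t. g (x + t *\<^sub>R b) \<partial>lborel)"
            unfolding g_def h_def by (rule fe_pointwise_bound[OF u seg elim mb[OF b]])
          finally show ?thesis .
        next
          case False
          then have "U x = 0" by (auto simp: U_def ext_def indicator_def)
          then show ?thesis by simp
        qed
      qed
    qed
    obtain L where L: "L \<ge> 0" "\<And>x. \<bar>ext u x\<bar> \<le> L" "\<And>x. norm (grad u x) \<le> L"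
      by (rule ext_grad_bounded[OF u], rule that)
    have pL: "\<bar>ext u x\<bar> ^ n \<le> L ^ n" for x n using L by (intro power_mono) auto
    have eU: "(\<integral>\<^sup>+x. ennreal (U x ^ 3) \<partial>lborel) = ennreal (LINT x|M. indicator A x * u x ^ 6)"
    proof (rule nn_integral_M_eq)
      show "(\<lambda>x. U x ^ 3) \<in> borel_measurable borel" using Um by measurable
      show "U x ^ 3 \<le> L ^ 6" for x using pL[of x 6] L(1) by (auto simp: U_def indicator_def)
    qed (auto simp: U_def ext_def indicator_def)
    have eg: "(\<integral>\<^sup>+x. g x \<partial>lborel) = ennreal (LINT x|M. m * (u x ^ 4 + \<bar>u x\<bar> ^ 3 * norm (grad u x)))"
      unfolding g_def
    proof (rule nn_integral_M_eq)
      show "(\<lambda>x. m * h x) \<in> borel_measurable borel" by measurable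
      show "m * h x \<le> m * (L ^ 4 + L ^ 3 * L)" for x
        unfolding h_def using pL[of x 4] pL[of x 3] L m1 by (intro mult_left_mono add_mono mult_mono) auto
    qed (use h0 m1 W_subset in \<open>auto simp: h_def ext_def grad_def indicator_def\<close>)
    define Y where "Y = (LINT x|M. u x ^ 4 + \<bar>u x\<bar> ^ 3 * norm (grad u x))"
    define X where "X = (LINT x|M. indicator A x * u x ^ 6)"
    have Y0: "Y \<ge> 0" unfolding Y_def by (rule integral_nonneg_AE) auto
    have X0: "X \<ge> 0" unfolding X_def by (rule integral_nonneg_AE) auto
    have "ennreal X ^ 2 \<le> c * ennreal (m * Y) ^ 3"
    proof -
      have "(\<integral>\<^sup>+x. ennreal (U x ^ 3) \<partial>lborel)\<^sup>2 \<le> c * (\<integral>\<^sup>+x. g x \<partial>lborel) ^ 3"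
        by (rule gag[rule_format]) (use Um gm U0 Ul Ug in simp_all)
      then show ?thesis unfolding eU eg by (simp add: X_def Y_def)
    qed
    also have "c = ennreal (enn2real c)" using c by simp
    finally have "ennreal X ^ 2 \<le> ennreal (enn2real c) * ennreal (m * Y) ^ 3" .
    moreover have "ennreal (m * Y) ^ 3 = ennreal ((m * Y) ^ 3)"
      using Y0 m1 by (intro ennreal_power) simp
    moreover have "ennreal X ^ 2 = ennreal (X\<^sup>2)" using X0 by (rule ennreal_power)
    ultimately have "ennreal (X\<^sup>2) \<le> ennreal (enn2real c * (m * Y) ^ 3)"
      using ennreal_mult''[of "(m * Y) ^ 3" "enn2real c"] Y0 m1 by simp
    then have "X\<^sup>2 \<le> enn2real c * (m * Y) ^ 3"
      using Y0 m1 by (subst (asm) ennreal_le_iff) auto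
    then show "(LINT x|M. indicator A x * u x ^ 6)\<^sup>2 \<le> enn2real c * m ^ 3 *
        (LINT x|M. u x ^ 4 + \<bar>u x\<bar> ^ 3 * norm (mesh.grad \<K> u x)) ^ 3"
      unfolding X_def Y_def by (simp add: power_mult_distrib mult.assoc)
  qed
qed

text \<open>With \<open>X\<close> the integral of \<open>u ^ 6\<close>, \<open>Y\<close> that of
  \<open>u ^ 4 + \<bar>u\<bar> ^ 3 * norm (grad u)\<close> and \<open>Z\<close> the squared H1 norm,
  the cones give \<open>X\<^sup>2 \<le> c\<^sup>2 * Y ^ 3\<close> and Cauchy-Schwarz gives
  \<open>Y\<^sup>2 \<le> X * (2 * Z)\<close>. Hence
  \<open>X ^ 4 \<le> 8 * c ^ 4 * X ^ 3 * Z ^ 3\<close>, and \<open>X ^ 3\<close> cancels because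
  \<open>X\<close> is finite.\<close>

lemma sobolev_inequality:
  fixes \<Omega> :: "(real^'n) set"
  assumes dim: "CARD('n) \<in> {2, 3}" and poly: "polyhedral_domain \<Omega>"
  shows "\<exists>C>0. \<forall>\<K> q u. mesh \<Omega> \<K> \<longrightarrow> u \<in> mesh.S \<Omega> \<K> q \<longrightarrow>
    (LINT x|lebesgue_on \<Omega>. u x ^ 6) \<le> C * (L2_inner \<Omega> u u + grad_form \<Omega> u u) ^ 3"
proof -
  obtain \<A> where A: "finite \<A>" "negligible (\<Omega> - \<Union>\<A>)" "\<And>A. A \<in> \<A> \<Longrightarrow> closed A"
    "\<And>A. A \<in> \<A> \<Longrightarrow> cone_condition \<Omega> A"
    by (rule polyhedral_domain_cone_cover[OF poly], rule that)
  have "\<forall>A\<in>\<A>. \<exists>C\<ge>0. \<forall>\<K> q u. mesh \<Omega> \<K> \<longrightarrow> u \<in> mesh.S \<Omega> \<K> q \<longrightarrow>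
    (LINT x|lebesgue_on \<Omega>. indicator A x * u x ^ 6)\<^sup>2 \<le>
    C * (LINT x|lebesgue_on \<Omega>. u x ^ 4 + \<bar>u x\<bar> ^ 3 * norm (mesh.grad \<K> u x)) ^ 3"
    by (intro ballI sobolev_on_cone[OF dim] A)
  from bchoice[OF this] obtain C where CC: "\<forall>A\<in>\<A>. 0 \<le> C A \<and> (\<forall>\<K> q u. mesh \<Omega> \<K> \<longrightarrow> u \<in> mesh.S \<Omega> \<K> q \<longrightarrow>
    (LINT x|lebesgue_on \<Omega>. indicator A x * u x ^ 6)\<^sup>2 \<le>
    C A * (LINT x|lebesgue_on \<Omega>. u x ^ 4 + \<bar>u x\<bar> ^ 3 * norm (mesh.grad \<K> u x)) ^ 3)" ..
  have C0: "\<And>A. A \<in> \<A> \<Longrightarrow> C A \<ge> 0" and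
    C: "\<And>A \<K> q u. A \<in> \<A> \<Longrightarrow> mesh \<Omega> \<K> \<Longrightarrow> u \<in> mesh.S \<Omega> \<K> q \<Longrightarrow>
    (LINT x|lebesgue_on \<Omega>. indicator A x * u x ^ 6)\<^sup>2 \<le>
    C A * (LINT x|lebesgue_on \<Omega>. u x ^ 4 + \<bar>u x\<bar> ^ 3 * norm (mesh.grad \<K> u x)) ^ 3"
    using CC by simp_all
  define c where "c = (\<Sum>A\<in>\<A>. sqrt (C A))"
  have c0: "c \<ge> 0" unfolding c_def by (intro sum_nonneg) (use C0 in auto)
  show ?thesis
  proof (intro exI[of _ "8 * c ^ 4 + 1"] conjI allI impI)
    show "8 * c ^ 4 + 1 > 0" using c0 by (simp add: add_nonneg_pos)
    fix \<K> q u assume mesh: "mesh \<Omega> \<K>" and u: "u \<in> mesh.S \<Omega> \<K> q"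
    interpret mesh \<Omega> \<K> q by fact
    define Y where "Y = (LINT x|M. u x ^ 4 + \<bar>u x\<bar> ^ 3 * norm (grad u x))"
    define X where "X = (LINT x|M. u x ^ 6)"
    define Z where "Z = L2_inner \<Omega> u u + grad_form \<Omega> u u"
    have b[simp]: "bounded_measurable M u" "bounded_measurable M (\<lambda>x. norm (grad u x))"
      using u by auto
    have Y0: "Y \<ge> 0" unfolding Y_def by (rule integral_nonneg_AE) auto
    have X0: "X \<ge> 0" unfolding X_def by (rule integral_nonneg_AE) auto
    have Z0: "Z \<ge> 0" unfolding Z_def L2_inner_def grad_form_fe[OF u u]
      by (intro add_nonneg_nonneg integral_nonneg_AE) auto
    have bi: "bounded_measurable M (\<lambda>x. indicator A x * u x ^ 6)" if "A \<in> \<A>" for A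
    proof -
      have "A \<in> sets borel" using A(3)[OF that] by auto
      then have "bounded_measurable M (indicator A)"
        by (intro bounded_measurableI[where B=1] measurable_M borel_measurable_indicator) (auto simp: indicator_def)
      then show ?thesis by auto
    qed
    have "X \<le> (LINT x|M. (\<Sum>A\<in>\<A>. indicator A x * u x ^ 6))"
      unfolding X_def
    proof (rule integral_mono_AE)
      have "AE x in lebesgue. x \<notin> (\<Omega> - \<Union>\<A>)"
        using A(2) unfolding negligible_iff_null_sets by (rule AE_not_in)
      then have "AE x in M. x \<in> (\<Union>\<A>)"
        by (subst AE_restrict_space_iff) (auto elim: eventually_mono)
      then show "AE x in M. u x ^ 6 \<le> (\<Sum>A\<in>\<A>. indicator A x * u x ^ 6)"
      proof eventually_elim
        case (elim x)
        then obtain A where "A \<in> \<A>" "x \<in> A" by auto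
        then have "u x ^ 6 = indicator A x * u x ^ 6" by simp
        also have "\<dots> \<le> (\<Sum>A\<in>\<A>. indicator A x * u x ^ 6)"
          by (rule member_le_sum[where f="\<lambda>A. indicator A x * u x ^ 6"])
            (use \<open>A \<in> \<A>\<close> A(1) in \<open>auto simp: zero_le_even_power\<close>)
        finally show ?case .
      qed
    qed (use bi in auto)
    also have "\<dots> = (\<Sum>A\<in>\<A>. LINT x|M. indicator A x * u x ^ 6)"
      by (rule Bochner_Integration.integral_sum) (use bi in auto)
    also have "\<dots> \<le> (\<Sum>A\<in>\<A>. sqrt (C A) * sqrt (Y ^ 3))"
    proof (rule sum_mono)
      fix A' assume "A' \<in> \<A>"
      from C[OF this mesh u] have "(LINT x|M. indicator A' x * u x ^ 6) \<le> sqrt (C A' * Y ^ 3)"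
        unfolding Y_def by (intro real_le_rsqrt) simp
      then show "(LINT x|M. indicator A' x * u x ^ 6) \<le> sqrt (C A') * sqrt (Y ^ 3)"
        by (simp add: real_sqrt_mult)
    qed
    also have "\<dots> = c * sqrt (Y ^ 3)" unfolding c_def by (simp add: sum_distrib_right)
    finally have "X\<^sup>2 \<le> (c * sqrt (Y ^ 3))\<^sup>2" using X0 by (rule power_mono)
    then have XY: "X\<^sup>2 \<le> c\<^sup>2 * Y ^ 3" using Y0 by (simp add: power_mult_distrib)
    have "Y = (LINT x|M. \<bar>u x\<bar> ^ 3 * (\<bar>u x\<bar> + norm (grad u x)))"
      unfolding Y_def by (simp add: distrib_left power4_eq_xxxx power3_eq_cube abs_mult[symmetric] mult.assoc)
    then have "Y\<^sup>2 \<le> (LINT x|M. (\<bar>u x\<bar> ^ 3)\<^sup>2) * (LINT x|M. (\<bar>u x\<bar> + norm (grad u x))\<^sup>2)"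
      using integral_Cauchy_Schwarz[of "\<lambda>x. \<bar>u x\<bar> ^ 3" "\<lambda>x. \<bar>u x\<bar> + norm (grad u x)"] by auto
    also have "(LINT x|M. (\<bar>u x\<bar> ^ 3)\<^sup>2) = X" by (simp add: X_def power_mult[symmetric])
    also have "(LINT x|M. (\<bar>u x\<bar> + norm (grad u x))\<^sup>2) \<le> (LINT x|M. 2 * ((u x * u x) + (grad u x \<bullet> grad u x)))"
    proof (rule integral_mono)
      fix x
      have "0 \<le> (\<bar>u x\<bar> - norm (grad u x))\<^sup>2" by simp
      then show "(\<bar>u x\<bar> + norm (grad u x))\<^sup>2 \<le> 2 * ((u x * u x) + (grad u x \<bullet> grad u x))"
        by (simp add: power2_eq_square algebra_simps power2_norm_eq_inner[symmetric] abs_mult_self_eq)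
    qed (use u in auto)
    also have "\<dots> = 2 * Z"
      unfolding Z_def L2_inner_def grad_form_fe[OF u u] using u by simp
    finally have YZ: "Y\<^sup>2 \<le> X * (2 * Z)" using X0 by (simp add: mult_left_mono)
    show "(LINT x|M. u x ^ 6) \<le> (8 * c ^ 4 + 1) * (L2_inner \<Omega> u u + grad_form \<Omega> u u) ^ 3"
    proof (cases "X = 0")
      case True
      then show ?thesis using Z0 c0 unfolding X_def[symmetric] Z_def[symmetric] by simp
    next
      case False
      then have Xp: "X > 0" using X0 by simp
      have "X ^ 3 * X = (X\<^sup>2)\<^sup>2" by (simp add: power2_eq_square power3_eq_cube)
      also have "\<dots> \<le> (c\<^sup>2 * Y ^ 3)\<^sup>2" by (rule power_mono[OF XY]) simp
      also have "\<dots> = c ^ 4 * (Y\<^sup>2) ^ 3" by (simp add: power_mult_distrib power_mult[symmetric])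
      also have "\<dots> \<le> c ^ 4 * (X * (2 * Z)) ^ 3"
        using c0 by (intro mult_left_mono power_mono YZ) auto
      also have "\<dots> = X ^ 3 * (8 * c ^ 4 * Z ^ 3)" by (simp add: power_mult_distrib)
      finally have "X \<le> 8 * c ^ 4 * Z ^ 3" using Xp by simp
      also have "\<dots> \<le> (8 * c ^ 4 + 1) * Z ^ 3" using Z0 by (simp add: distrib_right)
      finally show ?thesis unfolding X_def Z_def .
    qed
  qed
qed

section \<open>Inner products and the nonlinearity\<close>

text \<open>A crude Young inequality, by comparing both sides with the larger modulus. After scaling
  it replaces Hoelder's inequality with exponents 3/2 and 3.\<close>

lemma pow4_pow2_le: "(a::real) ^ 4 * b\<^sup>2 \<le> a ^ 6 + b ^ 6"
proof (cases "\<bar>a\<bar> \<le> \<bar>b\<bar>")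
  case True
  then have "\<bar>a\<bar> ^ 4 * b\<^sup>2 \<le> \<bar>b\<bar> ^ 4 * b\<^sup>2" by (intro mult_right_mono power_mono) auto
  also have "\<dots> = b ^ 6" by (simp add: power_add[symmetric])
  finally have "a ^ 4 * b\<^sup>2 \<le> b ^ 6" by simp
  moreover have "0 \<le> a ^ 6" by simp
  ultimately show ?thesis by linarith
next
  case False
  then have "a ^ 4 * \<bar>b\<bar>\<^sup>2 \<le> a ^ 4 * \<bar>a\<bar>\<^sup>2" by (intro mult_left_mono power_mono) auto
  also have "\<dots> = a ^ 6" by (simp add: power_add[symmetric])
  finally have "a ^ 4 * b\<^sup>2 \<le> a ^ 6" by simp
  moreover have "0 \<le> b ^ 6" by simp
  ultimately show ?thesis by linarith
qed

text \<open>With \<open>m\<close> the larger modulus of \<open>a\<close> and \<open>b\<close>, the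
  two factors of \<open>chi\<close> are at most \<open>m ^ 2\<close> and \<open>m\<close>.\<close>

lemma chi_power2_le: "(chi a b)\<^sup>2 \<le> a ^ 6 + b ^ 6"
proof -
  have *: "(chi a b)\<^sup>2 \<le> b ^ 6" if "\<bar>a\<bar> \<le> \<bar>b\<bar>" for a b
  proof -
    have "a\<^sup>2 \<le> b\<^sup>2" using that by (simp add: abs_le_square_iff)
    then have "\<bar>1/2 * (a\<^sup>2 + b\<^sup>2)\<bar> \<le> b\<^sup>2" by simp
    moreover have "\<bar>1/2 * (a + b)\<bar> \<le> \<bar>b\<bar>"
      using that abs_triangle_ineq[of a b] by (simp add: abs_mult)
    ultimately have "\<bar>chi a b\<bar> \<le> b\<^sup>2 * \<bar>b\<bar>"
      unfolding chi_def abs_mult[of "1/2 * (a\<^sup>2 + b\<^sup>2)"] by (intro mult_mono) auto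
    then have "\<bar>chi a b\<bar>\<^sup>2 \<le> (b\<^sup>2 * \<bar>b\<bar>)\<^sup>2" by (intro power_mono) auto
    also have "\<dots> = b ^ 6" by (simp add: power_mult_distrib power_mult[symmetric] power_add[symmetric])
    finally show ?thesis by simp
  qed
  have sym: "chi a b = chi b a" by (simp add: chi_def add.commute)
  show ?thesis
  proof (cases "\<bar>a\<bar> \<le> \<bar>b\<bar>")
    case True
    moreover have "0 \<le> a ^ 6" by simp
    ultimately show ?thesis using *[of a b] by linarith
  next
    case False
    then have "(chi a b)\<^sup>2 \<le> a ^ 6" using *[of b a] sym by simp
    moreover have "0 \<le> b ^ 6" by simp
    ultimately show ?thesis by linarith
  qed
qed

text \<open>\<open>chi\<close> is symmetric, so the difference vanishes for \<open>a = c\<close>.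
  The factor \<open>a - c\<close> is an increment over two time steps and will produce difference
  quotients.\<close>

lemma chi_diff: "chi a b - chi b c = (a - c) * (1/4 * (a\<^sup>2 + a * c + c\<^sup>2 + b * (a + c) + b\<^sup>2))"
  by (simp add: chi_def power2_eq_square field_simps)

text \<open>Mixed products are split by \<open>2 * a * b \<le> a\<^sup>2 + b\<^sup>2\<close>, which
  bounds the factor by \<open>a\<^sup>2 + b\<^sup>2 + c\<^sup>2\<close>; the 3 comes from squaring a
  sum of three terms.\<close>

lemma chi_diff_factor_le:
  "(1/4 * (a\<^sup>2 + a * c + c\<^sup>2 + b * (a + c) + b\<^sup>2))\<^sup>2 \<le> 3 * (a ^ 4 + b ^ 4 + (c::real) ^ 4)"
proof -
  have "a * c \<le> (a\<^sup>2 + c\<^sup>2) / 2" "- (a * c) \<le> (a\<^sup>2 + c\<^sup>2) / 2" "a * b \<le> (a\<^sup>2 + b\<^sup>2) / 2" "- (a * b) \<le> (a\<^sup>2 + b\<^sup>2) / 2"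
    "b * c \<le> (b\<^sup>2 + c\<^sup>2) / 2" "- (b * c) \<le> (b\<^sup>2 + c\<^sup>2) / 2"
    using sum_squares_bound[of a c] sum_squares_bound[of a "-c"] sum_squares_bound[of a b]
      sum_squares_bound[of a "-b"] sum_squares_bound[of b c] sum_squares_bound[of b "-c"] by auto
  then have "\<bar>1/4 * (a\<^sup>2 + a * c + c\<^sup>2 + b * (a + c) + b\<^sup>2)\<bar> \<le> a\<^sup>2 + b\<^sup>2 + c\<^sup>2"
    using zero_le_power2[of a] zero_le_power2[of b] zero_le_power2[of c]
    by (simp add: abs_le_iff distrib_left mult.commute[of b a])
  then have "\<bar>1/4 * (a\<^sup>2 + a * c + c\<^sup>2 + b * (a + c) + b\<^sup>2)\<bar>\<^sup>2 \<le> (a\<^sup>2 + b\<^sup>2 + c\<^sup>2)\<^sup>2"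
    by (intro power_mono) auto
  also have "\<dots> \<le> 3 * ((a\<^sup>2)\<^sup>2 + (b\<^sup>2)\<^sup>2 + (c\<^sup>2)\<^sup>2)"
    using sum_squares_bound[of "a\<^sup>2" "b\<^sup>2"] sum_squares_bound[of "a\<^sup>2" "c\<^sup>2"] sum_squares_bound[of "b\<^sup>2" "c\<^sup>2"]
    by (simp add: power2_sum algebra_simps)
  finally show ?thesis unfolding power2_abs by (simp add: power_mult[symmetric])
qed

section \<open>Calculus of the two bilinear forms, the double-well integral and a weighted L2
  bound\<close>

context mesh
begin

abbreviation ip :: "(real^'n \<Rightarrow> real) \<Rightarrow> (real^'n \<Rightarrow> real) \<Rightarrow> real" where "ip \<equiv> L2_inner \<Omega>"
abbreviation gf :: "(real^'n \<Rightarrow> real) \<Rightarrow> (real^'n \<Rightarrow> real) \<Rightarrow> real" where "gf \<equiv> grad_form \<Omega>"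
abbreviation bm :: "(real^'n \<Rightarrow> real) \<Rightarrow> bool" where "bm \<equiv> bounded_measurable M"

lemma bm_chi [intro, simp]: "bm f \<Longrightarrow> bm g \<Longrightarrow> bm (\<lambda>x. chi (f x) (g x))"
  unfolding chi_def by auto

lemma ip_commute: "ip f g = ip g f"
  by (simp add: L2_inner_def mult.commute)

lemma ip_linear:
  assumes "bm f" "bm g" "bm h"
  shows "ip (\<lambda>x. a * f x + b * g x) h = a * ip f h + b * ip g h"
proof -
  have "ip (\<lambda>x. a * f x + b * g x) h = (LINT x|M. a * (f x * h x) + b * (g x * h x))"
    unfolding L2_inner_def by (rule Bochner_Integration.integral_cong) (auto simp: algebra_simps)
  also have "\<dots> = a * ip f h + b * ip g h"
    unfolding L2_inner_def using assms by simp
  finally show ?thesis .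
qed

lemma ip_diff:
  assumes "bm f" "bm g" "bm h"
  shows "ip (\<lambda>x. f x - g x) h = ip f h - ip g h"
  using ip_linear[OF assms, of 1 "-1"] by simp

lemma ip_nonneg [simp]: "ip f f \<ge> 0"
  unfolding L2_inner_def by (rule integral_nonneg_AE) auto

lemma ip_young:
  assumes "bm f" "bm g" "s > 0"
  shows "\<bar>ip f g\<bar> \<le> s * ip f f + 1 / (4 * s) * ip g g"
proof -
  have p: "\<bar>y * z\<bar> \<le> s * (y * y) + 1 / (4 * s) * (z * z)" for y z :: real
  proof -
    have "0 \<le> (2 * s * \<bar>y\<bar> - \<bar>z\<bar>)\<^sup>2 / (4 * s)" using assms by simp
    also have "\<dots> = s * (y * y) + 1 / (4 * s) * (z * z) - \<bar>y * z\<bar>"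
      using assms by (simp add: power2_eq_square field_simps abs_mult)
    finally show ?thesis by simp
  qed
  have "\<bar>ip f g\<bar> \<le> (LINT x|M. \<bar>f x * g x\<bar>)" unfolding L2_inner_def by (rule integral_abs_bound)
  also have "\<dots> \<le> (LINT x|M. s * (f x * f x) + 1 / (4 * s) * (g x * g x))"
    by (rule integral_mono) (use assms p in auto)
  also have "\<dots> = s * ip f f + 1 / (4 * s) * ip g g"
    unfolding L2_inner_def using assms by simp
  finally show ?thesis .
qed

lemma fe_diff: "u \<in> S \<Longrightarrow> v \<in> S \<Longrightarrow> (\<lambda>x. u x - v x) \<in> S"
  using fe_linear(1)[of u v 1 "-1"] by simp

lemma gf_commute: "gf u v = gf v u"
  by (simp add: grad_form_def inner_commute)

lemma gf_linear:
  assumes "u \<in> S" "v \<in> S" "w \<in> S"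
  shows "gf (\<lambda>x. a * u x + b * v x) w = a * gf u w + b * gf v w"
proof -
  have "gf (\<lambda>x. a * u x + b * v x) w = (LINT x|M. a * (grad u x \<bullet> grad w x) + b * (grad v x \<bullet> grad w x))"
    unfolding grad_form_fe[OF fe_linear(1)[OF assms(1,2)] assms(3)] fe_linear(2)[OF assms(1,2)]
    by (simp add: inner_add_left)
  also have "\<dots> = a * gf u w + b * gf v w"
    using assms by (simp add: grad_form_fe)
  finally show ?thesis .
qed

lemma gf_diff:
  assumes "u \<in> S" "v \<in> S" "w \<in> S"
  shows "gf (\<lambda>x. u x - v x) w = gf u w - gf v w"
  using gf_linear[OF assms, of 1 "-1"] by simp

lemma gf_nonneg [simp]: "gf u u \<ge> 0"
  unfolding grad_form_def by (rule integral_nonneg_AE) auto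

text \<open>Expansion of \<open>gf w w \<ge> 0\<close> for \<open>w = 2 * s * u + t * v\<close> with
  \<open>t = 1\<close> and \<open>t = -1\<close>, divided by \<open>4 * s\<close>.\<close>

lemma gf_young:
  assumes u: "u \<in> S" and v: "v \<in> S" and s: "s > 0"
  shows "\<bar>gf u v\<bar> \<le> s * gf u u + 1 / (4 * s) * gf v v"
proof -
  have *: "0 \<le> s * gf u u + 1 / (4 * s) * gf v v + t * gf u v" if "t\<^sup>2 = 1" for t
  proof -
    let ?w = "\<lambda>x. (2 * s) * u x + t * v x"
    have w: "?w \<in> S" using fe_linear(1)[OF u v] .
    have "0 \<le> gf ?w ?w / (4 * s)" using s by simp
    also have "gf ?w ?w = 2 * s * (2 * s * gf u u + t * gf u v) + t * (2 * s * gf u v + t * gf v v)"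
      unfolding gf_linear[OF u v w] gf_commute[of u ?w] gf_commute[of v ?w] gf_linear[OF u v u] gf_linear[OF u v v]
        gf_commute[of v u] by simp
    also have "\<dots> / (4 * s) = s * gf u u + (t\<^sup>2) / (4 * s) * gf v v + t * gf u v"
      using s by (simp add: field_simps power2_eq_square)
    finally show ?thesis unfolding that .
  qed
  show ?thesis using *[of 1] *[of "-1"] by (simp add: abs_le_iff)
qed

lemma ip_quad:
  assumes "bm f" "bm g"
  shows "ip (\<lambda>x. a * f x + b * g x) (\<lambda>x. a * f x + b * g x) = a\<^sup>2 * ip f f + 2 * a * b * ip f g + b\<^sup>2 * ip g g"
proof -
  have b: "bm (\<lambda>x. a * f x + b * g x)" using assms by auto
  show ?thesis
    unfolding ip_linear[OF assms b] ip_commute[of f "\<lambda>x. a * f x + b * g x"] ip_commute[of g "\<lambda>x. a * f x + b * g x"]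
      ip_linear[OF assms assms(1)] ip_linear[OF assms assms(2)] ip_commute[of g f]
    by (simp add: power2_eq_square algebra_simps)
qed

lemma gf_quad:
  assumes "u \<in> S" "v \<in> S"
  shows "gf (\<lambda>x. a * u x + b * v x) (\<lambda>x. a * u x + b * v x) = a\<^sup>2 * gf u u + 2 * a * b * gf u v + b\<^sup>2 * gf v v"
proof -
  have b: "(\<lambda>x. a * u x + b * v x) \<in> S" using fe_linear(1)[OF assms] .
  show ?thesis
    unfolding gf_linear[OF assms b] gf_commute[of u "\<lambda>x. a * u x + b * v x"] gf_commute[of v "\<lambda>x. a * u x + b * v x"]
      gf_linear[OF assms assms(1)] gf_linear[OF assms assms(2)] gf_commute[of v u]
    by (simp add: power2_eq_square algebra_simps)
qed

definition dw :: "(real^'n \<Rightarrow> real) \<Rightarrow> real" where "dw u = (LINT x|M. ((u x)\<^sup>2 - 1)\<^sup>2)"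

lemma dw_nonneg [simp]: "dw u \<ge> 0"
  unfolding dw_def by (rule integral_nonneg_AE) auto

lemma energy_dw: "u \<in> S \<Longrightarrow> energy \<Omega> \<epsilon> u = 1 / (4 * \<epsilon>) * dw u + \<epsilon> / 2 * gf u u"
  unfolding dw_def by (rule energy_fe)

text \<open>The convex splitting: \<open>chi u v * (u - v)\<close> is exactly a quarter of
  \<open>u ^ 4 - v ^ 4\<close>, and the explicit treatment of the concave part leaves the square of
  the increment with a good sign.\<close>

lemma chi_dw_identity:
  assumes "bm u" "bm v"
  shows "ip (\<lambda>x. chi (u x) (v x)) (\<lambda>x. u x - v x) - ip v (\<lambda>x. u x - v x)
    = 1/4 * dw u - 1/4 * dw v + 1/2 * ip (\<lambda>x. u x - v x) (\<lambda>x. u x - v x)"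
proof -
  have "ip (\<lambda>x. chi (u x) (v x)) (\<lambda>x. u x - v x) - ip v (\<lambda>x. u x - v x)
     = (LINT x|M. chi (u x) (v x) * (u x - v x) - v x * (u x - v x))"
    unfolding L2_inner_def by (rule Bochner_Integration.integral_diff[symmetric]) (use assms in auto)
  also have "\<dots> = (LINT x|M. 1/4 * ((u x)\<^sup>2 - 1)\<^sup>2 - 1/4 * ((v x)\<^sup>2 - 1)\<^sup>2 + 1/2 * ((u x - v x) * (u x - v x)))"
    by (rule Bochner_Integration.integral_cong) (auto simp: chi_def power2_eq_square field_simps)
  also have "\<dots> = (LINT x|M. 1/4 * ((u x)\<^sup>2 - 1)\<^sup>2 - 1/4 * ((v x)\<^sup>2 - 1)\<^sup>2) + (LINT x|M. 1/2 * ((u x - v x) * (u x - v x)))"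
    by (rule Bochner_Integration.integral_add)
      (use assms in \<open>auto intro!: integrable_bounded_measurable bounded_measurable_diff bounded_measurable_mult\<close>)
  also have "(LINT x|M. 1/4 * ((u x)\<^sup>2 - 1)\<^sup>2 - 1/4 * ((v x)\<^sup>2 - 1)\<^sup>2)
      = (LINT x|M. 1/4 * ((u x)\<^sup>2 - 1)\<^sup>2) - (LINT x|M. 1/4 * ((v x)\<^sup>2 - 1)\<^sup>2)"
    by (rule Bochner_Integration.integral_diff)
      (use assms in \<open>auto intro!: integrable_bounded_measurable bounded_measurable_diff bounded_measurable_mult\<close>)
  finally show ?thesis unfolding dw_def L2_inner_def by simp
qed

lemma ip_le_dw:
  assumes "bm u"
  shows "ip u u \<le> 2 * measure M \<Omega> + dw u"
proof -
  have "ip u u \<le> (LINT x|M. 2 + ((u x)\<^sup>2 - 1)\<^sup>2)"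
    unfolding L2_inner_def
  proof (rule integral_mono)
    fix x
    \<comment> \<open>Completing the square in \<open>(u x)\<^sup>2\<close> at its minimum
      3/2.\<close>
    have "0 \<le> ((u x)\<^sup>2 - 1 - 1/2)\<^sup>2" by simp
    then show "u x * u x \<le> 2 + ((u x)\<^sup>2 - 1)\<^sup>2" by (simp add: power2_eq_square algebra_simps)
  qed (use assms in \<open>auto intro!: integrable_bounded_measurable\<close>)
  also have "\<dots> = 2 * measure M \<Omega> + dw u"
    unfolding dw_def using assms by (subst Bochner_Integration.integral_add) (auto simp: mult.commute)
  finally show ?thesis .
qed

text \<open>\<open>pow4_pow2_le\<close> is applied to \<open>u\<close> and
  \<open>\<psi> / sqrt s\<close>. The best \<open>s\<close> is the squared H1 norm \<open>H\<close>
  of \<open>\<psi>\<close>, which may be 0; so the bound is shown for all positive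
  \<open>s \<ge> H\<close>, and \<open>s\<close> then tends to \<open>H\<close>.\<close>

lemma weighted_sobolev:
  assumes u: "u \<in> S" and \<psi>: "\<psi> \<in> S" and Cs: "Cs \<ge> 0"
    and sob: "\<And>u. u \<in> S \<Longrightarrow> (LINT x|M. u x ^ 6) \<le> Cs * (ip u u + gf u u) ^ 3"
    and K: "(LINT x|M. u x ^ 6) \<le> K"
  shows "(LINT x|M. u x ^ 4 * (\<psi> x)\<^sup>2) \<le> (K + Cs) * (ip \<psi> \<psi> + gf \<psi> \<psi>)"
proof -
  define H where "H = ip \<psi> \<psi> + gf \<psi> \<psi>"
  have H0: "H \<ge> 0" by (simp add: H_def)
  have "(LINT x|M. u x ^ 6) \<ge> 0" by (rule integral_nonneg_AE) auto
  then have K0: "K \<ge> 0" using K by linarith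
  have b: "bm u" "bm \<psi>" using u \<psi> by auto
  have *: "(LINT x|M. u x ^ 4 * (\<psi> x)\<^sup>2) \<le> (K + Cs) * s" if s: "s > 0" "s \<ge> H" for s
  proof -
    have "(LINT x|M. u x ^ 4 * (\<psi> x)\<^sup>2) \<le> (LINT x|M. s * (u x ^ 6) + 1 / s\<^sup>2 * \<psi> x ^ 6)"
    proof (rule integral_mono)
      fix x
      have "u x ^ 4 * (\<psi> x / sqrt s)\<^sup>2 \<le> u x ^ 6 + (\<psi> x / sqrt s) ^ 6" by (rule pow4_pow2_le)
      moreover have "sqrt s ^ 6 = s ^ 3"
      proof -
        have "sqrt s ^ 6 = ((sqrt s)\<^sup>2) ^ 3" by (simp add: power_mult[symmetric])
        then show ?thesis using s by simp
      qed
      ultimately have "u x ^ 4 * ((\<psi> x)\<^sup>2 / s) \<le> u x ^ 6 + \<psi> x ^ 6 / s ^ 3"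
        using s by (simp add: power_divide)
      then have "s * (u x ^ 4 * ((\<psi> x)\<^sup>2 / s)) \<le> s * (u x ^ 6 + \<psi> x ^ 6 / s ^ 3)"
        using s by (intro mult_left_mono) auto
      then show "u x ^ 4 * (\<psi> x)\<^sup>2 \<le> s * (u x ^ 6) + 1 / s\<^sup>2 * \<psi> x ^ 6"
        using s by (simp add: distrib_left power3_eq_cube power2_eq_square)
    qed (use b in auto)
    also have "\<dots> = s * (LINT x|M. u x ^ 6) + 1 / s\<^sup>2 * (LINT x|M. \<psi> x ^ 6)"
      using b by simp
    also have "\<dots> \<le> s * K + 1 / s\<^sup>2 * (Cs * s ^ 3)"
    proof (intro add_mono mult_left_mono K)
      have "(LINT x|M. \<psi> x ^ 6) \<le> Cs * H ^ 3" using sob[OF \<psi>] by (simp add: H_def)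
      also have "\<dots> \<le> Cs * s ^ 3" using s H0 Cs by (intro mult_left_mono power_mono) auto
      finally show "(LINT x|M. \<psi> x ^ 6) \<le> Cs * s ^ 3" .
    qed (use s in auto)
    also have "\<dots> = (K + Cs) * s" using s by (simp add: power3_eq_cube power2_eq_square algebra_simps)
    finally show ?thesis .
  qed
  show ?thesis
  proof (rule field_le_epsilon)
    fix e :: real assume e: "e > 0"
    define \<delta> where "\<delta> = e / (K + Cs + 1)"
    have "\<delta> > 0" using e K0 Cs by (simp add: \<delta>_def)
    have "(K + Cs) * (H + \<delta>) = (K + Cs) * H + (K + Cs) * \<delta>" by (rule distrib_left)
    also have "(K + Cs) * \<delta> \<le> (K + Cs + 1) * \<delta>" using \<open>\<delta> > 0\<close> by (intro mult_right_mono) auto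
    also have "\<dots> = e" using K0 Cs by (simp add: \<delta>_def)
    finally show "(LINT x|M. u x ^ 4 * (\<psi> x)\<^sup>2) \<le> (K + Cs) * (ip \<psi> \<psi> + gf \<psi> \<psi>) + e"
      using *[of "H + \<delta>"] \<open>\<delta> > 0\<close> H0 unfolding H_def[symmetric] by linarith
  qed
qed

end

section \<open>Energy law\<close>

text \<open>To be read with \<open>A\<close> the squared L2 norms of the potentials,
  \<open>B\<close> those of their increments, \<open>x\<close> the terms of the sum of squared
  difference quotients, and \<open>g\<close> the squared gradient norms of the potentials. Since the
  weighted sum of \<open>g\<close> is bounded in advance, adding up the recursion suffices, and the
  time length enters linearly through the constant 1 in the remainder.\<close>

lemma discrete_summation:
  fixes A B x g :: "nat \<Rightarrow> real"
  assumes nonneg: "\<And>m. A m \<ge> 0" "\<And>m. B m \<ge> 0" "\<And>m. x m \<ge> 0" "\<And>m. g m \<ge> 0"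
    and \<tau>: "\<tau> > 0" and K: "K \<ge> 0" and N: "N \<ge> 1"
    and 0: "A 0 \<le> K" "x 0 \<le> K"
    and sum_g: "\<tau> * (\<Sum>j<N. g j) \<le> K"
    and 1: "1 < N \<Longrightarrow> 3/8 * A 1 + 1/8 * B 1 + 1/3 * x 1 \<le> K + K * \<tau> * (1 + g 1 + g 0)"
    and 2: "\<And>m. Suc (Suc m) < N \<Longrightarrow>
      1/2 * (A (Suc (Suc m)) - A (Suc m)) + 1/8 * (B (Suc (Suc m)) - B (Suc m)) + 1/3 * x (Suc (Suc m))
      \<le> 1/24 * x (Suc m) + 1/6 * x m + K * \<tau> * (1 + g (Suc (Suc m)) + g m)"
  shows "(\<Sum>j<N. x j) \<le> 56 * (K + K\<^sup>2) * (\<tau> * N + 1)"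
    and "\<And>m. m < N \<Longrightarrow> A m \<le> 56 * (K + K\<^sup>2) * (\<tau> * N + 1)"
proof -
  define R where "R = 4 * (K + K\<^sup>2) * (\<tau> * N + 1)"
  have TN: "\<tau> * N \<ge> 0" using \<tau> by simp
  have KR: "K \<le> R"
  proof -
    have "K * 1 \<le> (4 * (K + K\<^sup>2)) * (\<tau> * N + 1)" using K TN by (intro mult_mono) auto
    then show ?thesis by (simp add: R_def)
  qed
  \<comment> \<open>\<open>1/24 + 1/6 = 5/24 < 1/3\<close>: storing these fractions of \<open>x\<close> in \<open>\<Phi>\<close> absorbs the right-hand side of
    the recursion and leaves \<open>1/8 * x\<close>\<close>
  define \<Phi> where "\<Phi> = (\<lambda>m. 1/2 * A (Suc m) + 1/8 * B (Suc m) + 5/24 * x (Suc m) + 1/6 * x m)"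
  have step: "\<Phi> m + 1/8 * (\<Sum>j<m. x (Suc (Suc j))) \<le> \<Phi> 0 + K * \<tau> * (\<Sum>j<m. 1 + g (Suc (Suc j)) + g j)"
    if "Suc m < N" for m
    using that
  proof (induction m)
    case (Suc m)
    then have "\<Phi> m + 1/8 * (\<Sum>j<m. x (Suc (Suc j))) \<le> \<Phi> 0 + K * \<tau> * (\<Sum>j<m. 1 + g (Suc (Suc j)) + g j)" by simp
    moreover have "\<Phi> (Suc m) + 1/8 * x (Suc (Suc m)) \<le> \<Phi> m + K * \<tau> * (1 + g (Suc (Suc m)) + g m)"
      using 2[OF Suc.prems] unfolding \<Phi>_def by argo
    ultimately show ?case by (simp add: distrib_left)
  qed simp
  have shift: "(\<Sum>j<m. g (Suc (Suc j))) \<le> (\<Sum>j<Suc (Suc m). g j)" for m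
    using nonneg(4)[of 0] nonneg(4)[of 1] by (induction m) auto
  have main: "\<Phi> m + 1/8 * (\<Sum>j<m. x (Suc (Suc j))) \<le> R" if m: "Suc m < N" for m
  proof -
    have le: "(\<Sum>j<k. g j) \<le> (\<Sum>j<N. g j)" if "k \<le> N" for k
      using that nonneg(4) by (intro sum_mono2) auto
    have "(\<Sum>j<m. 1 + g (Suc (Suc j)) + g j) = m + (\<Sum>j<m. g (Suc (Suc j))) + (\<Sum>j<m. g j)"
      by (simp add: sum.distrib)
    also have "\<dots> \<le> N + (\<Sum>j<N. g j) + (\<Sum>j<N. g j)"
      using shift[of m] le[of "Suc (Suc m)"] le[of m] m by simp
    finally have "\<tau> * (\<Sum>j<m. 1 + g (Suc (Suc j)) + g j) \<le> \<tau> * (N + (\<Sum>j<N. g j) + (\<Sum>j<N. g j))"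
      using \<tau> by (intro mult_left_mono) auto
    also have "\<dots> \<le> \<tau> * N + 2 * K" using sum_g by (simp add: distrib_left)
    finally have s: "K * (\<tau> * (\<Sum>j<m. 1 + g (Suc (Suc j)) + g j)) \<le> K * (\<tau> * N + 2 * K)"
      using K by (rule mult_left_mono)
    have "1 + g 1 + g 0 \<le> N + (\<Sum>j<N. g j)"
      using le[of "Suc (Suc 0)"] m by (simp add: add.commute)
    then have "\<tau> * (1 + g 1 + g 0) \<le> \<tau> * (N + (\<Sum>j<N. g j))" using \<tau> by (intro mult_left_mono) auto
    also have "\<dots> \<le> \<tau> * N + K" using sum_g by (simp add: distrib_left)
    finally have "K * (\<tau> * (1 + g 1 + g 0)) \<le> K * (\<tau> * N + K)" using K by (rule mult_left_mono)
    moreover have "3/8 * A 1 + 1/8 * B 1 + 1/3 * x 1 \<le> K + K * (\<tau> * (1 + g 1 + g 0))"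
      using 1 m by (simp add: mult.assoc)
    ultimately have "3/8 * A 1 + 1/8 * B 1 + 1/3 * x 1 \<le> K + K * (\<tau> * N + K)" by linarith
    \<comment> \<open>Twice the start hypothesis dominates the part of \<open>\<Phi> 0\<close> at
      level 1, since \<open>2 * 3/8 \<ge> 1/2\<close>; the additional \<open>K\<close> pays for
      \<open>x 0\<close>.\<close>
    then have "2 * (3/8 * A 1 + 1/8 * B 1 + 1/3 * x 1) + K \<le> 2 * (K + K * (\<tau> * N + K)) + K" by simp
    moreover have "\<Phi> 0 \<le> 2 * (3/8 * A 1 + 1/8 * B 1 + 1/3 * x 1) + K"
      using 0 K nonneg(1)[of 1] nonneg(2)[of 1] nonneg(3)[of 1] unfolding \<Phi>_def by simp
    ultimately have "\<Phi> 0 \<le> 2 * (K + K * (\<tau> * N + K)) + K" by (rule order_trans[rotated])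
    then have "\<Phi> m + 1/8 * (\<Sum>j<m. x (Suc (Suc j))) \<le> 2 * (K + K * (\<tau> * N + K)) + K + K * (\<tau> * N + 2 * K)"
      using step[OF m] s by (simp add: mult.assoc)
    also have "\<dots> = 3 * K + 4 * K\<^sup>2 + 3 * (K * (\<tau> * N))" by (simp add: power2_eq_square algebra_simps)
    also have "\<dots> \<le> 4 * K + 4 * K\<^sup>2 + 4 * (K * (\<tau> * N)) + 4 * (K\<^sup>2 * (\<tau> * N))" using K TN by simp
    also have "\<dots> = R" by (simp add: R_def algebra_simps)
    finally show ?thesis .
  qed
  have sx: "(\<Sum>j<m. x (Suc (Suc j))) \<ge> 0" for m using nonneg(3) by (intro sum_nonneg) auto
  \<comment> \<open>14 rounds up \<open>1 + 24/5 + 8\<close>, the contributions of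
    \<open>x 0\<close>, of \<open>x 1\<close> (from the 5/24 in \<open>\<Phi> 0\<close>) and of the
    remaining terms (from the factor 1/8). With the 4 in \<open>R\<close> this gives the 56 of the
    claim.\<close>
  have "(\<Sum>j<N. x j) \<le> 14 * R"
  proof (cases "N = 1")
    case True
    then show ?thesis using 0(2) KR K by simp
  next
    case False
    then obtain m where m: "N = Suc (Suc m)" using N by (metis One_nat_def Suc_le_D not_less_eq_eq le_antisym not0_implies_Suc)
    have "(\<Sum>j<N. x j) = x 0 + (x 1 + (\<Sum>j<m. x (Suc (Suc j))))"
      unfolding m sum.lessThan_Suc_shift by simp
    moreover have "\<Phi> m + 1/8 * (\<Sum>j<m. x (Suc (Suc j))) \<le> R" "\<Phi> 0 \<le> R"
      using main[of m] main[of 0] m by auto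
    moreover have "\<Phi> m \<ge> 0" "\<Phi> 0 \<ge> 5/24 * x 1"
      unfolding \<Phi>_def using nonneg by (simp_all add: add_nonneg_nonneg)
    ultimately show ?thesis using KR 0(2) K by linarith
  qed
  then show "(\<Sum>j<N. x j) \<le> 56 * (K + K\<^sup>2) * (\<tau> * N + 1)" by (simp add: R_def algebra_simps)
  have "A m \<le> 14 * R" if "m < N" for m
  proof (cases m)
    case 0
    then show ?thesis using \<open>A 0 \<le> K\<close> KR K by simp
  next
    case (Suc k)
    have "1/2 * A m \<le> \<Phi> k" unfolding \<Phi>_def Suc using nonneg by (simp add: add_nonneg_nonneg)
    then show ?thesis using main[of k] sx[of k] that Suc KR K by auto
  qed
  then show "\<And>m. m < N \<Longrightarrow> A m \<le> 56 * (K + K\<^sup>2) * (\<tau> * N + 1)" by (simp add: R_def algebra_simps)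
qed

context mesh
begin

text \<open>The weight is fixed so that four such terms cost half of \<open>ip g g\<close>.\<close>

lemma ip_scaled_young:
  assumes "bm f" "bm g"
  shows "c * ip f g \<le> 2 * c\<^sup>2 * ip f f + 1/8 * ip g g"
proof (cases "c = 0")
  case False
  have "c * ip f g \<le> \<bar>c\<bar> * \<bar>ip f g\<bar>" by (metis abs_ge_self abs_mult)
  also have "\<dots> \<le> \<bar>c\<bar> * (2 * \<bar>c\<bar> * ip f f + 1 / (4 * (2 * \<bar>c\<bar>)) * ip g g)"
    using False by (intro mult_left_mono ip_young assms) auto
  also have "\<dots> = 2 * c\<^sup>2 * ip f f + 1/8 * ip g g"
    using False by (simp add: field_simps power2_eq_square)
  finally show ?thesis .
qed simp

text \<open>All three follow from bounding the mixed term by half the sum of the squares. In the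
  lower bound \<open>3/8 = 9/16 - 3/16\<close> and \<open>-1/8 = 1/16 - 3/16\<close>.\<close>

lemma combination_le:
  assumes "a \<in> S" "c \<in> S"
  shows "ip (\<lambda>x. 3/4 * a x + 1/4 * c x) (\<lambda>x. 3/4 * a x + 1/4 * c x) \<le> ip a a + ip c c"
    "gf (\<lambda>x. 3/4 * a x + 1/4 * c x) (\<lambda>x. 3/4 * a x + 1/4 * c x) \<le> gf a a + gf c c"
    "ip (\<lambda>x. 3/4 * a x + 1/4 * c x) (\<lambda>x. 3/4 * a x + 1/4 * c x) \<ge> 3/8 * ip a a - 1/8 * ip c c"
proof -
  have b: "bm a" "bm c" using assms by auto
  have "\<bar>ip a c\<bar> \<le> 1/2 * ip a a + 1/2 * ip c c" using ip_young[OF b, of "1/2"] by simp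
  then show "ip (\<lambda>x. 3/4 * a x + 1/4 * c x) (\<lambda>x. 3/4 * a x + 1/4 * c x) \<le> ip a a + ip c c"
    "ip (\<lambda>x. 3/4 * a x + 1/4 * c x) (\<lambda>x. 3/4 * a x + 1/4 * c x) \<ge> 3/8 * ip a a - 1/8 * ip c c"
    unfolding ip_quad[OF b] using ip_nonneg[of a] ip_nonneg[of c]
    by (simp_all add: power2_eq_square abs_le_iff del: ip_nonneg)
  have "\<bar>gf a c\<bar> \<le> 1/2 * gf a a + 1/2 * gf c c" using gf_young[OF assms, of "1/2"] by simp
  then show "gf (\<lambda>x. 3/4 * a x + 1/4 * c x) (\<lambda>x. 3/4 * a x + 1/4 * c x) \<le> gf a a + gf c c"
    unfolding gf_quad[OF assms] using gf_nonneg[of a] gf_nonneg[of c]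
    by (simp add: power2_eq_square abs_le_iff del: gf_nonneg)
qed

text \<open>The scheme is tested with \<open>\<psi> = 3/4 a + 1/4 c\<close> because
  \<open>(a - b)(3/4 a + 1/4 c) = 1/2 (a\<^sup>2 - b\<^sup>2) + 1/8 ((a - b)\<^sup>2 - (b - c)\<^sup>2) + 1/8 (a - 2 b + c)\<^sup>2\<close>
  telescopes.\<close>

lemma telescoping_test:
  assumes S: "a \<in> S" "b \<in> S" "c \<in> S" "D \<in> S" and pos: "\<epsilon> > 0" "\<tau> > 0"
  defines "\<psi> \<equiv> \<lambda>x. 3/4 * a x + 1/4 * c x"
  assumes h1: "ip a \<psi> - ip b \<psi> = \<epsilon> * gf D \<psi> + r"
    and h2: "ip D D = - (\<tau> * \<epsilon>) * gf \<psi> D"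
  shows "1/2 * (ip a a - ip b b) + 1/8 * (ip (\<lambda>x. a x - b x) (\<lambda>x. a x - b x) - ip (\<lambda>x. b x - c x) (\<lambda>x. b x - c x))
    + ip D D / \<tau> \<le> r"
proof -
  have b: "bm a" "bm b" "bm c" using S by auto
  \<comment> \<open>The evolution equation trades the gradient term for the squared norm of
    \<open>D\<close>, which then acts as dissipation.\<close>
  have "\<epsilon> * gf D \<psi> = - ip D D / \<tau>"
    using h2 pos by (simp add: gf_commute[of \<psi> D])
  with h1 have h: "ip a \<psi> - ip b \<psi> + ip D D / \<tau> = r" by simp
  have p: "ip a \<psi> = 3/4 * ip a a + 1/4 * ip a c" "ip b \<psi> = 3/4 * ip a b + 1/4 * ip b c"
    unfolding \<psi>_def ip_commute[of _ "\<lambda>x. 3/4 * a x + 1/4 * c x"] ip_linear[OF b(1,3) b(1)] ip_linear[OF b(1,3) b(2)]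
    by (simp_all add: ip_commute[of c a] ip_commute[of c b])
  have dd: "ip (\<lambda>x. u x - v x) (\<lambda>x. u x - v x) = ip u u - 2 * ip u v + ip v v" if "bm u" "bm v" for u v
    using ip_quad[OF that, of 1 "-1"] by simp
  have bd: "bm (\<lambda>x. a x - b x)" "bm (\<lambda>x. b x - c x)" using b by auto
  have "ip (\<lambda>x. a x - b x) (\<lambda>x. b x - c x) = ip a (\<lambda>x. b x - c x) - ip b (\<lambda>x. b x - c x)"
    by (rule ip_diff[OF b(1,2) bd(2)])
  also have "\<dots> = (ip a b - ip a c) - (ip b b - ip b c)"
    unfolding ip_commute[of _ "\<lambda>x. b x - c x"] ip_diff[OF b(2,3) b(1)] ip_diff[OF b(2,3) b(2)]
    by (simp add: ip_commute[of b a] ip_commute[of c a] ip_commute[of c b])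
  finally have cross: "ip (\<lambda>x. a x - b x) (\<lambda>x. b x - c x) = (ip a b - ip a c) - (ip b b - ip b c)" .
  \<comment> \<open>The square of the second difference; the identity above contains it with a
    positive factor, so it is dropped.\<close>
  have "0 \<le> ip (\<lambda>x. (a x - b x) - (b x - c x)) (\<lambda>x. (a x - b x) - (b x - c x))" by simp
  then have "0 \<le> ip (\<lambda>x. a x - b x) (\<lambda>x. a x - b x) - 2 * ((ip a b - ip a c) - (ip b b - ip b c))
      + ip (\<lambda>x. b x - c x) (\<lambda>x. b x - c x)"
    unfolding dd[OF bd] cross .
  then show ?thesis using h unfolding p dd[OF b(1,2)] dd[OF b(2,3)] by argo
qed

end

text \<open>One run of the scheme with \<open>N\<close> steps. The constants defined inside, up to
  \<open>K\<close>, mention only \<open>\<Omega>\<close>, \<open>\<epsilon>\<close>,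
  \<open>C0\<close> and the Sobolev constant \<open>Cs\<close>; this carries their independence of
  mesh, time step and solution.\<close>

locale scheme = mesh \<Omega> \<K> q for \<Omega> :: "(real^'n) set" and \<K> q +
  fixes \<epsilon> \<tau> C0 Cs :: real and N :: nat and \<phi> \<mu> :: "nat \<Rightarrow> real^'n \<Rightarrow> real"
    and \<mu>0 l\<phi> l\<mu> :: "real^'n \<Rightarrow> real"
  assumes eps: "\<epsilon> > 0" and tau: "\<tau> > 0" and C0: "C0 > 0" and Cs: "Cs \<ge> 0" and N: "N \<ge> 1"
    and initial_S: "\<phi> 0 \<in> S"
    and first: "first_step_solution \<Omega> S \<epsilon> \<tau> (\<phi> 0) \<mu>0 (\<phi> 1) (\<mu> 0)"
    and multi: "\<And>m. 1 \<le> m \<Longrightarrow> m \<le> N - 1 \<Longrightarrow>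
      multistep_solution \<Omega> S \<epsilon> \<tau> (\<phi> (m - 1)) (\<phi> m) (\<phi> (m + 1)) (\<mu> m)"
    and lap: "is_discrete_laplacian \<Omega> S (\<phi> 0) l\<phi>" "is_discrete_laplacian \<Omega> S \<mu>0 l\<mu>"
    and init: "energy \<Omega> \<epsilon> (\<phi> 0) + \<tau>\<^sup>2 * ip l\<mu> l\<mu> + ip l\<phi> l\<phi> \<le> C0"
    and sob: "\<And>u. u \<in> S \<Longrightarrow> (LINT x|M. u x ^ 6) \<le> Cs * (ip u u + gf u u) ^ 3"
begin

lemma phi_S: "m \<le> N \<Longrightarrow> \<phi> m \<in> S"
proof -
  assume m: "m \<le> N"
  consider "m = 0" | "m = 1" | k where "m = Suc (Suc k)" by (metis One_nat_def not0_implies_Suc)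
  then show ?thesis
  proof cases
    case 3
    then show ?thesis using multi[of "Suc k"] m by (simp add: multistep_solution_def)
  qed (use initial_S first in \<open>auto simp: first_step_solution_def\<close>)
qed

lemma mu_S: "m < N \<Longrightarrow> \<mu> m \<in> S"
proof (cases m)
  case (Suc k)
  assume "m < N"
  then show ?thesis using multi[of m] Suc by (simp add: multistep_solution_def)
qed (use first in \<open>simp add: first_step_solution_def\<close>)

abbreviation d :: "nat \<Rightarrow> real^'n \<Rightarrow> real" where "d m \<equiv> (\<lambda>x. \<phi> (Suc m) x - \<phi> m x)"
abbreviation X :: "nat \<Rightarrow> real^'n \<Rightarrow> real" where "X m \<equiv> (\<lambda>x. chi (\<phi> (Suc m) x) (\<phi> m x))"

lemma d_S: "m < N \<Longrightarrow> d m \<in> S"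
  by (intro fe_diff phi_S) auto

lemma bm_phi: "m \<le> N \<Longrightarrow> bm (\<phi> m)" using phi_S by auto
lemma bm_d: "m < N \<Longrightarrow> bm (d m)" using d_S by auto
lemma bm_X: "m < N \<Longrightarrow> bm (X m)" using bm_phi by auto
lemma lap_S: "l\<phi> \<in> S" "l\<mu> \<in> S" using lap by (auto simp: is_discrete_laplacian_def)
lemma gf_lap: "\<xi> \<in> S \<Longrightarrow> gf (\<phi> 0) \<xi> = - ip l\<phi> \<xi>" "\<xi> \<in> S \<Longrightarrow> gf \<mu>0 \<xi> = - ip l\<mu> \<xi>"
  using lap by (auto simp: is_discrete_laplacian_def)

lemma evolution:
  assumes m: "m < N" and \<nu>: "\<nu> \<in> S"
  shows "ip (d m) \<nu> = - (\<tau> * \<epsilon>) * gf (\<mu> m) \<nu>"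
proof -
  have "ip (\<lambda>x. (\<phi> (Suc m) x - \<phi> m x) / \<tau>) \<nu> + \<epsilon> * gf (\<mu> m) \<nu> = 0"
  proof (cases m)
    case 0
    then show ?thesis using first \<nu> by (simp add: first_step_solution_def)
  next
    case (Suc k)
    then show ?thesis using multi[of m] m \<nu> by (simp add: multistep_solution_def)
  qed
  moreover have "ip (\<lambda>x. (\<phi> (Suc m) x - \<phi> m x) / \<tau>) \<nu> = ip (d m) \<nu> / \<tau>"
    unfolding L2_inner_def by simp
  ultimately have "ip (d m) \<nu> / \<tau> = - \<epsilon> * gf (\<mu> m) \<nu>" by simp
  then show ?thesis using tau by (simp add: field_simps)
qed

lemma potential_0:
  assumes \<psi>: "\<psi> \<in> S"
  shows "ip (\<mu> 0) \<psi> = 1/\<epsilon> * ip (X 0) \<psi> - 1/\<epsilon> * ip (\<phi> 0) \<psi> - \<tau>/2 * ip l\<mu> \<psi>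
    + \<epsilon> * (1/2 * gf (\<phi> (Suc 0)) \<psi> + 1/2 * gf (\<phi> 0) \<psi>)"
proof -
  have "(1 / \<epsilon>) * ip (X 0) \<psi> - (1 / \<epsilon>) * ip (\<phi> 0) \<psi> + \<tau> / 2 * gf \<mu>0 \<psi>
      + \<epsilon> * gf (\<lambda>x. 1/2 * \<phi> (Suc 0) x + 1/2 * \<phi> 0 x) \<psi> - ip (\<mu> 0) \<psi> = 0"
    using first \<psi> unfolding first_step_solution_def One_nat_def by blast
  moreover have "gf (\<lambda>x. 1/2 * \<phi> (Suc 0) x + 1/2 * \<phi> 0 x) \<psi> = 1/2 * gf (\<phi> (Suc 0)) \<psi> + 1/2 * gf (\<phi> 0) \<psi>"
    using N by (intro gf_linear phi_S \<psi>) auto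
  ultimately show ?thesis using gf_lap(2)[OF \<psi>] by simp
qed

lemma potential_Suc:
  assumes m: "Suc m < N" and \<psi>: "\<psi> \<in> S"
  shows "ip (\<mu> (Suc m)) \<psi> = 1/\<epsilon> * ip (X (Suc m)) \<psi> - 1/\<epsilon> * (3/2 * ip (\<phi> (Suc m)) \<psi> - 1/2 * ip (\<phi> m) \<psi>)
    + \<epsilon> * (3/4 * gf (\<phi> (Suc (Suc m))) \<psi> + 1/4 * gf (\<phi> m) \<psi>)"
proof -
  have "(1 / \<epsilon>) * ip (X (Suc m)) \<psi> - (1 / \<epsilon>) * ip (\<lambda>x. 3/2 * \<phi> (Suc m) x - 1/2 * \<phi> m x) \<psi>
      + \<epsilon> * gf (\<lambda>x. 3/4 * \<phi> (Suc (Suc m)) x + 1/4 * \<phi> m x) \<psi> - ip (\<mu> (Suc m)) \<psi> = 0"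
    using multi[of "Suc m"] m \<psi> by (simp add: multistep_solution_def)
  moreover have "gf (\<lambda>x. 3/4 * \<phi> (Suc (Suc m)) x + 1/4 * \<phi> m x) \<psi> = 3/4 * gf (\<phi> (Suc (Suc m))) \<psi> + 1/4 * gf (\<phi> m) \<psi>"
    using m by (intro gf_linear phi_S \<psi>) auto
  moreover have "ip (\<lambda>x. 3/2 * \<phi> (Suc m) x - 1/2 * \<phi> m x) \<psi> = 3/2 * ip (\<phi> (Suc m)) \<psi> - 1/2 * ip (\<phi> m) \<psi>"
    using ip_linear[of "\<phi> (Suc m)" "\<phi> m" \<psi> "3/2" "-1/2"] bm_phi m \<psi> by simp
  ultimately show ?thesis by simp
qed

abbreviation En :: "nat \<Rightarrow> real" where "En m \<equiv> energy \<Omega> \<epsilon> (\<phi> m)"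

lemma En_eq: "m \<le> N \<Longrightarrow> En m = 1 / (4 * \<epsilon>) * dw (\<phi> m) + \<epsilon> / 2 * gf (\<phi> m) (\<phi> m)"
  by (intro energy_dw phi_S)

lemma En_nonneg: "m \<le> N \<Longrightarrow> En m \<ge> 0"
  using En_eq[of m] eps by simp

lemma init_bounds: "En 0 \<le> C0" "\<tau>\<^sup>2 * ip l\<mu> l\<mu> \<le> C0" "ip l\<phi> l\<phi> \<le> C0"
proof -
  have "En 0 \<ge> 0" "\<tau>\<^sup>2 * ip l\<mu> l\<mu> \<ge> 0" "ip l\<phi> l\<phi> \<ge> 0" using En_nonneg[of 0] by auto
  then show "En 0 \<le> C0" "\<tau>\<^sup>2 * ip l\<mu> l\<mu> \<le> C0" "ip l\<phi> l\<phi> \<le> C0" using init by linarith+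
qed

text \<open>Tested with the first increment. Young's inequality splits the term with
  \<open>l\<mu>\<close> into half of the available
  \<open>1 / (2 * \<epsilon>) * ip (d 0) (d 0)\<close> and a multiple of
  \<open>\<tau>\<^sup>2 * ip l\<mu> l\<mu>\<close>, which the assumption on the initial data
  bounds.\<close>

lemma first_energy_step:
  "En (Suc 0) + \<tau> * \<epsilon> * gf (\<mu> 0) (\<mu> 0) + 1 / (4 * \<epsilon>) * ip (d 0) (d 0) \<le> C0 * (1 + \<epsilon> / 4)"
proof -
  have N0: "0 < N" "Suc 0 \<le> N" "0 \<le> N" using N by auto
  note S = phi_S[OF N0(2)] phi_S[OF N0(3)] d_S[OF N0(1)] mu_S[OF N0(1)]
  note eq = potential_0[OF S(3)]
  have ev: "ip (\<mu> 0) (d 0) = - (\<tau> * \<epsilon>) * gf (\<mu> 0) (\<mu> 0)"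
    using evolution[OF N0(1) S(4)] by (simp add: ip_commute[of "\<mu> 0"])
  have gd: "gf (\<phi> (Suc 0)) (d 0) + gf (\<phi> 0) (d 0) = gf (\<phi> (Suc 0)) (\<phi> (Suc 0)) - gf (\<phi> 0) (\<phi> 0)"
    unfolding gf_commute[of _ "d 0"] gf_diff[OF S(1,2) S(1)] gf_diff[OF S(1,2) S(2)]
    by (simp add: gf_commute[of "\<phi> 0" "\<phi> (Suc 0)"])
  have cd: "ip (X 0) (d 0) - ip (\<phi> 0) (d 0) = 1/4 * dw (\<phi> (Suc 0)) - 1/4 * dw (\<phi> 0) + 1/2 * ip (d 0) (d 0)"
    by (rule chi_dw_identity) (use S in auto)
  have "- (\<tau> * \<epsilon>) * gf (\<mu> 0) (\<mu> 0) = 1/\<epsilon> * (ip (X 0) (d 0) - ip (\<phi> 0) (d 0)) - \<tau>/2 * ip l\<mu> (d 0)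
      + \<epsilon>/2 * (gf (\<phi> (Suc 0)) (d 0) + gf (\<phi> 0) (d 0))"
    using eq unfolding ev by (simp add: algebra_simps)
  also have "\<dots> = En (Suc 0) - En 0 + 1 / (2 * \<epsilon>) * ip (d 0) (d 0) - \<tau>/2 * ip l\<mu> (d 0)"
    unfolding cd gd En_eq[OF N0(2)] En_eq[OF N0(3)]
    by (simp add: add_divide_distrib diff_divide_distrib algebra_simps)
  finally have id: "- (\<tau> * \<epsilon>) * gf (\<mu> 0) (\<mu> 0) = En (Suc 0) - En 0 + 1 / (2 * \<epsilon>) * ip (d 0) (d 0) - \<tau>/2 * ip l\<mu> (d 0)" .
  have "\<tau>/2 * ip l\<mu> (d 0) \<le> \<tau>/2 * \<bar>ip (d 0) l\<mu>\<bar>" using tau by (simp add: ip_commute[of l\<mu>])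
  also have "\<dots> \<le> \<tau>/2 * (1 / (2 * \<epsilon> * \<tau>) * ip (d 0) (d 0) + 1 / (4 * (1 / (2 * \<epsilon> * \<tau>))) * ip l\<mu> l\<mu>)"
    by (intro mult_left_mono ip_young) (use S lap_S tau eps in auto)
  also have "\<dots> = 1 / (4 * \<epsilon>) * ip (d 0) (d 0) + \<epsilon> / 4 * (\<tau>\<^sup>2 * ip l\<mu> l\<mu>)"
    using tau eps by (simp add: field_simps power2_eq_square)
  also have "\<dots> \<le> 1 / (4 * \<epsilon>) * ip (d 0) (d 0) + \<epsilon> / 4 * C0"
    using init_bounds(2) eps by (intro add_left_mono mult_left_mono) auto
  finally have y: "\<tau>/2 * ip l\<mu> (d 0) \<le> 1 / (4 * \<epsilon>) * ip (d 0) (d 0) + \<epsilon> / 4 * C0" .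
  have "1 / (2 * \<epsilon>) * ip (d 0) (d 0) = 1 / (4 * \<epsilon>) * ip (d 0) (d 0) + 1 / (4 * \<epsilon>) * ip (d 0) (d 0)"
    using eps by (simp add: field_simps)
  then show ?thesis using id y init_bounds(1) by (simp add: distrib_left)
qed

text \<open>A modified energy: the increment terms store what the extrapolation and the weights 3/4,
  1/4 carry over from one step to the next.\<close>

definition F :: "nat \<Rightarrow> real" where
  "F m = En (Suc m) + 1 / (4 * \<epsilon>) * ip (d m) (d m) + \<epsilon> / 8 * gf (d m) (d m)"

text \<open>Tested with the newest increment \<open>d1\<close>. The extrapolation is
  \<open>u1\<close> plus half of \<open>d0\<close>, so apart from the exact double-well difference
  only \<open>- 1/2 * ip d0 d1\<close> arises; half of the dissipation \<open>1/2 * ip d1 d1\<close>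
  pays for it, and the rest telescopes into \<open>F\<close>.\<close>

lemma energy_step:
  assumes m: "Suc m < N"
  shows "F (Suc m) + \<tau> * \<epsilon> * gf (\<mu> (Suc m)) (\<mu> (Suc m)) \<le> F m"
proof -
  define u0 u1 u2 where "u0 = \<phi> m" "u1 = \<phi> (Suc m)" "u2 = \<phi> (Suc (Suc m))"
  note u = this
  define d0 d1 where "d0 = (\<lambda>x. u1 x - u0 x)" "d1 = (\<lambda>x. u2 x - u1 x)"
  note dd = this
  have S: "u0 \<in> S" "u1 \<in> S" "u2 \<in> S" "\<mu> (Suc m) \<in> S" unfolding u using m by (auto intro: phi_S mu_S)
  have dS: "d0 \<in> S" "d1 \<in> S" unfolding dd using S by (auto intro: fe_diff)
  have bms: "bm u0" "bm u1" "bm u2" "bm d0" "bm d1" using S dS by auto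
  have eq: "ip (\<mu> (Suc m)) d1 = 1/\<epsilon> * ip (\<lambda>x. chi (u2 x) (u1 x)) d1 - 1/\<epsilon> * (3/2 * ip u1 d1 - 1/2 * ip u0 d1)
    + \<epsilon> * (3/4 * gf u2 d1 + 1/4 * gf u0 d1)"
    using potential_Suc[OF m dS(2)] by (simp add: u)
  have ev: "ip (\<mu> (Suc m)) d1 = - (\<tau> * \<epsilon>) * gf (\<mu> (Suc m)) (\<mu> (Suc m))"
    using evolution[OF m S(4)] by (simp add: ip_commute[of "\<mu> (Suc m)"] dd u)
  have cd: "ip (\<lambda>x. chi (u2 x) (u1 x)) d1 - ip u1 d1 = 1/4 * dw u2 - 1/4 * dw u1 + 1/2 * ip d1 d1"
    unfolding dd by (rule chi_dw_identity) (use bms in auto)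
  have d01: "ip d0 d1 = ip u1 d1 - ip u0 d1" unfolding dd(1) by (rule ip_diff) (use bms in auto)
  have yd: "\<bar>ip d0 d1\<bar> \<le> 1/2 * ip d0 d0 + 1/2 * ip d1 d1" using ip_young[OF bms(4,5), of "1/2"] by simp
  have gd: "gf v d1 = gf v u2 - gf v u1" "gf v d0 = gf v u1 - gf v u0" if "v \<in> S" for v
    unfolding gf_commute[of v d1] gf_commute[of v d0] gf_commute[of v u2] gf_commute[of v u1] gf_commute[of v u0]
    unfolding dd
    by (simp_all add: gf_diff[OF S(3,2) that] gf_diff[OF S(2,1) that])
  have sym: "gf u0 u2 = gf u2 u0" "gf u0 u1 = gf u1 u0" "gf u1 u2 = gf u2 u1" by (rule gf_commute)+
  have gdd: "gf d1 d1 = gf u2 u2 - 2 * gf u2 u1 + gf u1 u1" "gf d0 d0 = gf u1 u1 - 2 * gf u1 u0 + gf u0 u0"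
    "gf d0 d1 = gf u2 u1 - gf u1 u1 - gf u2 u0 + gf u1 u0"
    using gd(1)[OF dS(2)] gd(2)[OF dS(1)] gd(1)[OF dS(1)] gd[OF S(1)] gd[OF S(2)] gd[OF S(3)] sym
      gf_commute[of d1 u0] gf_commute[of d1 u1] gf_commute[of d1 u2] gf_commute[of d0 u0] gf_commute[of d0 u1] gf_commute[of d0 u2]
    by simp_all
  \<comment> \<open>The squared gradient norm of the second difference
    \<open>d1 - d0\<close>.\<close>
  have e: "0 \<le> gf d1 d1 - 2 * gf d0 d1 + gf d0 d0"
    using gf_young[OF dS(1) dS(2), of "1/2"] by (simp add: abs_le_iff)
  have g: "3/4 * gf u2 d1 + 1/4 * gf u0 d1 \<ge> 1/2 * (gf u2 u2 - gf u1 u1) + 1/8 * (gf d1 d1 - gf d0 d0)"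
    using e unfolding gdd gd(1)[OF S(3)] gd(1)[OF S(1)] sym by argo
  have "- (\<tau> * \<epsilon>) * gf (\<mu> (Suc m)) (\<mu> (Suc m)) = 1/\<epsilon> * ((ip (\<lambda>x. chi (u2 x) (u1 x)) d1 - ip u1 d1) - 1/2 * ip d0 d1)
    + \<epsilon> * (3/4 * gf u2 d1 + 1/4 * gf u0 d1)"
    using eq unfolding ev d01 by (simp add: algebra_simps)
  also have "\<dots> \<ge> 1/\<epsilon> * ((1/4 * dw u2 - 1/4 * dw u1 + 1/2 * ip d1 d1) - 1/2 * (1/2 * ip d0 d0 + 1/2 * ip d1 d1))
    + \<epsilon> * (1/2 * (gf u2 u2 - gf u1 u1) + 1/8 * (gf d1 d1 - gf d0 d0))"
    unfolding cd using yd eps g by (intro add_mono[OF mult_left_mono mult_left_mono]) auto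
  finally have "1/\<epsilon> * ((1/4 * dw u2 - 1/4 * dw u1 + 1/2 * ip d1 d1) - 1/2 * (1/2 * ip d0 d0 + 1/2 * ip d1 d1))
    + \<epsilon> * (1/2 * (gf u2 u2 - gf u1 u1) + 1/8 * (gf d1 d1 - gf d0 d0)) \<le> - (\<tau> * \<epsilon>) * gf (\<mu> (Suc m)) (\<mu> (Suc m))" .
  moreover have "F (Suc m) = 1 / (4 * \<epsilon>) * dw u2 + \<epsilon> / 2 * gf u2 u2 + 1 / (4 * \<epsilon>) * ip d1 d1 + \<epsilon> / 8 * gf d1 d1"
    "F m = 1 / (4 * \<epsilon>) * dw u1 + \<epsilon> / 2 * gf u1 u1 + 1 / (4 * \<epsilon>) * ip d0 d0 + \<epsilon> / 8 * gf d0 d0"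
    unfolding F_def using m En_eq by (simp_all add: u dd)
  ultimately show ?thesis by (simp add: add_divide_distrib diff_divide_distrib algebra_simps)
qed

text \<open>The factor 2 leaves room for the gradient of the first increment in \<open>F 0\<close>,
  which is at most half of \<open>En 1 + En 0\<close>.\<close>

definition E1 :: real where "E1 = 2 * (C0 * (1 + \<epsilon> / 4))"

lemma E1_ge: "C0 \<le> E1" "E1 \<ge> 0" unfolding E1_def using C0 eps by (simp_all add: distrib_left)

lemma energy_sum:
  assumes "m < N"
  shows "F m + \<tau> * \<epsilon> * (\<Sum>j<Suc m. gf (\<mu> j) (\<mu> j)) \<le> E1"
  using assms
proof (induction m)
  case 0
  have S: "\<phi> (Suc 0) \<in> S" "\<phi> 0 \<in> S" using N by (auto intro: phi_S)
  have "gf (d 0) (d 0) = gf (\<phi> (Suc 0)) (\<phi> (Suc 0)) - 2 * gf (\<phi> (Suc 0)) (\<phi> 0) + gf (\<phi> 0) (\<phi> 0)"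
    using gf_quad[OF S, of 1 "-1"] by simp
  also have "\<dots> \<le> 2 * gf (\<phi> (Suc 0)) (\<phi> (Suc 0)) + 2 * gf (\<phi> 0) (\<phi> 0)"
    using gf_young[OF S, of "1/2"] by (simp add: abs_le_iff)
  finally have "\<epsilon> / 8 * gf (d 0) (d 0) \<le> \<epsilon> / 8 * (2 * gf (\<phi> (Suc 0)) (\<phi> (Suc 0)) + 2 * gf (\<phi> 0) (\<phi> 0))"
    using eps by (intro mult_left_mono) auto
  moreover have "\<epsilon> / 2 * gf (\<phi> (Suc 0)) (\<phi> (Suc 0)) \<le> En (Suc 0)" "\<epsilon> / 2 * gf (\<phi> 0) (\<phi> 0) \<le> En 0"
    using En_eq[of "Suc 0"] En_eq[of 0] N eps by simp_all
  moreover have "C0 \<le> C0 * (1 + \<epsilon> / 4)" using C0 eps by (simp add: distrib_left)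
  moreover have "En (Suc 0) \<le> C0 * (1 + \<epsilon> / 4)"
  proof -
    have "0 \<le> \<tau> * \<epsilon> * gf (\<mu> 0) (\<mu> 0)" "0 \<le> 1 / (4 * \<epsilon>) * ip (d 0) (d 0)" using tau eps by simp_all
    then show ?thesis using first_energy_step by linarith
  qed
  ultimately show ?case
    using first_energy_step init_bounds(1) unfolding F_def E1_def
    by (simp add: distrib_left)
next
  case (Suc m)
  then show ?case using energy_step[of m] by (simp add: distrib_left)
qed

lemma En_le: "m \<le> N \<Longrightarrow> En m \<le> E1"
proof (cases m)
  case 0
  then show ?thesis using init_bounds(1) E1_ge by simp
next
  case (Suc k)
  assume "m \<le> N"
  then have "F k + \<tau> * \<epsilon> * (\<Sum>j<Suc k. gf (\<mu> j) (\<mu> j)) \<le> E1" using energy_sum Suc by simp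
  moreover have "0 \<le> \<tau> * \<epsilon> * (\<Sum>j<Suc k. gf (\<mu> j) (\<mu> j))" "0 \<le> 1 / (4 * \<epsilon>) * ip (d k) (d k)"
    "0 \<le> \<epsilon> / 8 * gf (d k) (d k)"
    using tau eps by (auto intro!: mult_nonneg_nonneg sum_nonneg simp del: sum.lessThan_Suc)
  ultimately show ?thesis unfolding F_def Suc by linarith
qed

lemma sum_gf_mu: "\<tau> * (\<Sum>j<N. gf (\<mu> j) (\<mu> j)) \<le> E1 / \<epsilon>"
proof -
  obtain k where k: "N = Suc k" using N by (metis Suc_le_D One_nat_def)
  have "F k \<ge> 0" unfolding F_def using En_nonneg[of "Suc k"] k eps by simp
  then have "\<tau> * \<epsilon> * (\<Sum>j<N. gf (\<mu> j) (\<mu> j)) \<le> E1" using energy_sum[of k] k by simp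
  then show ?thesis using eps by (simp add: field_simps)
qed

text \<open>\<open>N2\<close>, \<open>G2\<close> and \<open>N6\<close> bound the squared L2 norm,
  the squared gradient norm and the integral of the sixth power of every phase field.\<close>

definition N2 :: real where "N2 = 2 * measure M \<Omega> + 4 * \<epsilon> * E1"
definition G2 :: real where "G2 = 2 * E1 / \<epsilon>"
definition N6 :: real where "N6 = Cs * (N2 + G2) ^ 3"

lemma phi_bounds:
  assumes m: "m \<le> N"
  shows "ip (\<phi> m) (\<phi> m) \<le> N2" "gf (\<phi> m) (\<phi> m) \<le> G2" "(LINT x|M. \<phi> m x ^ 6) \<le> N6"
proof -
  have 1: "1 / (4 * \<epsilon>) * dw (\<phi> m) + \<epsilon> / 2 * gf (\<phi> m) (\<phi> m) \<le> E1" using En_le[OF m] En_eq[OF m] by simp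
  moreover have "0 \<le> 1 / (4 * \<epsilon>) * dw (\<phi> m)" "0 \<le> \<epsilon> / 2 * gf (\<phi> m) (\<phi> m)" using eps by simp_all
  ultimately have 2: "1 / (4 * \<epsilon>) * dw (\<phi> m) \<le> E1" "\<epsilon> / 2 * gf (\<phi> m) (\<phi> m) \<le> E1" by linarith+
  then have "dw (\<phi> m) \<le> 4 * \<epsilon> * E1" using eps by (simp add: field_simps)
  then show b1: "ip (\<phi> m) (\<phi> m) \<le> N2" using ip_le_dw[OF bm_phi[OF m]] by (simp add: N2_def)
  show b2: "gf (\<phi> m) (\<phi> m) \<le> G2" using 2 eps by (simp add: G2_def field_simps)
  have "(LINT x|M. \<phi> m x ^ 6) \<le> Cs * (ip (\<phi> m) (\<phi> m) + gf (\<phi> m) (\<phi> m)) ^ 3" by (rule sob[OF phi_S[OF m]])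
  also have "\<dots> \<le> N6" unfolding N6_def using b1 b2 Cs by (intro mult_left_mono power_mono add_mono) auto
  finally show "(LINT x|M. \<phi> m x ^ 6) \<le> N6" .
qed

lemma const_nonneg: "N2 \<ge> 0" "G2 \<ge> 0" "N6 \<ge> 0"
  unfolding N6_def N2_def G2_def using E1_ge eps Cs by auto

lemma X_bound:
  assumes m: "m < N"
  shows "ip (X m) (X m) \<le> 2 * N6"
proof -
  have b: "bm (\<phi> (Suc m))" "bm (\<phi> m)" using m bm_phi by auto
  have "ip (X m) (X m) \<le> (LINT x|M. \<phi> (Suc m) x ^ 6 + \<phi> m x ^ 6)"
    unfolding L2_inner_def
    by (rule integral_mono) (use b chi_power2_le in \<open>auto simp: power2_eq_square\<close>)
  also have "\<dots> = (LINT x|M. \<phi> (Suc m) x ^ 6) + (LINT x|M. \<phi> m x ^ 6)" using b by simp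
  finally show ?thesis using phi_bounds(3)[of m] phi_bounds(3)[of "Suc m"] m by simp
qed

end

section \<open>Chemical potentials and difference quotients\<close>

context scheme
begin

text \<open>The weight is scaled by \<open>\<tau>\<close>: for an increment \<open>f\<close> the
  first term is a fraction of a difference quotient term, and the second has the factor
  \<open>\<tau>\<close> needed for summation over time.\<close>

lemma weighted_young:
  assumes "bm f" "bm g" "p > 0"
  shows "c * ip f g \<le> p * (ip f f / \<tau>) + \<tau> * c\<^sup>2 / (4 * p) * ip g g"
proof (cases "c = 0")
  case True
  then show ?thesis using assms tau by simp
next
  case False
  have "c * ip f g \<le> \<bar>c\<bar> * \<bar>ip f g\<bar>" by (metis abs_ge_self abs_mult)
  also have "\<dots> \<le> \<bar>c\<bar> * (p / (\<tau> * \<bar>c\<bar>) * ip f f + 1 / (4 * (p / (\<tau> * \<bar>c\<bar>))) * ip g g)"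
    using False assms tau by (intro mult_left_mono ip_young) auto
  also have "\<dots> = p * (ip f f / \<tau>) + \<tau> * (\<bar>c\<bar> * \<bar>c\<bar>) / (4 * p) * ip g g"
    using False assms tau by (simp add: field_simps)
  finally show ?thesis by (simp add: power2_eq_square)
qed

text \<open>Twice the sum of the four Young remainders in the test of the first potential
  equation.\<close>

definition KA :: real where
  "KA = 2 * ((4 * N6 + 2 * N2) / \<epsilon>\<^sup>2 + C0 / 2 + 2 * \<epsilon>\<^sup>2 * C0)"

lemma KA_nonneg: "KA \<ge> 0"
  unfolding KA_def using const_nonneg C0 by simp

text \<open>Here \<open>a (\<phi>\<^sup>1 - \<phi>\<^sup>0, \<mu>)\<close> is not estimated: the evolution equation turns it into
  \<open>- \<parallel>\<phi>\<^sup>1 - \<phi>\<^sup>0\<parallel>\<^sup>2 / (\<tau> \<epsilon>)\<close>, which has the good sign.\<close>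

lemma first_potential_bound:
  "ip (\<mu> 0) (\<mu> 0) \<le> KA" "ip (d 0) (d 0) / \<tau> \<le> KA"
proof -
  have N0: "0 < N" "Suc 0 \<le> N" "0 \<le> N" using N by auto
  note S = phi_S[OF N0(2)] phi_S[OF N0(3)] d_S[OF N0(1)] mu_S[OF N0(1)]
  have bms: "bm (X 0)" "bm (\<phi> 0)" "bm l\<mu>" "bm l\<phi>" "bm (\<mu> 0)" using S lap_S by auto
  have g1: "gf (\<phi> (Suc 0)) (\<mu> 0) = gf (\<phi> 0) (\<mu> 0) + gf (\<mu> 0) (d 0)"
    using gf_diff[OF S(1,2,4)] by (simp add: gf_commute[of "\<mu> 0" "d 0"])
  have g2: "\<epsilon> * gf (\<mu> 0) (d 0) = - (ip (d 0) (d 0) / \<tau>)"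
    using evolution[OF N0(1) S(3)] tau by simp
  have "\<epsilon> * (1/2 * gf (\<phi> (Suc 0)) (\<mu> 0) + 1/2 * gf (\<phi> 0) (\<mu> 0))
      = \<epsilon> * gf (\<phi> 0) (\<mu> 0) + 1/2 * (\<epsilon> * gf (\<mu> 0) (d 0))"
    unfolding g1 by (simp add: algebra_simps)
  then have "\<epsilon> * (1/2 * gf (\<phi> (Suc 0)) (\<mu> 0) + 1/2 * gf (\<phi> 0) (\<mu> 0))
      = - \<epsilon> * ip l\<phi> (\<mu> 0) - 1/2 * (ip (d 0) (d 0) / \<tau>)"
    unfolding g2 gf_lap(1)[OF S(4)] by simp
  then have eq: "ip (\<mu> 0) (\<mu> 0) + 1/2 * (ip (d 0) (d 0) / \<tau>)
      = (1/\<epsilon>) * ip (X 0) (\<mu> 0) + (- 1/\<epsilon>) * ip (\<phi> 0) (\<mu> 0) + (- \<tau>/2) * ip l\<mu> (\<mu> 0) + (- \<epsilon>) * ip l\<phi> (\<mu> 0)"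
    using potential_0[OF S(4)] by simp
  have "(1/\<epsilon>) * ip (X 0) (\<mu> 0) \<le> 2 * (1/\<epsilon>)\<^sup>2 * ip (X 0) (X 0) + 1/8 * ip (\<mu> 0) (\<mu> 0)"
    "(- 1/\<epsilon>) * ip (\<phi> 0) (\<mu> 0) \<le> 2 * (- 1/\<epsilon>)\<^sup>2 * ip (\<phi> 0) (\<phi> 0) + 1/8 * ip (\<mu> 0) (\<mu> 0)"
    "(- \<tau>/2) * ip l\<mu> (\<mu> 0) \<le> 2 * (- \<tau>/2)\<^sup>2 * ip l\<mu> l\<mu> + 1/8 * ip (\<mu> 0) (\<mu> 0)"
    "(- \<epsilon>) * ip l\<phi> (\<mu> 0) \<le> 2 * (- \<epsilon>)\<^sup>2 * ip l\<phi> l\<phi> + 1/8 * ip (\<mu> 0) (\<mu> 0)"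
    by (rule ip_scaled_young; use bms in blast)+
  moreover have "2 * (1/\<epsilon>)\<^sup>2 * ip (X 0) (X 0) \<le> 2 * (1/\<epsilon>)\<^sup>2 * (2 * N6)"
    "2 * (- 1/\<epsilon>)\<^sup>2 * ip (\<phi> 0) (\<phi> 0) \<le> 2 * (- 1/\<epsilon>)\<^sup>2 * N2"
    "2 * (- \<epsilon>)\<^sup>2 * ip l\<phi> l\<phi> \<le> 2 * (- \<epsilon>)\<^sup>2 * C0"
    using X_bound[OF N0(1)] phi_bounds(1)[OF N0(3)] init_bounds(3) by (intro mult_left_mono; simp)+
  moreover have "2 * (- \<tau>/2)\<^sup>2 * ip l\<mu> l\<mu> \<le> C0 / 2" using init_bounds(2) by (simp add: power_divide)
  ultimately have "1/2 * ip (\<mu> 0) (\<mu> 0) + 1/2 * (ip (d 0) (d 0) / \<tau>)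
      \<le> 2 * (1/\<epsilon>)\<^sup>2 * (2 * N6) + 2 * (- 1/\<epsilon>)\<^sup>2 * N2 + 2 * (- \<epsilon>)\<^sup>2 * C0 + C0 / 2"
    using eq by linarith
  also have "\<dots> = KA / 2" unfolding KA_def by (simp add: power_divide add_divide_distrib algebra_simps)
  finally have "ip (\<mu> 0) (\<mu> 0) + ip (d 0) (d 0) / \<tau> \<le> KA" by simp
  moreover have "ip (d 0) (d 0) / \<tau> \<ge> 0" using tau by simp
  ultimately show "ip (\<mu> 0) (\<mu> 0) \<le> KA" "ip (d 0) (d 0) / \<tau> \<le> KA"
    using ip_nonneg[of "\<mu> 0"] by linarith+
qed

definition KM :: real where
  "KM = KA + 2 * ((4 * N6 + 5 * N2) / \<epsilon>\<^sup>2 + \<epsilon> * G2 + \<epsilon>)"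

lemma KM_nonneg: "KM \<ge> 0"
  unfolding KM_def using const_nonneg KA_nonneg eps by simp

text \<open>Testing the potential equation with the potential itself controls its full L2 norm, mean
  value included, by the gradient at the same level. It is not yet a uniform bound, but its
  right-hand side is summable in time.\<close>

lemma potential_bound:
  assumes m: "m < N"
  shows "ip (\<mu> m) (\<mu> m) \<le> KM * (1 + gf (\<mu> m) (\<mu> m))"
proof (cases m)
  case 0
  have "KA * 1 \<le> KM * (1 + gf (\<mu> 0) (\<mu> 0))"
    using KA_nonneg KM_nonneg const_nonneg eps by (intro mult_mono) (simp_all add: KM_def)
  then show ?thesis using first_potential_bound(1) 0 by simp
next
  case (Suc k)
  then have k: "Suc k < N" using m by simp
  have kk: "Suc k \<le> N" "k \<le> N" "Suc (Suc k) \<le> N" using k by auto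
  define w where "w = \<mu> (Suc k)"
  have wS: "w \<in> S" unfolding w_def by (rule mu_S[OF k])
  have bms: "bm (X (Suc k))" "bm (\<phi> (Suc k))" "bm (\<phi> k)" "bm w" using bm_X bm_phi k wS by auto
  have "ip w w = 1/\<epsilon> * ip (X (Suc k)) w - 1/\<epsilon> * (3/2 * ip (\<phi> (Suc k)) w - 1/2 * ip (\<phi> k) w)
      + \<epsilon> * (3/4 * gf (\<phi> (Suc (Suc k))) w + 1/4 * gf (\<phi> k) w)"
    using potential_Suc[OF k wS] by (simp add: w_def)
  then have eq: "ip w w = (1/\<epsilon>) * ip (X (Suc k)) w + (- 3/(2*\<epsilon>)) * ip (\<phi> (Suc k)) w + (1/(2*\<epsilon>)) * ip (\<phi> k) w
      + \<epsilon> * (3/4 * gf (\<phi> (Suc (Suc k))) w + 1/4 * gf (\<phi> k) w)"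
    by (simp add: add_divide_distrib diff_divide_distrib algebra_simps)
  have "(1/\<epsilon>) * ip (X (Suc k)) w \<le> 2 * (1/\<epsilon>)\<^sup>2 * ip (X (Suc k)) (X (Suc k)) + 1/8 * ip w w"
    "(- 3/(2*\<epsilon>)) * ip (\<phi> (Suc k)) w \<le> 2 * (- 3/(2*\<epsilon>))\<^sup>2 * ip (\<phi> (Suc k)) (\<phi> (Suc k)) + 1/8 * ip w w"
    "(1/(2*\<epsilon>)) * ip (\<phi> k) w \<le> 2 * (1/(2*\<epsilon>))\<^sup>2 * ip (\<phi> k) (\<phi> k) + 1/8 * ip w w"
    by (rule ip_scaled_young; use bms in blast)+
  moreover have "2 * (1/\<epsilon>)\<^sup>2 * ip (X (Suc k)) (X (Suc k)) \<le> 2 * (1/\<epsilon>)\<^sup>2 * (2 * N6)"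
    "2 * (- 3/(2*\<epsilon>))\<^sup>2 * ip (\<phi> (Suc k)) (\<phi> (Suc k)) \<le> 2 * (- 3/(2*\<epsilon>))\<^sup>2 * N2"
    "2 * (1/(2*\<epsilon>))\<^sup>2 * ip (\<phi> k) (\<phi> k) \<le> 2 * (1/(2*\<epsilon>))\<^sup>2 * N2"
    using X_bound[OF k] phi_bounds(1)[OF kk(1)] phi_bounds(1)[OF kk(2)] by (intro mult_left_mono; simp)+
  moreover have "\<epsilon> * (3/4 * gf (\<phi> (Suc (Suc k))) w + 1/4 * gf (\<phi> k) w) \<le> \<epsilon> * (1/2 * G2 + 1/2 * gf w w)"
  proof (rule mult_left_mono)
    show "3/4 * gf (\<phi> (Suc (Suc k))) w + 1/4 * gf (\<phi> k) w \<le> 1/2 * G2 + 1/2 * gf w w"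
      using gf_young[OF phi_S[OF kk(3)] wS, of "1/2"] gf_young[OF phi_S[OF kk(2)] wS, of "1/2"]
        phi_bounds(2)[OF kk(3)] phi_bounds(2)[OF kk(2)] by (simp add: abs_le_iff)
  qed (use eps in simp)
  \<comment> \<open>Three Young terms at 1/8 each leave 5/8 of \<open>ip w w\<close>.\<close>
  ultimately have "5/8 * ip w w \<le> 2 * (1/\<epsilon>)\<^sup>2 * (2 * N6) + 2 * (- 3/(2*\<epsilon>))\<^sup>2 * N2 + 2 * (1/(2*\<epsilon>))\<^sup>2 * N2
      + \<epsilon> * (1/2 * G2 + 1/2 * gf w w)"
    using eq by linarith
  also have "\<dots> = (4 * N6 + 5 * N2) / \<epsilon>\<^sup>2 + \<epsilon> * G2 / 2 + \<epsilon> * gf w w / 2"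
    by (simp add: power_divide power_mult_distrib add_divide_distrib algebra_simps)
  finally have "ip w w \<le> 2 * ((4 * N6 + 5 * N2) / \<epsilon>\<^sup>2 + \<epsilon> * G2 + \<epsilon>) + 2 * \<epsilon> * gf w w"
  proof -
    have "0 \<le> (4 * N6 + 5 * N2) / \<epsilon>\<^sup>2" "0 \<le> \<epsilon> * G2" "0 \<le> \<epsilon> * gf w w" using const_nonneg eps by simp_all
    moreover assume "5/8 * ip w w \<le> (4 * N6 + 5 * N2) / \<epsilon>\<^sup>2 + \<epsilon> * G2 / 2 + \<epsilon> * gf w w / 2"
    ultimately show ?thesis using eps by argo
  qed
  also have "\<dots> \<le> KM + KM * gf w w"
  proof (rule add_mono)
    show "2 * ((4 * N6 + 5 * N2) / \<epsilon>\<^sup>2 + \<epsilon> * G2 + \<epsilon>) \<le> KM" using KA_nonneg by (simp add: KM_def)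
    have "2 * \<epsilon> \<le> KM" using KA_nonneg const_nonneg eps by (simp add: KM_def distrib_left)
    then show "2 * \<epsilon> * gf w w \<le> KM * gf w w" by (rule mult_right_mono) simp
  qed
  finally show ?thesis by (simp add: Suc w_def distrib_left)
qed

abbreviation H :: "(real^'n \<Rightarrow> real) \<Rightarrow> real" where "H \<psi> \<equiv> ip \<psi> \<psi> + gf \<psi> \<psi>"

text \<open>\<open>chi_diff\<close> writes the increment as \<open>e * w\<close> with
  \<open>e\<close> the increment over two steps. In \<open>9 * (N6 + Cs)\<close> one 3 comes from
  \<open>chi_diff_factor_le\<close>, the other from the three phase fields, each treated by
  \<open>weighted_sobolev\<close>.\<close>

lemma chi_increment_bound:
  assumes k: "Suc k < N" and \<psi>: "\<psi> \<in> S" and s: "s > 0"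
  shows "\<bar>ip (X (Suc k)) \<psi> - ip (X k) \<psi>\<bar> \<le>
    2 * s * (ip (d (Suc k)) (d (Suc k)) + ip (d k) (d k)) + 1 / (4 * s) * (9 * (N6 + Cs) * H \<psi>)"
proof -
  have kk: "Suc k \<le> N" "k \<le> N" "Suc (Suc k) \<le> N" "k < N" using k by auto
  define a b c where "a = \<phi> (Suc (Suc k))" "b = \<phi> (Suc k)" "c = \<phi> k"
  note abc = this
  define w where "w = (\<lambda>x. 1/4 * ((a x)\<^sup>2 + a x * c x + (c x)\<^sup>2 + b x * (a x + c x) + (b x)\<^sup>2))"
  define e where "e = (\<lambda>x. a x - c x)"
  have S: "a \<in> S" "b \<in> S" "c \<in> S" unfolding abc using kk by (auto intro: phi_S)
  have bms: "bm a" "bm b" "bm c" "bm \<psi>" using S \<psi> by auto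
  have bw: "bm w" unfolding w_def using bms by (intro bounded_measurable_mult bounded_measurable_add) auto
  have be: "bm e" "bm (\<lambda>x. w x * \<psi> x)" using bms bw by (auto simp: e_def)
  have "ip (X (Suc k)) \<psi> - ip (X k) \<psi> = (LINT x|M. chi (a x) (b x) * \<psi> x - chi (b x) (c x) * \<psi> x)"
    unfolding L2_inner_def abc[symmetric]
    by (rule Bochner_Integration.integral_diff[symmetric]) (use bms in auto)
  also have "\<dots> = ip e (\<lambda>x. w x * \<psi> x)"
    unfolding L2_inner_def
  proof (rule Bochner_Integration.integral_cong)
    fix x
    have "chi (a x) (b x) * \<psi> x - chi (b x) (c x) * \<psi> x = (chi (a x) (b x) - chi (b x) (c x)) * \<psi> x"
      by (simp add: left_diff_distrib)
    also have "\<dots> = e x * (w x * \<psi> x)" unfolding chi_diff e_def w_def by (simp add: mult.assoc)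
    finally show "chi (a x) (b x) * \<psi> x - chi (b x) (c x) * \<psi> x = e x * (w x * \<psi> x)" .
  qed simp
  finally have eq: "ip (X (Suc k)) \<psi> - ip (X k) \<psi> = ip e (\<lambda>x. w x * \<psi> x)" .
  have "e = (\<lambda>x. 1 * d (Suc k) x + 1 * d k x)" by (simp add: e_def abc)
  then have "ip e e = ip (d (Suc k)) (d (Suc k)) + 2 * ip (d (Suc k)) (d k) + ip (d k) (d k)"
    using ip_quad[OF bm_d[OF k] bm_d[OF kk(4)], of 1 1] by simp
  also have "\<dots> \<le> 2 * (ip (d (Suc k)) (d (Suc k)) + ip (d k) (d k))"
    using ip_young[OF bm_d[OF k] bm_d[OF kk(4)], of "1/2"] by (simp add: abs_le_iff)
  finally have ee: "ip e e \<le> 2 * (ip (d (Suc k)) (d (Suc k)) + ip (d k) (d k))" .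
  have "ip (\<lambda>x. w x * \<psi> x) (\<lambda>x. w x * \<psi> x) \<le>
      (LINT x|M. 3 * (a x ^ 4 * (\<psi> x)\<^sup>2) + 3 * (b x ^ 4 * (\<psi> x)\<^sup>2) + 3 * (c x ^ 4 * (\<psi> x)\<^sup>2))"
    unfolding L2_inner_def
  proof (rule integral_mono)
    fix x
    have "(w x)\<^sup>2 * (\<psi> x)\<^sup>2 \<le> (3 * (a x ^ 4 + b x ^ 4 + c x ^ 4)) * (\<psi> x)\<^sup>2"
      unfolding w_def by (intro mult_right_mono chi_diff_factor_le) auto
    then show "w x * \<psi> x * (w x * \<psi> x) \<le> 3 * (a x ^ 4 * (\<psi> x)\<^sup>2) + 3 * (b x ^ 4 * (\<psi> x)\<^sup>2) + 3 * (c x ^ 4 * (\<psi> x)\<^sup>2)"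
      by (simp add: power2_eq_square algebra_simps)
  qed (use be bms in auto)
  also have "\<dots> = 3 * (LINT x|M. a x ^ 4 * (\<psi> x)\<^sup>2) + 3 * (LINT x|M. b x ^ 4 * (\<psi> x)\<^sup>2) + 3 * (LINT x|M. c x ^ 4 * (\<psi> x)\<^sup>2)"
    using bms by simp
  also have "\<dots> \<le> 3 * ((N6 + Cs) * H \<psi>) + 3 * ((N6 + Cs) * H \<psi>) + 3 * ((N6 + Cs) * H \<psi>)"
    using weighted_sobolev[OF S(1) \<psi> Cs sob] weighted_sobolev[OF S(2) \<psi> Cs sob] weighted_sobolev[OF S(3) \<psi> Cs sob]
      phi_bounds(3)[OF kk(3)] phi_bounds(3)[OF kk(1)] phi_bounds(3)[OF kk(2)]
    unfolding abc[symmetric] by (intro add_mono mult_left_mono) auto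
  finally have ww: "ip (\<lambda>x. w x * \<psi> x) (\<lambda>x. w x * \<psi> x) \<le> 9 * (N6 + Cs) * H \<psi>" by (simp add: algebra_simps)
  have "\<bar>ip e (\<lambda>x. w x * \<psi> x)\<bar> \<le> s * ip e e + 1 / (4 * s) * ip (\<lambda>x. w x * \<psi> x) (\<lambda>x. w x * \<psi> x)"
    by (rule ip_young[OF be s])
  also have "\<dots> \<le> s * (2 * (ip (d (Suc k)) (d (Suc k)) + ip (d k) (d k))) + 1 / (4 * s) * (9 * (N6 + Cs) * H \<psi>)"
    using s by (intro add_mono mult_left_mono ee ww) auto
  finally show ?thesis unfolding eq by (simp add: mult_ac)
qed

text \<open>The \<open>m\<close>-th term of the sum of squared difference quotients, with its factor
  \<open>\<tau>\<close>.\<close>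

abbreviation x :: "nat \<Rightarrow> real" where "x m \<equiv> ip (d m) (d m) / \<tau>"

text \<open>The choice \<open>s = \<epsilon> / (96 * \<tau>)\<close> makes the coefficient of the
  difference quotients 1/48, small enough to be absorbed later; the price is
  \<open>9 * 96 / 4 = 216\<close>.\<close>

lemma chi_remainder:
  assumes k: "Suc k < N" and \<psi>: "\<psi> \<in> S"
  shows "1/\<epsilon> * (ip (X (Suc k)) \<psi> - ip (X k) \<psi>) \<le> 1/48 * (x (Suc k) + x k) + \<tau> * (216 * (N6 + Cs) / \<epsilon>\<^sup>2) * H \<psi>"
proof -
  have "1/\<epsilon> * (ip (X (Suc k)) \<psi> - ip (X k) \<psi>) \<le> 1/\<epsilon> * \<bar>ip (X (Suc k)) \<psi> - ip (X k) \<psi>\<bar>"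
    using eps by (intro mult_left_mono) auto
  also have "\<dots> \<le> 1/\<epsilon> * (2 * (\<epsilon> / (96 * \<tau>)) * (ip (d (Suc k)) (d (Suc k)) + ip (d k) (d k))
      + 1 / (4 * (\<epsilon> / (96 * \<tau>))) * (9 * (N6 + Cs) * H \<psi>))"
    using eps tau by (intro mult_left_mono chi_increment_bound k \<psi>) auto
  also have "\<dots> = 1/\<epsilon> * (2 * (\<epsilon> / (96 * \<tau>))) * (ip (d (Suc k)) (d (Suc k)) + ip (d k) (d k))
      + 1/\<epsilon> * (1 / (4 * (\<epsilon> / (96 * \<tau>)))) * 9 * (N6 + Cs) * H \<psi>"
  proof -
    have "A * (2 * s * D + Q * (9 * P * h)) = A * (2 * s) * D + A * Q * 9 * P * h" for A s D Q P h :: real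
      by (simp add: algebra_simps)
    then show ?thesis .
  qed
  also have "1/\<epsilon> * (2 * (\<epsilon> / (96 * \<tau>))) = 1 / (48 * \<tau>)" using eps tau by (simp add: field_simps)
  also have "1/\<epsilon> * (1 / (4 * (\<epsilon> / (96 * \<tau>)))) * 9 = 216 * \<tau> / \<epsilon>\<^sup>2"
    using eps tau by (simp add: field_simps power2_eq_square)
  also have "1 / (48 * \<tau>) * (ip (d (Suc k)) (d (Suc k)) + ip (d k) (d k)) + 216 * \<tau> / \<epsilon>\<^sup>2 * (N6 + Cs) * H \<psi>
      = 1/48 * (x (Suc k) + x k) + \<tau> * (216 * (N6 + Cs) / \<epsilon>\<^sup>2) * H \<psi>"
  proof -
    have "1 / (48 * \<tau>) * (a + b) + 216 * \<tau> / e * P * h = 1/48 * (a / \<tau> + b / \<tau>) + \<tau> * (216 * P / e) * h"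
      for a b e P h :: real by (simp add: add_divide_distrib algebra_simps)
    then show ?thesis .
  qed
  finally show ?thesis .
qed

text \<open>The 29 is \<open>27 + 2\<close>, the Young constants of the two linear terms in a
  general step; the single linear term of the first step fits into the same 29.\<close>

definition Kr :: real where "Kr = (216 * (N6 + Cs) + 29) / \<epsilon>\<^sup>2"
definition KC :: real where "KC = 2 * Kr * (KM + 1)"

lemma Kr_nonneg: "Kr \<ge> 0"
  unfolding Kr_def using const_nonneg Cs by simp

lemma KC_nonneg: "KC \<ge> 0"
  unfolding KC_def using Kr_nonneg KM_nonneg by simp

text \<open>Replaces the H1 norm of the test function by gradients of potentials, whose time sums
  are known.\<close>

lemma test_norm_bound:
  assumes "j < N" "k < N"
  shows "Kr * H (\<lambda>x. 3/4 * \<mu> j x + 1/4 * \<mu> k x) \<le> KC * (1 + gf (\<mu> j) (\<mu> j) + gf (\<mu> k) (\<mu> k))"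
proof -
  define g1 g2 where "g1 = gf (\<mu> j) (\<mu> j)" "g2 = gf (\<mu> k) (\<mu> k)"
  note g = this
  have g0: "g1 \<ge> 0" "g2 \<ge> 0" by (simp_all add: g)
  have "H (\<lambda>x. 3/4 * \<mu> j x + 1/4 * \<mu> k x) \<le> (ip (\<mu> j) (\<mu> j) + ip (\<mu> k) (\<mu> k)) + (g1 + g2)"
    unfolding g using combination_le[OF mu_S[OF assms(1)] mu_S[OF assms(2)]] by (intro add_mono) auto
  also have "\<dots> \<le> (KM * (1 + g1) + KM * (1 + g2)) + (g1 + g2)"
    using potential_bound[OF assms(1)] potential_bound[OF assms(2)] unfolding g by (intro add_mono) auto
  also have "\<dots> \<le> 2 * (KM + 1) * (1 + g1 + g2)"
    using KM_nonneg g0 by (simp add: algebra_simps)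
  finally have "Kr * H (\<lambda>x. 3/4 * \<mu> j x + 1/4 * \<mu> k x) \<le> Kr * (2 * (KM + 1) * (1 + g1 + g2))"
    using Kr_nonneg by (rule mult_left_mono)
  then show ?thesis unfolding g KC_def by (simp only: mult.assoc mult.left_commute[of Kr 2])
qed

text \<open>The evolution equations of steps \<open>j\<close> and \<open>k\<close>, combined with
  the weights of the test function and tested with the combined increment \<open>D\<close>.\<close>

lemma test_evolution:
  assumes "j < N" "k < N"
  defines "D \<equiv> \<lambda>x. 3/4 * d j x + 1/4 * d k x" and "\<psi> \<equiv> \<lambda>x. 3/4 * \<mu> j x + 1/4 * \<mu> k x"
  shows "D \<in> S" "\<psi> \<in> S" "ip D D = - (\<tau> * \<epsilon>) * gf \<psi> D" "ip D D / \<tau> \<ge> 3/8 * x j - 1/8 * x k"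
proof -
  note dS = d_S[OF assms(1)] d_S[OF assms(2)]
  show D: "D \<in> S" unfolding D_def by (rule fe_linear(1)[OF dS])
  show "\<psi> \<in> S" unfolding \<psi>_def by (intro fe_linear(1) mu_S assms)
  have "ip D D = 3/4 * ip (d j) D + 1/4 * ip (d k) D"
    by (subst (1) D_def, rule ip_linear) (use dS D in auto)
  also have "\<dots> = - (\<tau> * \<epsilon>) * (3/4 * gf (\<mu> j) D + 1/4 * gf (\<mu> k) D)"
    unfolding evolution[OF assms(1) D] evolution[OF assms(2) D] by (simp add: algebra_simps)
  also have "3/4 * gf (\<mu> j) D + 1/4 * gf (\<mu> k) D = gf \<psi> D"
    unfolding \<psi>_def by (intro gf_linear[symmetric] mu_S assms D)
  finally show "ip D D = - (\<tau> * \<epsilon>) * gf \<psi> D" .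
  have "(3/8 * ip (d j) (d j) - 1/8 * ip (d k) (d k)) / \<tau> \<le> ip D D / \<tau>"
    unfolding D_def using tau by (intro divide_right_mono combination_le(3)[OF dS]) auto
  then show "ip D D / \<tau> \<ge> 3/8 * x j - 1/8 * x k" by (simp add: diff_divide_distrib)
qed

text \<open>The difference of the two gradient terms is \<open>\<epsilon> * gf D \<psi>\<close>.
  Bookkeeping: \<open>D\<close> gives \<open>3/8 * x (Suc (Suc m)) - 1/8 * x m\<close>, and the
  Young terms cost 1/48 at the newest level, \<open>1/48 + 1/48\<close> at the middle one and 1/24
  at the oldest. Thus \<open>3/8 - 1/48 \<ge> 1/3\<close> stays on the left, against 1/24 and
  \<open>1/8 + 1/24 = 1/6\<close> on the right.\<close>

lemma potential_step:
  assumes m: "Suc (Suc m) < N"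
  shows "1/2 * (ip (\<mu> (Suc (Suc m))) (\<mu> (Suc (Suc m))) - ip (\<mu> (Suc m)) (\<mu> (Suc m)))
    + 1/8 * (ip (\<lambda>x. \<mu> (Suc (Suc m)) x - \<mu> (Suc m) x) (\<lambda>x. \<mu> (Suc (Suc m)) x - \<mu> (Suc m) x)
      - ip (\<lambda>x. \<mu> (Suc m) x - \<mu> m x) (\<lambda>x. \<mu> (Suc m) x - \<mu> m x)) + 1/3 * x (Suc (Suc m))
    \<le> 1/24 * x (Suc m) + 1/6 * x m + KC * \<tau> * (1 + gf (\<mu> (Suc (Suc m))) (\<mu> (Suc (Suc m))) + gf (\<mu> m) (\<mu> m))"
proof -
  have mm: "m < N" "Suc m < N" using m by auto
  have ml: "m \<le> N" "Suc m \<le> N" "Suc (Suc m) \<le> N" "Suc (Suc (Suc m)) \<le> N" using m by auto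
  define \<psi> where "\<psi> = (\<lambda>x. 3/4 * \<mu> (Suc (Suc m)) x + 1/4 * \<mu> m x)"
  define D where "D = (\<lambda>x. 3/4 * d (Suc (Suc m)) x + 1/4 * d m x)"
  define r where "r = 1/\<epsilon> * (ip (X (Suc (Suc m))) \<psi> - ip (X (Suc m)) \<psi>) + (- 3/(2*\<epsilon>)) * ip (d (Suc m)) \<psi> + (1/(2*\<epsilon>)) * ip (d m) \<psi>"
  define T where "T = (\<lambda>c. \<tau> * (c / \<epsilon>\<^sup>2) * H \<psi>)"
  note te = test_evolution[OF m mm(1), folded \<psi>_def D_def]
  have b\<psi>: "bm \<psi>" using te(2) by auto
  have gD: "gf D \<psi> = 3/4 * (gf (\<phi> (Suc (Suc (Suc m)))) \<psi> - gf (\<phi> (Suc (Suc m))) \<psi>) + 1/4 * (gf (\<phi> (Suc m)) \<psi> - gf (\<phi> m) \<psi>)"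
    unfolding D_def gf_linear[OF d_S[OF m] d_S[OF mm(1)] te(2)]
      gf_diff[OF phi_S[OF ml(4)] phi_S[OF ml(3)] te(2)] gf_diff[OF phi_S[OF ml(2)] phi_S[OF ml(1)] te(2)] ..
  have id: "ip (d (Suc m)) \<psi> = ip (\<phi> (Suc (Suc m))) \<psi> - ip (\<phi> (Suc m)) \<psi>" "ip (d m) \<psi> = ip (\<phi> (Suc m)) \<psi> - ip (\<phi> m) \<psi>"
    by (rule ip_diff[OF bm_phi[OF ml(3)] bm_phi[OF ml(2)] b\<psi>], rule ip_diff[OF bm_phi[OF ml(2)] bm_phi[OF ml(1)] b\<psi>])
  have h1: "ip (\<mu> (Suc (Suc m))) \<psi> - ip (\<mu> (Suc m)) \<psi> = \<epsilon> * gf D \<psi> + r"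
    unfolding r_def gD id potential_Suc[OF m te(2)] potential_Suc[OF mm(2) te(2)]
    by (simp add: add_divide_distrib diff_divide_distrib algebra_simps)
  have main: "1/2 * (ip (\<mu> (Suc (Suc m))) (\<mu> (Suc (Suc m))) - ip (\<mu> (Suc m)) (\<mu> (Suc m)))
    + 1/8 * (ip (\<lambda>x. \<mu> (Suc (Suc m)) x - \<mu> (Suc m) x) (\<lambda>x. \<mu> (Suc (Suc m)) x - \<mu> (Suc m) x)
      - ip (\<lambda>x. \<mu> (Suc m) x - \<mu> m x) (\<lambda>x. \<mu> (Suc m) x - \<mu> m x)) + ip D D / \<tau> \<le> r"
    by (rule telescoping_test[OF mu_S[OF m] mu_S[OF mm(2)] mu_S[OF mm(1)] te(1) eps tau, folded \<psi>_def, OF h1 te(3)])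
  have "1/\<epsilon> * (ip (X (Suc (Suc m))) \<psi> - ip (X (Suc m)) \<psi>) \<le> 1/48 * (x (Suc (Suc m)) + x (Suc m)) + T (216 * (N6 + Cs))"
    unfolding T_def by (rule chi_remainder[OF m te(2)])
  moreover have "(- 3/(2*\<epsilon>)) * ip (d (Suc m)) \<psi> \<le> 1/48 * x (Suc m) + T 27"
  proof -
    have "(- 3/(2*\<epsilon>)) * ip (d (Suc m)) \<psi> \<le> 1/48 * x (Suc m) + \<tau> * (- 3/(2*\<epsilon>))\<^sup>2 / (4 * (1/48)) * ip \<psi> \<psi>"
      by (rule weighted_young[OF bm_d[OF mm(2)] b\<psi>]) simp
    also have "\<tau> * (- 3/(2*\<epsilon>))\<^sup>2 / (4 * (1/48)) = \<tau> * (27 / \<epsilon>\<^sup>2)" by (simp add: power_divide power_mult_distrib)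
    also have "1/48 * x (Suc m) + \<tau> * (27 / \<epsilon>\<^sup>2) * ip \<psi> \<psi> \<le> 1/48 * x (Suc m) + \<tau> * (27 / \<epsilon>\<^sup>2) * H \<psi>"
      using tau by (intro add_left_mono mult_left_mono) auto
    finally show ?thesis by (simp only: T_def)
  qed
  moreover have "(1/(2*\<epsilon>)) * ip (d m) \<psi> \<le> 1/24 * x m + T 2"
  proof -
    have "(1/(2*\<epsilon>)) * ip (d m) \<psi> \<le> 1/24 * x m + \<tau> * (1/(2*\<epsilon>))\<^sup>2 / (4 * (1/24)) * ip \<psi> \<psi>"
      by (rule weighted_young[OF bm_d[OF mm(1)] b\<psi>]) simp
    also have "\<tau> * (1/(2*\<epsilon>))\<^sup>2 / (4 * (1/24)) = \<tau> * (3 / 2 / \<epsilon>\<^sup>2)" by (simp add: power_divide power_mult_distrib)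
    also have "1/24 * x m + \<tau> * (3 / 2 / \<epsilon>\<^sup>2) * ip \<psi> \<psi> \<le> 1/24 * x m + \<tau> * (2 / \<epsilon>\<^sup>2) * H \<psi>"
      using tau eps by (intro add_left_mono mult_mono mult_left_mono divide_right_mono) auto
    finally show ?thesis by (simp only: T_def)
  qed
  moreover have "T (216 * (N6 + Cs)) + T 27 + T 2 = \<tau> * (Kr * H \<psi>)"
    unfolding Kr_def T_def by (simp add: add_divide_distrib algebra_simps)
  moreover have "\<tau> * (Kr * H \<psi>) \<le> \<tau> * (KC * (1 + gf (\<mu> (Suc (Suc m))) (\<mu> (Suc (Suc m))) + gf (\<mu> m) (\<mu> m)))"
    unfolding \<psi>_def using tau by (intro mult_left_mono test_norm_bound m mm) auto
  ultimately have "r \<le> 1/48 * x (Suc (Suc m)) + 1/24 * x (Suc m) + 1/24 * x m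
      + KC * \<tau> * (1 + gf (\<mu> (Suc (Suc m))) (\<mu> (Suc (Suc m))) + gf (\<mu> m) (\<mu> m))"
    unfolding r_def mult.commute[of KC \<tau>] mult.assoc[of \<tau> KC] by argo
  moreover have "x (Suc (Suc m)) \<ge> 0" using tau by simp
  ultimately show ?thesis using main te(4) by argo
qed

text \<open>Despite the other weights of the first step, the gradient terms again differ by
  \<open>D\<close>, since \<open>3/4 \<phi>2 + 1/4 \<phi>0 - 1/2 \<phi>1 - 1/2 \<phi>0\<close> is
  \<open>3/4\<close> of the second increment plus \<open>1/4\<close> of the first. The term with
  \<open>l\<mu>\<close> takes 1/8 of the new squared norm, so 3/8 instead of 1/2 remains.\<close>

lemma first_potential_step:
  assumes m: "Suc 0 < N"
  shows "3/8 * ip (\<mu> (Suc 0)) (\<mu> (Suc 0)) + 1/8 * ip (\<lambda>x. \<mu> (Suc 0) x - \<mu> 0 x) (\<lambda>x. \<mu> (Suc 0) x - \<mu> 0 x)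
    + 1/3 * x (Suc 0) \<le> 2 * KA + C0 + KC * \<tau> * (1 + gf (\<mu> (Suc 0)) (\<mu> (Suc 0)) + gf (\<mu> 0) (\<mu> 0))"
proof -
  have mm: "0 < N" using m by auto
  have ml: "0 \<le> N" "Suc 0 \<le> N" "Suc (Suc 0) \<le> N" using m by auto
  define \<psi> where "\<psi> = (\<lambda>x. 3/4 * \<mu> (Suc 0) x + 1/4 * \<mu> 0 x)"
  define D where "D = (\<lambda>x. 3/4 * d (Suc 0) x + 1/4 * d 0 x)"
  define r where "r = 1/\<epsilon> * (ip (X (Suc 0)) \<psi> - ip (X 0) \<psi>) + (- 3/(2*\<epsilon>)) * ip (d 0) \<psi> + \<tau>/2 * ip l\<mu> \<psi>"
  define T where "T = (\<lambda>c. \<tau> * (c / \<epsilon>\<^sup>2) * H \<psi>)"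
  note te = test_evolution[OF m mm, folded \<psi>_def D_def]
  have b\<psi>: "bm \<psi>" using te(2) by auto
  have gD: "gf D \<psi> = 3/4 * (gf (\<phi> (Suc (Suc 0))) \<psi> - gf (\<phi> (Suc 0)) \<psi>) + 1/4 * (gf (\<phi> (Suc 0)) \<psi> - gf (\<phi> 0) \<psi>)"
    unfolding D_def gf_linear[OF d_S[OF m] d_S[OF mm] te(2)]
      gf_diff[OF phi_S[OF ml(3)] phi_S[OF ml(2)] te(2)] gf_diff[OF phi_S[OF ml(2)] phi_S[OF ml(1)] te(2)] ..
  have id: "ip (d 0) \<psi> = ip (\<phi> (Suc 0)) \<psi> - ip (\<phi> 0) \<psi>"
    by (rule ip_diff[OF bm_phi[OF ml(2)] bm_phi[OF ml(1)] b\<psi>])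
  have h1: "ip (\<mu> (Suc 0)) \<psi> - ip (\<mu> 0) \<psi> = \<epsilon> * gf D \<psi> + r"
    unfolding r_def gD id potential_Suc[OF m te(2)] potential_0[OF te(2)]
    by (simp add: add_divide_distrib diff_divide_distrib algebra_simps)
  \<comment> \<open>\<open>\<mu> 0\<close> is used for both older levels, so the old increment is
    zero.\<close>
  have main: "1/2 * (ip (\<mu> (Suc 0)) (\<mu> (Suc 0)) - ip (\<mu> 0) (\<mu> 0))
    + 1/8 * (ip (\<lambda>x. \<mu> (Suc 0) x - \<mu> 0 x) (\<lambda>x. \<mu> (Suc 0) x - \<mu> 0 x)
      - ip (\<lambda>x. \<mu> 0 x - \<mu> 0 x) (\<lambda>x. \<mu> 0 x - \<mu> 0 x)) + ip D D / \<tau> \<le> r"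
    by (rule telescoping_test[OF mu_S[OF m] mu_S[OF mm] mu_S[OF mm] te(1) eps tau, folded \<psi>_def, OF h1 te(3)])
  have z: "ip (\<lambda>x. \<mu> 0 x - \<mu> 0 x) (\<lambda>x. \<mu> 0 x - \<mu> 0 x) = 0" by (simp add: L2_inner_def)
  have "1/\<epsilon> * (ip (X (Suc 0)) \<psi> - ip (X 0) \<psi>) \<le> 1/48 * (x (Suc 0) + x 0) + T (216 * (N6 + Cs))"
    unfolding T_def by (rule chi_remainder[OF m te(2)])
  moreover have "(- 3/(2*\<epsilon>)) * ip (d 0) \<psi> \<le> 1/48 * x 0 + T 29"
  proof -
    have "(- 3/(2*\<epsilon>)) * ip (d 0) \<psi> \<le> 1/48 * x 0 + \<tau> * (- 3/(2*\<epsilon>))\<^sup>2 / (4 * (1/48)) * ip \<psi> \<psi>"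
      by (rule weighted_young[OF bm_d[OF mm] b\<psi>]) simp
    also have "\<tau> * (- 3/(2*\<epsilon>))\<^sup>2 / (4 * (1/48)) = \<tau> * (27 / \<epsilon>\<^sup>2)" by (simp add: power_divide power_mult_distrib)
    also have "1/48 * x 0 + \<tau> * (27 / \<epsilon>\<^sup>2) * ip \<psi> \<psi> \<le> 1/48 * x 0 + \<tau> * (29 / \<epsilon>\<^sup>2) * H \<psi>"
      using tau eps by (intro add_left_mono mult_mono mult_left_mono divide_right_mono) auto
    finally show ?thesis by (simp only: T_def)
  qed
  moreover have "\<tau>/2 * ip l\<mu> \<psi> \<le> C0 / 2 + 1/8 * (ip (\<mu> (Suc 0)) (\<mu> (Suc 0)) + ip (\<mu> 0) (\<mu> 0))"
  proof -
    have y: "\<tau>/2 * ip l\<mu> \<psi> \<le> 2 * (\<tau>/2)\<^sup>2 * ip l\<mu> l\<mu> + 1/8 * ip \<psi> \<psi>"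
      by (rule ip_scaled_young) (use lap_S b\<psi> in auto)
    have c: "2 * (\<tau>/2)\<^sup>2 * ip l\<mu> l\<mu> \<le> C0 / 2" using init_bounds(2) by (simp add: power_divide)
    have "ip \<psi> \<psi> \<le> ip (\<mu> (Suc 0)) (\<mu> (Suc 0)) + ip (\<mu> 0) (\<mu> 0)"
      unfolding \<psi>_def by (rule combination_le(1)[OF mu_S[OF m] mu_S[OF mm]])
    then have "1/8 * ip \<psi> \<psi> \<le> 1/8 * (ip (\<mu> (Suc 0)) (\<mu> (Suc 0)) + ip (\<mu> 0) (\<mu> 0))" by simp
    from order_trans[OF y add_mono[OF c this]] show ?thesis .
  qed
  moreover have "T (216 * (N6 + Cs)) + T 29 = \<tau> * (Kr * H \<psi>)"
    unfolding Kr_def T_def by (simp add: add_divide_distrib algebra_simps)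
  moreover have "\<tau> * (Kr * H \<psi>) \<le> \<tau> * (KC * (1 + gf (\<mu> (Suc 0)) (\<mu> (Suc 0)) + gf (\<mu> 0) (\<mu> 0)))"
    unfolding \<psi>_def using tau by (intro mult_left_mono test_norm_bound m mm) auto
  ultimately have "r \<le> 1/48 * x (Suc 0) + 1/24 * x 0 + C0 / 2 + 1/8 * (ip (\<mu> (Suc 0)) (\<mu> (Suc 0)) + ip (\<mu> 0) (\<mu> 0))
      + KC * \<tau> * (1 + gf (\<mu> (Suc 0)) (\<mu> (Suc 0)) + gf (\<mu> 0) (\<mu> 0))"
    unfolding r_def mult.commute[of KC \<tau>] mult.assoc[of \<tau> KC] by argo
  moreover have "x (Suc 0) \<ge> 0" using tau by simp
  ultimately show ?thesis using main te(4) first_potential_bound C0 KA_nonneg unfolding z by argo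
qed

text \<open>One constant large enough for every use of \<open>K\<close> in
  \<open>discrete_summation\<close>: initial values, gradient sum and both recursions.\<close>

definition K :: real where "K = 2 * KA + C0 + KC + E1 / \<epsilon>"

lemma scheme_estimates:
  "(\<Sum>j<N. x j) \<le> 56 * (K + K\<^sup>2) * (\<tau> * N + 1)"
  "m < N \<Longrightarrow> ip (\<mu> m) (\<mu> m) \<le> 56 * (K + K\<^sup>2) * (\<tau> * N + 1)"
proof -
  have nn: "KA \<ge> 0" "KC \<ge> 0" "E1 / \<epsilon> \<ge> 0" "C0 \<ge> 0"
    using KA_nonneg KC_nonneg E1_ge eps C0 by auto
  have le: "KC * \<tau> * z \<le> K * \<tau> * z" if "z \<ge> 0" for z
    using nn tau that by (intro mult_right_mono) (auto simp: K_def)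
  \<comment> \<open>At \<open>m = 0\<close> truncated subtraction gives the increment 0; the
    recursion uses \<open>B\<close> only from index 1 on.\<close>
  define B where "B = (\<lambda>m. ip (\<lambda>x. \<mu> m x - \<mu> (m - 1) x) (\<lambda>x. \<mu> m x - \<mu> (m - 1) x))"
  have h1: "3/8 * ip (\<mu> 1) (\<mu> 1) + 1/8 * B 1 + 1/3 * x 1 \<le> K + K * \<tau> * (1 + gf (\<mu> 1) (\<mu> 1) + gf (\<mu> 0) (\<mu> 0))"
    if "1 < N"
    using first_potential_step that le[of "1 + gf (\<mu> 1) (\<mu> 1) + gf (\<mu> 0) (\<mu> 0)"] nn
    by (simp add: B_def K_def)
  have h2: "1/2 * (ip (\<mu> (Suc (Suc m))) (\<mu> (Suc (Suc m))) - ip (\<mu> (Suc m)) (\<mu> (Suc m)))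
      + 1/8 * (B (Suc (Suc m)) - B (Suc m)) + 1/3 * x (Suc (Suc m))
      \<le> 1/24 * x (Suc m) + 1/6 * x m + K * \<tau> * (1 + gf (\<mu> (Suc (Suc m))) (\<mu> (Suc (Suc m))) + gf (\<mu> m) (\<mu> m))"
    if "Suc (Suc m) < N" for m
    using potential_step[OF that] le[of "1 + gf (\<mu> (Suc (Suc m))) (\<mu> (Suc (Suc m))) + gf (\<mu> m) (\<mu> m)"]
    by (simp add: B_def)
  have K: "K \<ge> 0" "KA \<le> K" "E1 / \<epsilon> \<le> K" using nn by (auto simp: K_def)
  have init: "ip (\<mu> 0) (\<mu> 0) \<le> K" "x 0 \<le> K" "\<tau> * (\<Sum>j<N. gf (\<mu> j) (\<mu> j)) \<le> K"
    using first_potential_bound sum_gf_mu K by linarith+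
  have nonneg: "B m \<ge> 0" "x m \<ge> 0" for m using tau by (auto simp: B_def)
  note summation = discrete_summation[of "\<lambda>m. ip (\<mu> m) (\<mu> m)" B x "\<lambda>m. gf (\<mu> m) (\<mu> m)",
      OF ip_nonneg nonneg gf_nonneg tau K(1) N init h1 h2]
  show "(\<Sum>j<N. x j) \<le> 56 * (K + K\<^sup>2) * (\<tau> * N + 1)" by (rule summation(1))
  show "m < N \<Longrightarrow> ip (\<mu> m) (\<mu> m) \<le> 56 * (K + K\<^sup>2) * (\<tau> * N + 1)" by (rule summation(2))
qed

end

section \<open>From conforming meshes and Ritz projections to the abstract setting\<close>

lemma mesh_if_conforming:
  fixes \<Omega> :: "(real^'n) set"
  assumes "polyhedral_domain \<Omega>" "conforming_mesh \<Omega> \<K>"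
  shows "mesh \<Omega> \<K>"
proof -
  have tri: "finite \<K>" "\<Union>\<K> = closure \<Omega>" "\<And>T. T \<in> \<K> \<Longrightarrow> int CARD('n) simplex T"
    using assms(2) by (simp_all add: conforming_mesh_def triangulation_def)
  have dom: "open \<Omega>" "interior (closure \<Omega>) = \<Omega>"
    using assms(1) unfolding polyhedral_domain_def by blast+
  have compact: "compact T" "convex T" if "T \<in> \<K>" for T
    using tri(3)[OF that] compact_simplex convex_simplex by blast+
  show ?thesis
  proof
    have "bounded (\<Union>\<K>)" using tri(1) compact compact_imp_bounded by (intro bounded_Union) auto
    then show "bounded \<Omega>" unfolding tri(2) by (rule bounded_subset[OF _ closure_subset])
    show "\<Omega> \<subseteq> \<Union>\<K>" unfolding tri(2) by (rule closure_subset)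
    \<comment> \<open>The interior of a cell lies in \<open>interior (closure \<Omega>)\<close>,
      which is \<open>\<Omega>\<close> because slits and punctures are excluded.\<close>
    show "interior T \<subseteq> \<Omega>" if "T \<in> \<K>" for T
    proof -
      have "interior T \<subseteq> interior (closure \<Omega>)" using that tri(2) by (intro interior_mono) auto
      then show ?thesis by (simp add: dom)
    qed
  qed (use dom tri compact in auto)
qed

theorem lemma2p8:
  fixes \<Omega> :: "(real^'n) set" and \<epsilon> \<sigma> \<kappa> C0 :: real and q :: nat
  assumes "CARD('n) \<in> {2, 3}"
    and "polyhedral_domain \<Omega>"
    and "\<epsilon> > 0" and "q \<ge> 1" and "C0 > 0"
  shows "\<exists>C>0. \<forall>(H :: real set) (\<T> :: real \<Rightarrow> (real^'n) set set) (\<phi>0 :: real^'n \<Rightarrow> real).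
    regular_mesh_family \<Omega> \<sigma> \<kappa> H \<T> \<longrightarrow>
    \<phi>0 \<in> H2 \<Omega> \<longrightarrow> zero_normal_derivative \<Omega> \<phi>0 \<longrightarrow> chemical_potential \<Omega> \<epsilon> \<phi>0 \<in> H1 \<Omega> \<longrightarrow>
    (\<forall>h\<in>H. \<forall>(T :: real) (M :: nat) (\<tau> :: real) Sh
        (\<phi> :: nat \<Rightarrow> real^'n \<Rightarrow> real)  \<comment> \<open>\<open>\<phi> m\<close> is the phase field at time level \<open>m\<close>\<close>
        (\<mu>0 :: real^'n \<Rightarrow> real)
        (\<mu> :: nat \<Rightarrow> real^'n \<Rightarrow> real)  \<comment> \<open>\<open>\<mu> m\<close> is the chemical potential at time level \<open>m + 1/2\<close>\<close>
        (lap_\<phi>0 :: real^'n \<Rightarrow> real) (lap_\<mu>0 :: real^'n \<Rightarrow> real).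
      T > 0 \<longrightarrow> M \<ge> 1 \<longrightarrow> \<tau> = T / real M \<longrightarrow> Sh = fe_space \<Omega> (\<T> h) q \<longrightarrow>
      is_ritz_projection \<Omega> Sh \<phi>0 (\<phi> 0) \<longrightarrow>
      is_ritz_projection \<Omega> Sh (chemical_potential \<Omega> \<epsilon> \<phi>0) \<mu>0 \<longrightarrow>
      first_step_solution \<Omega> Sh \<epsilon> \<tau> (\<phi> 0) \<mu>0 (\<phi> 1) (\<mu> 0) \<longrightarrow>
      (\<forall>m. 1 \<le> m \<and> m \<le> M - 1 \<longrightarrow>
         multistep_solution \<Omega> Sh \<epsilon> \<tau> (\<phi> (m - 1)) (\<phi> m) (\<phi> (m + 1)) (\<mu> m)) \<longrightarrow>
      is_discrete_laplacian \<Omega> Sh (\<phi> 0) lap_\<phi>0 \<longrightarrow>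
      is_discrete_laplacian \<Omega> Sh \<mu>0 lap_\<mu>0 \<longrightarrow>
      energy \<Omega> \<epsilon> (\<phi> 0) + \<tau>\<^sup>2 * (L2_norm \<Omega> lap_\<mu>0)\<^sup>2 + (L2_norm \<Omega> lap_\<phi>0)\<^sup>2 \<le> C0 \<longrightarrow>
      (L2_norm \<Omega> \<mu>0)\<^sup>2 \<le> C0 \<longrightarrow>
      \<tau> * (\<Sum>m = 0..M - 1. (L2_norm \<Omega> (\<lambda>x. (\<phi> (m + 1) x - \<phi> m x) / \<tau>))\<^sup>2) \<le> C * (T + 1) \<and>
      (MAX m \<in> {0..M - 1}. (L2_norm \<Omega> (\<mu> m))\<^sup>2) \<le> C * (T + 1))"
proof -
  obtain Cs where Cs: "Cs > 0" and sob: "\<And>\<K> q u. mesh \<Omega> \<K> \<Longrightarrow> u \<in> mesh.S \<Omega> \<K> q \<Longrightarrow>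
      (LINT x|lebesgue_on \<Omega>. u x ^ 6) \<le> Cs * (L2_inner \<Omega> u u + grad_form \<Omega> u u) ^ 3"
    using sobolev_inequality[OF assms(1,2)] by blast
  \<comment> \<open>Fixed before mesh, time step and solution are introduced. The sign of
    \<open>c\<close> is only known inside the locale, so \<open>C\<close> uses its absolute value,
    and the added 1 ensures positivity.\<close>
  define c where "c = scheme.K \<Omega> \<epsilon> C0 Cs"
  define C where "C = 56 * (\<bar>c\<bar> + c\<^sup>2) + 1"
  have Cpos: "C > 0" unfolding C_def by (intro add_nonneg_pos mult_nonneg_nonneg) auto
  show ?thesis
  proof (rule exI[of _ C], rule conjI[OF Cpos], intro allI impI ballI conjI)
    fix H :: "real set" and \<T> :: "real \<Rightarrow> (real^'n) set set" and \<phi>0 :: "real^'n \<Rightarrow> real" and h T :: real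
      and M :: nat and \<tau> :: real and Sh :: "(real^'n \<Rightarrow> real) set" and \<phi> :: "nat \<Rightarrow> real^'n \<Rightarrow> real"
      and \<mu>0 :: "real^'n \<Rightarrow> real" and \<mu> :: "nat \<Rightarrow> real^'n \<Rightarrow> real" and lap_\<phi>0 lap_\<mu>0 :: "real^'n \<Rightarrow> real"
    assume mesh: "regular_mesh_family \<Omega> \<sigma> \<kappa> H \<T>" "h \<in> H"
      and T: "T > 0" "M \<ge> 1" "\<tau> = T / real M" and Sh: "Sh = fe_space \<Omega> (\<T> h) q"
      and ritz: "is_ritz_projection \<Omega> Sh \<phi>0 (\<phi> 0)"
      and first: "first_step_solution \<Omega> Sh \<epsilon> \<tau> (\<phi> 0) \<mu>0 (\<phi> 1) (\<mu> 0)"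
      and multi: "\<forall>m. 1 \<le> m \<and> m \<le> M - 1 \<longrightarrow>
         multistep_solution \<Omega> Sh \<epsilon> \<tau> (\<phi> (m - 1)) (\<phi> m) (\<phi> (m + 1)) (\<mu> m)"
      and lap: "is_discrete_laplacian \<Omega> Sh (\<phi> 0) lap_\<phi>0" "is_discrete_laplacian \<Omega> Sh \<mu>0 lap_\<mu>0"
      and init: "energy \<Omega> \<epsilon> (\<phi> 0) + \<tau>\<^sup>2 * (L2_norm \<Omega> lap_\<mu>0)\<^sup>2 + (L2_norm \<Omega> lap_\<phi>0)\<^sup>2 \<le> C0"
    have mesh_h: "mesh \<Omega> (\<T> h)"
      using mesh by (intro mesh_if_conforming[OF assms(2)]) (auto simp: regular_mesh_family_def)
    interpret mesh \<Omega> "\<T> h" q by (rule mesh_h)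
    have norm: "(L2_norm \<Omega> u)\<^sup>2 = ip u u" for u
      unfolding L2_norm_def by (rule real_sqrt_pow2) simp
    have ShS: "Sh = S" by (simp add: Sh S_def)
    interpret scheme \<Omega> "\<T> h" q \<epsilon> \<tau> C0 Cs M \<phi> \<mu> \<mu>0 lap_\<phi>0 lap_\<mu>0
    proof
      show "\<phi> 0 \<in> S" using ritz by (simp add: is_ritz_projection_def ShS)
      show "energy \<Omega> \<epsilon> (\<phi> 0) + \<tau>\<^sup>2 * ip lap_\<mu>0 lap_\<mu>0 + ip lap_\<phi>0 lap_\<phi>0 \<le> C0"
        using init by (simp add: norm)
      show "(LINT x|lebesgue_on \<Omega>. u x ^ 6) \<le> Cs * (ip u u + gf u u) ^ 3" if "u \<in> S" for u
        by (rule sob[OF mesh_h that])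
      show "multistep_solution \<Omega> S \<epsilon> \<tau> (\<phi> (m - 1)) (\<phi> m) (\<phi> (m + 1)) (\<mu> m)" if "1 \<le> m" "m \<le> M - 1" for m
        using multi that by (simp add: ShS)
    qed (use assms T Cs first lap in \<open>simp_all add: ShS\<close>)
    have "\<tau> * real M = T" using T by simp
    moreover have "56 * (c + c\<^sup>2) * (T + 1) \<le> C * (T + 1)"
      unfolding C_def using T(1) abs_ge_self[of c] by (intro mult_right_mono) auto
    ultimately have Kle: "56 * (K + K\<^sup>2) * (\<tau> * real M + 1) \<le> C * (T + 1)"
      by (simp only: c_def)
    have le: "(\<Sum>j<M. x j) \<le> C * (T + 1)" "\<And>m. m < M \<Longrightarrow> ip (\<mu> m) (\<mu> m) \<le> C * (T + 1)"
      using order_trans[OF scheme_estimates(1) Kle] order_trans[OF scheme_estimates(2) Kle] by simp_all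
    have sets: "{0..M - 1} = {..<M}" using T(2) by auto
    have "\<tau> * (L2_norm \<Omega> (\<lambda>x. (\<phi> (m + 1) x - \<phi> m x) / \<tau>))\<^sup>2 = x m" for m
    proof -
      have "(L2_norm \<Omega> (\<lambda>x. (\<phi> (m + 1) x - \<phi> m x) / \<tau>))\<^sup>2 = ip (d m) (d m) / (\<tau> * \<tau>)"
        unfolding norm L2_inner_def by simp
      then show ?thesis using tau by simp
    qed
    then show "\<tau> * (\<Sum>m = 0..M - 1. (L2_norm \<Omega> (\<lambda>x. (\<phi> (m + 1) x - \<phi> m x) / \<tau>))\<^sup>2) \<le> C * (T + 1)"
      using le(1) unfolding sets sum_distrib_left by simp
    show "(MAX m \<in> {0..M - 1}. (L2_norm \<Omega> (\<mu> m))\<^sup>2) \<le> C * (T + 1)"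
      unfolding sets norm using le(2) T(2) by (subst Max_le_iff) (auto simp: lessThan_empty_iff)
  qed
qed

end
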